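(* In dynamic rings without chirality, without cross detection, and whose size $n$ is known to the agents, Gathering is solvable from all initial configurations $C\in\mathcal{C}\setminus(\mathcal{P}\cup\mathcal{E})$. Moreover, there exists an algorithm solving Gathering that terminates in $\mathcal{O}(n^2)$ rounds for any $C\in\mathcal{C}\setminus(\mathcal{P}\cup\mathcal{E})$; if $C\in\mathcal{P}\cup\mathcal{E}$ the algorithm either solves Gathering or it detects that the configuration is in $\mathcal{P}\cup\mathcal{E}$.
   Context: Dynamic ring. $\mathcal{R}=(v_0,\dots,v_{n-1})$ is a ring of $n$ anonymous nodes; $v_i$ is joined to $v_{i-1}$ and $v_{i+1}$ (indices modulo $n$) through two distinctly labeled ports $q_{i-}$, $q_{i+}$; the labeling is arbitrary and need not give a globally consistent orientation. Each port has an incoming and an outgoing buffer. Time proceeds in synchronous rounds; in each round an adversarial scheduler, not restricted by any fairness assumption, chooses which edge (at most one) is missing (1-interval connectivity). Agents. There are $k$ anonymous agents, each with its own memory and computational capability, all executing the same deterministic protocol. They start at distinct nodes, called homebases; homebases are identically marked, so an agent can tell whether its current node is a homebase. Several agents may be in the same node; an agent sees how many other agents are in its node and where (at the node, in which incoming or outgoing buffer). Agents have no explicit communication. Each agent has a private orientation of the ring, consistent over all nodes, designating at each node one port as left and the other as right; different agents may have different orientations. There is chirality if all agents are guaranteed to agree on the orientation; without chirality there is no such guarantee. Cross detection would mean that, whenever agents move in opposite directions on the same edge in the same round, the involved agents detect this event; without it they do not. Rounds. In each round each agent, based on the number of agents at its node and in the buffers, its memory and its state, chooses a direction in $\{left,right,nil\}$.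 With $nil$ it places itself at the node. Otherwise it moves to the outgoing buffer of the chosen port; if the edge is present, it arrives in the incoming buffer of the corresponding port of the neighbouring node in the next round; if the edge is missing it stays in the outgoing buffer. There is an initial state and a terminal state. Gathering. Gathering is achieved in a round if all agents are on the same node or on two neighbouring nodes. An algorithm solves Gathering from a configuration if, for every adversarial schedule and every admissible choice of port labels and private orientations, within finite time all agents are in the terminal state, are gathered, and are aware that gathering has been achieved. Configurations. A configuration is the set of locations of the $k$ homebases in the ring; $\mathcal{C}$ is the set of all configurations. Let $h_0,\dots,h_{k-1}$ be the homebases in clockwise order and $d_i$ the number of edges between $h_i$ and $h_{i+1}$ (indices modulo $k$). The configuration is periodic if there is $p$ with $p\mid k$, $p<k$, and $d_i=d_{i+p}$ for all $i$; $\mathcal{P}$ is the set of periodic configurations. Let $\delta^{+j}=\langle d_j,d_{j+1},\dots,d_{j+k-1}\rangle$ and $\delta^{-j}=\langle d_{j-1},d_{j-2},\dots,d_{j-k}\rangle$, and let $\delta_{min}$ be the lexicographically minimum sequence among all $\delta^{+j},\delta^{-j}$, $0\le j\le k-1$. A non-periodic configuration is double-palindrome if $\delta_{min}=\delta^{+i}=\delta^{-j}$ with $i\ne j$; it then has a unique axis of symmetry, equidistant from $h_i$ and $h_j$. If this axis passes through two edges (i.e. the two distances along the ring between $h_i$ and $h_j$ are both odd) the configuration is edge-edge; $\mathcal{E}$ is the set of edge-edge configurations. *)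

theory Defs
  imports Complex_Main "HOL-Library.List_Lexorder" "HOL-Library.Landau_Symbols"
begin

text \<open>
  The nodes of the ring of size \<open>n\<close> are \<open>0, \<dots>, n - 1\<close> in clockwise order. A configuration is
  the nonempty set \<open>H\<close> of homebases, so the number of agents is \<open>k = card H\<close>.
\<close>

definition configurations :: "nat \<Rightarrow> nat set set" where
  "configurations n = {H. H \<subseteq> {..<n} \<and> H \<noteq> {}}"

definition homebase :: "nat set \<Rightarrow> nat \<Rightarrow> nat" where
  "homebase H i = sorted_list_of_set H ! i"

text \<open>Clockwise gap after the \<open>i\<close>-th homebase, for \<open>i < k\<close>; it is \<open>n\<close> if \<open>k = 1\<close>.\<close>

definition gap :: "nat \<Rightarrow> nat set \<Rightarrow> nat \<Rightarrow> nat" where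
  "gap n H i =
     (if Suc i < card H then homebase H (Suc i) - homebase H i
      else homebase H 0 + n - homebase H i)"

definition periodic :: "nat \<Rightarrow> nat set \<Rightarrow> bool" where
  "periodic n H \<longleftrightarrow>
     (\<exists>p. p dvd card H \<and> p < card H \<and> (\<forall>i<card H. gap n H i = gap n H ((i + p) mod card H)))"

text \<open>
  The sequences \<open>d\<^sub>j, d\<^sub>j\<^sub>+\<^sub>1, \<dots>\<close> and \<open>d\<^sub>j\<^sub>-\<^sub>1, d\<^sub>j\<^sub>-\<^sub>2, \<dots>\<close>, each of length \<open>k\<close>, for \<open>j < k\<close>;
  adding \<open>k\<close> keeps the index of the second one nonnegative before reduction.
\<close>

definition seq_plus :: "nat \<Rightarrow> nat set \<Rightarrow> nat \<Rightarrow> nat list" where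
  "seq_plus n H j = map (\<lambda>m. gap n H ((j + m) mod card H)) [0..<card H]"

definition seq_minus :: "nat \<Rightarrow> nat set \<Rightarrow> nat \<Rightarrow> nat list" where
  "seq_minus n H j = map (\<lambda>m. gap n H ((j + card H - Suc m) mod card H)) [0..<card H]"

text \<open>The order on lists is the lexicographic one.\<close>

definition seq_min :: "nat \<Rightarrow> nat set \<Rightarrow> nat list" where
  "seq_min n H = Min (seq_plus n H ` {..<card H} \<union> seq_minus n H ` {..<card H})"

definition palindrome_pair :: "nat \<Rightarrow> nat set \<Rightarrow> nat \<Rightarrow> nat \<Rightarrow> bool" where
  "palindrome_pair n H i j \<longleftrightarrow>
     i < card H \<and> j < card H \<and> i \<noteq> j \<and> seq_min n H = seq_plus n H i \<and> seq_min n H = seq_minus n H j"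

definition double_palindrome :: "nat \<Rightarrow> nat set \<Rightarrow> bool" where
  "double_palindrome n H \<longleftrightarrow> \<not> periodic n H \<and> (\<exists>i j. palindrome_pair n H i j)"

definition cw_distance :: "nat \<Rightarrow> nat \<Rightarrow> nat \<Rightarrow> nat" where
  "cw_distance n u v = (v + n - u) mod n"

definition edge_edge :: "nat \<Rightarrow> nat set \<Rightarrow> bool" where
  "edge_edge n H \<longleftrightarrow> double_palindrome n H \<and>
     (\<exists>i j. palindrome_pair n H i j \<and>
        odd (cw_distance n (homebase H i) (homebase H j)) \<and>
        odd (cw_distance n (homebase H j) (homebase H i)))"

definition periodic_configs :: "nat \<Rightarrow> nat set set" where
  "periodic_configs n = {H \<in> configurations n. periodic n H}"

definition edge_edge_configs :: "nat \<Rightarrow> nat set set" where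
  "edge_edge_configs n = {H \<in> configurations n. edge_edge n H}"

datatype port = Port0 | Port1
datatype heading = Clockwise | Counterclockwise
datatype side = Left | Right

text \<open>Where inside a node an agent is: at the node proper or in a buffer of one of its ports.\<close>

datatype 'p place = AtNode | InBuf 'p | OutBuf 'p

text \<open>
  Everything an agent perceives at the beginning of a round, ports being named through its private
  orientation. There is no information about crossings, and none about port labels.
\<close>

record view =
  on_homebase :: bool
  own_place :: "side place"
  others :: "side place \<Rightarrow> nat"

text \<open>
  A terminated agent remembers what it has concluded: that gathering has been achieved, or that the
  initial configuration is periodic or edge-edge.
\<close>

datatype verdict = Gathering_Achieved | Config_Excluded
datatype 'm state = Active 'm | Term verdict

text \<open>The direction \<open>nil\<close> is \<open>None\<close>.\<close>

record 'm protocol =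
  init_mem :: 'm
  act :: "'m \<Rightarrow> view \<Rightarrow> 'm state \<times> side option"

fun decide :: "'m protocol \<Rightarrow> 'm state \<Rightarrow> view \<Rightarrow> 'm state \<times> side option" where
  "decide A (Active m) w = act A m w"
| "decide A (Term v) w = (Term v, None)"

text \<open>
  All the choices that are not under the control of the agents. Agents are identified, for
  bookkeeping only, with the homebase they start from. The port of node \<open>v\<close> labelled \<open>p\<close> leads to
  the neighbour of \<open>v\<close> in direction \<open>labelling v p\<close>; agent \<open>a\<close> calls that port
  \<open>orientation a v p\<close>. Edge \<open>e\<close> joins \<open>e\<close> and \<open>e + 1\<close> modulo \<open>n\<close>, and \<open>missing t\<close> is the edge absent
  in round \<open>t\<close>, if any.
\<close>

record scenario =
  ring_size :: nat
  homebases :: "nat set"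
  labelling :: "nat \<Rightarrow> port \<Rightarrow> heading"
  orientation :: "nat \<Rightarrow> nat \<Rightarrow> port \<Rightarrow> side"
  missing :: "nat \<Rightarrow> nat option"

text \<open>
  Labels are arbitrary at each node. An orientation is consistent if ports with the same heading
  are on the same side at all nodes; distinct agents may be oriented differently.
\<close>

definition scenarios :: "nat \<Rightarrow> nat set \<Rightarrow> scenario set" where
  "scenarios n H = {S.
     ring_size S = n \<and> homebases S = H \<and>
     (\<forall>v<n. bij (labelling S v)) \<and>
     (\<forall>a\<in>H. (\<forall>v<n. bij (orientation S a v)) \<and>
        (\<forall>u<n. \<forall>v<n. \<forall>p q. labelling S u p = labelling S v q \<longrightarrow>
           orientation S a u p = orientation S a v q)) \<and>
     (\<forall>t e. missing S t = Some e \<longrightarrow> e < n)}"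

fun opposite :: "heading \<Rightarrow> heading" where
  "opposite Clockwise = Counterclockwise"
| "opposite Counterclockwise = Clockwise"

fun neighbour :: "nat \<Rightarrow> nat \<Rightarrow> heading \<Rightarrow> nat" where
  "neighbour n v Clockwise = (v + 1) mod n"
| "neighbour n v Counterclockwise = (v + n - 1) mod n"

fun edge_towards :: "nat \<Rightarrow> nat \<Rightarrow> heading \<Rightarrow> nat" where
  "edge_towards n v Clockwise = v"
| "edge_towards n v Counterclockwise = (v + n - 1) mod n"

record 'm world =
  node_of :: "nat \<Rightarrow> nat"
  place_of :: "nat \<Rightarrow> port place"
  state_of :: "nat \<Rightarrow> 'm state"

definition initial_world :: "'m protocol \<Rightarrow> 'm world" where
  "initial_world A =
     \<lparr>node_of = (\<lambda>a. a), place_of = (\<lambda>a. AtNode), state_of = (\<lambda>a. Active (init_mem A))\<rparr>"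

definition view_of :: "scenario \<Rightarrow> 'm world \<Rightarrow> nat \<Rightarrow> view" where
  "view_of S w a =
     (let v = node_of w a; own_name = map_place (orientation S a v) in
      \<lparr>on_homebase = (v \<in> homebases S),
       own_place = own_name (place_of w a),
       others = (\<lambda>x. card {b \<in> homebases S. b \<noteq> a \<and> node_of w b = v \<and> own_name (place_of w b) = x})\<rparr>)"

definition move :: "scenario \<Rightarrow> nat \<Rightarrow> nat \<Rightarrow> nat \<Rightarrow> side option \<Rightarrow> nat \<times> port place" where
  "move S t a v d =
     (case d of
        None \<Rightarrow> (v, AtNode)
      | Some s \<Rightarrow>
          (let p = inv (orientation S a v) s; x = labelling S v p; u = neighbour (ring_size S) v x in
           if missing S t = Some (edge_towards (ring_size S) v x) then (v, OutBuf p)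
           else (u, InBuf (inv (labelling S u) (opposite x)))))"

definition round_step :: "scenario \<Rightarrow> 'm protocol \<Rightarrow> nat \<Rightarrow> 'm world \<Rightarrow> 'm world" where
  "round_step S A t w =
     (let choice = (\<lambda>a. decide A (state_of w a) (view_of S w a));
          dest = (\<lambda>a. move S t a (node_of w a) (snd (choice a)))
      in \<lparr>node_of = (\<lambda>a. fst (dest a)), place_of = (\<lambda>a. snd (dest a)), state_of = (\<lambda>a. fst (choice a))\<rparr>)"

primrec run :: "scenario \<Rightarrow> 'm protocol \<Rightarrow> nat \<Rightarrow> 'm world" where
  "run S A 0 = initial_world A"
| "run S A (Suc t) = round_step S A t (run S A t)"

text \<open>An agent in a buffer of a port of \<open>v\<close> is in the node \<open>v\<close>.\<close>

definition gathered :: "scenario \<Rightarrow> 'm world \<Rightarrow> bool" where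
  "gathered S w \<longleftrightarrow>
     (\<exists>v. \<forall>a\<in>homebases S. node_of w a = v) \<or>
     (\<exists>v x. \<forall>a\<in>homebases S. node_of w a \<in> {v, neighbour (ring_size S) v x})"

text \<open>Awareness is factive: nobody concludes that gathering has been achieved when it has not.\<close>

definition aware_correctly :: "scenario \<Rightarrow> 'm protocol \<Rightarrow> bool" where
  "aware_correctly S A \<longleftrightarrow>
     (\<forall>t. \<forall>a\<in>homebases S. state_of (run S A t) a = Term Gathering_Achieved \<longrightarrow> gathered S (run S A t))"

definition solved_at :: "scenario \<Rightarrow> 'm protocol \<Rightarrow> nat \<Rightarrow> bool" where
  "solved_at S A t \<longleftrightarrow>
     (\<forall>a\<in>homebases S. state_of (run S A t) a = Term Gathering_Achieved) \<and> gathered S (run S A t)"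

definition solves_in :: "scenario \<Rightarrow> 'm protocol \<Rightarrow> bool" where
  "solves_in S A \<longleftrightarrow> aware_correctly S A \<and> (\<exists>t. solved_at S A t)"

definition detects_in :: "scenario \<Rightarrow> 'm protocol \<Rightarrow> bool" where
  "detects_in S A \<longleftrightarrow> (\<exists>t. \<forall>a\<in>homebases S. state_of (run S A t) a = Term Config_Excluded)"

definition solves_gathering :: "nat \<Rightarrow> nat set \<Rightarrow> 'm protocol \<Rightarrow> bool" where
  "solves_gathering n H A \<longleftrightarrow> (\<forall>S\<in>scenarios n H. solves_in S A)"

definition terminates_within :: "nat \<Rightarrow> nat set \<Rightarrow> 'm protocol \<Rightarrow> nat \<Rightarrow> bool" where
  "terminates_within n H A T \<longleftrightarrow>
     (\<forall>S\<in>scenarios n H. \<exists>t\<le>T. \<forall>a\<in>H. \<exists>v. state_of (run S A t) a = Term v)"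

definition solves_or_detects :: "nat \<Rightarrow> nat set \<Rightarrow> 'm protocol \<Rightarrow> bool" where
  "solves_or_detects n H A \<longleftrightarrow> (\<forall>S\<in>scenarios n H. solves_in S A \<or> detects_in S A)"

end

theory Submission imports Defs "HOL-Library.Countable" begin

text \<open>
  In a first phase of \<open>O(n\<^sup>2)\<close> rounds every agent pushes in every round, an agent that has not yet made
  \<open>n\<close> moves (an unexplored one) always in the same direction. Only one edge is missing at a time, so an
  edge missing for \<open>n\<close> rounds has all agents at its two ends. An explored agent that is blocked probes
  once per window of \<open>4 * n\<close> rounds: it steps back and returns, and if it then finds that a companion
  has kept pushing, it stays with it, while otherwise it turns round. Hence, if an unexplored agent
  is blocked for two windows, all agents are at the ends of one edge and know that somebody pushes on
  either side; the first one to terminate is noticed by the others, as active agents are always in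
  buffers. If nobody terminates, then every unexplored agent moves at least once in three windows,
  and finally all agents know the configuration.

  In that case the agents elect a node \<open>z\<close> and an orientation. Configurations for which this is
  possible have no symmetry but, possibly, one reflection fixing \<open>z\<close>, and in the symmetric ones
  mirrored agents are given opposite orientations. If there is no such \<open>z\<close>, the configuration is
  periodic or edge-edge. Otherwise there are three stages of \<open>n\<close> rounds, based on the remark that
  of two separated groups that approach a common target from different sides, at most one is delayed
  in each round, so that within \<open>n\<close> rounds one arrives. The stages split the
  agents into a lower and an upper group with a common orientation of the segment \<open>0, \<dots>, n\<close> that
  results from cutting the ring at \<open>z\<close>. Finally, in phase \<open>m = 1, \<dots>, n\<close> the lower group walks up to
  \<open>m\<close> if it is below, the upper group walks down to \<open>m\<close> if it is above; by the same remark either the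
  groups meet, or end up as neighbours at \<open>m - 1\<close> and \<open>m\<close>, or the lower group has arrived and the
  next phase begins.
\<close>

section \<open>The model seen through headings\<close>

text \<open>The obstacle is termination without communication. Agents at the two ends of a missing
  edge do not see each other, and awareness must be factive in every round, so the first agent to
  stop needs the certainty that all others will stop before leaving the two nodes. Only a blocked
  unexplored agent starts an alarm. An end held by explored agents alone would therefore be
  dangerous: nobody there would ever stop of its own accord. The probes exclude this. Explored
  agents without an unexplored companion turn after the first window and, the edge being missing
  throughout, walk round to the other end, where the unexplored agent is; the second window lets
  them find it and stick to it. From then on every occupied end has an unexplored agent whose own
  delay is running. In the second half the obstacle is the lack of a common orientation. Each of the
  three stages is so designed that an arrival and the absence of arrivals are both informative: an
  arrival tells apart agents of opposite orientation that were together, and its absence proves that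
  those together are oriented alike.\<close>

fun opp :: "side \<Rightarrow> side" where
  "opp Left = Right"
| "opp Right = Left"

lemma opp_neq [simp]: "opp s \<noteq> s" "s \<noteq> opp s"
  by (cases s; simp)+

lemma opposite_opposite [simp]: "opposite (opposite h) = h"
  by (cases h) auto

lemma opposite_neq [simp]: "opposite h \<noteq> h" "h \<noteq> opposite h"
  by (cases h; simp)+

lemma opposite_inject [simp]: "opposite h = opposite h' \<longleftrightarrow> h = h'"
  by (cases h; cases h') auto

lemma heading_neq: "h \<noteq> h' \<longleftrightarrow> h' = opposite h"
  by (cases h; cases h') auto

lemma side_neq: "s \<noteq> s' \<longleftrightarrow> s' = opp s"
  by (cases s; cases s') auto

lemma neighbour_less: "0 < n \<Longrightarrow> neighbour n v h < n"
  by (cases h) auto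

lemma edge_towards_less: "0 < n \<Longrightarrow> v < n \<Longrightarrow> edge_towards n v h < n"
  by (cases h) auto

lemma mod_succ: "v < n \<Longrightarrow> (v + 1) mod n = (if v + 1 = n then 0 else v + (1::nat))"
  by auto

lemma mod_pred:
  assumes "v < (n::nat)"
  shows "(v + n - 1) mod n = (if v = 0 then n - 1 else v - 1)"
proof (cases "v = 0")
  case False
  then have "v + n - 1 = (v - 1) + n" by simp
  then have "(v + n - 1) mod n = (v - 1) mod n" by (metis mod_add_self2)
  also have "\<dots> = v - 1" using assms by (intro mod_less) linarith
  finally show ?thesis using False by simp
qed (use assms in simp)

lemma neighbour_if:
  assumes "v < n"
  shows "neighbour n v h = (case h of Clockwise \<Rightarrow> if v + 1 = n then 0 else v + 1
    | Counterclockwise \<Rightarrow> if v = 0 then n - 1 else v - 1)"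
  using mod_succ[OF assms] mod_pred[OF assms] by (cases h) auto

lemma edge_towards_if:
  assumes "v < n"
  shows "edge_towards n v h = (case h of Clockwise \<Rightarrow> v
    | Counterclockwise \<Rightarrow> if v = 0 then n - 1 else v - 1)"
  using mod_pred[OF assms] by (cases h) auto

lemma neighbour_opposite:
  assumes "v < n"
  shows "neighbour n (neighbour n v h) (opposite h) = v"
proof -
  have "neighbour n v h < n" using assms neighbour_less by simp
  from neighbour_if[OF this] show ?thesis using assms
    by (cases h) (auto simp: neighbour_if simp del: neighbour.simps split: if_splits)
qed

lemma edge_towards_opposite:
  assumes "v < n"
  shows "edge_towards n (neighbour n v h) (opposite h) = edge_towards n v h"
proof -
  have "neighbour n v h < n" using assms neighbour_less by simp
  from edge_towards_if[OF this] show ?thesis using assms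
    by (cases h) (auto simp: neighbour_if edge_towards_if
      simp del: neighbour.simps edge_towards.simps split: if_splits)
qed

lemma neighbour_neq: "v < n \<Longrightarrow> 2 \<le> n \<Longrightarrow> neighbour n v h \<noteq> v"
  by (cases h) (auto simp: neighbour_if simp del: neighbour.simps)

lemma edge_towards_inj:
  "u < n \<Longrightarrow> v < n \<Longrightarrow> edge_towards n u h = edge_towards n v h \<Longrightarrow> u = v"
  by (cases h) (auto simp: edge_towards_if simp del: edge_towards.simps split: if_splits)

lemma edge_towards_facing:
  assumes "u < n" "v < n" "edge_towards n u (opposite h) = edge_towards n v h"
  shows "u = neighbour n v h"
proof (rule edge_towards_inj)
  show "u < n" "neighbour n v h < n" using assms neighbour_less by auto
  show "edge_towards n u (opposite h) = edge_towards n (neighbour n v h) (opposite h)"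
    using assms edge_towards_opposite by simp
qed

lemma edge_towards_both:
  "v < n \<Longrightarrow> 2 \<le> n \<Longrightarrow> edge_towards n v (opposite h) \<noteq> edge_towards n v h"
  using edge_towards_facing neighbour_neq by metis

lemma bij_inv_f: "bij f \<Longrightarrow> inv f (f x) = x"
  by (simp add: bij_is_inj)

lemma bij_f_inv: "bij f \<Longrightarrow> f (inv f x) = x"
  by (simp add: bij_is_surj surj_f_inv_f)

declare run.simps [simp del]

locale scen =
  fixes S :: scenario and n :: nat and H :: "nat set"
  assumes scen: "S \<in> scenarios n H" and conf: "H \<in> configurations n"
begin

lemma ring_size [simp]: "ring_size S = n" and homebases [simp]: "homebases S = H"
  using scen by (auto simp: scenarios_def)

lemma H_less: "a \<in> H \<Longrightarrow> a < n"
  using conf by (auto simp: configurations_def)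

lemma H_ne: "H \<noteq> {}"
  using conf by (auto simp: configurations_def)

lemma fin_H [simp]: "finite H"
  using conf finite_subset by (auto simp: configurations_def)

lemma n_pos: "0 < n"
  using H_ne H_less by fastforce

lemma bij_lab [simp]: "v < n \<Longrightarrow> bij (labelling S v)"
  using scen by (auto simp: scenarios_def)

text \<open>Consistency of a private orientation makes the side of a port depend on its heading
  alone, so it can be read off at node \<open>0\<close>. Port labels thereby disappear from the rest
  of the proof.\<close>

definition sd :: "nat \<Rightarrow> heading \<Rightarrow> side" where
  "sd a x = orientation S a 0 (inv (labelling S 0) x)"

definition hdg :: "nat \<Rightarrow> side \<Rightarrow> heading" where
  "hdg a = inv (sd a)"

lemma orientation_sd:
  assumes "a \<in> H" "v < n"
  shows "orientation S a v p = sd a (labelling S v p)"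
proof -
  have "labelling S v p = labelling S 0 (inv (labelling S 0) (labelling S v p))"
    by (simp add: bij_f_inv n_pos)
  then show ?thesis using assms scen n_pos unfolding scenarios_def sd_def by blast
qed

lemma bij_sd [simp]: "a \<in> H \<Longrightarrow> bij (sd a)"
proof -
  assume a: "a \<in> H"
  have "bij (orientation S a 0)" using scen a n_pos by (auto simp: scenarios_def)
  moreover have "sd a = orientation S a 0 \<circ> inv (labelling S 0)" by (auto simp: sd_def)
  ultimately show ?thesis using n_pos by (metis bij_comp bij_imp_bij_inv bij_lab)
qed

lemma sd_hdg [simp]: "a \<in> H \<Longrightarrow> sd a (hdg a s) = s"
  by (simp add: hdg_def bij_f_inv)

lemma hdg_sd [simp]: "a \<in> H \<Longrightarrow> hdg a (sd a x) = x"
  by (simp add: hdg_def bij_inv_f)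

lemma hdg_inject [simp]: "a \<in> H \<Longrightarrow> hdg a s = hdg a s' \<longleftrightarrow> s = s'"
  by (metis sd_hdg)

lemma hdg_opp [simp]: "a \<in> H \<Longrightarrow> hdg a (opp s) = opposite (hdg a s)"
  by (metis hdg_inject heading_neq opp_neq(1))

lemma sd_opposite [simp]: "a \<in> H \<Longrightarrow> sd a (opposite h) = opp (sd a h)"
  by (metis hdg_opp hdg_sd sd_hdg)

lemma map_place_hdg_sd [simp]: "a \<in> H \<Longrightarrow> map_place (hdg a) (map_place (sd a) x) = x"
  by (cases x) auto

lemma map_place_sd_hdg [simp]: "a \<in> H \<Longrightarrow> map_place (sd a) (map_place (hdg a) x) = x"
  by (cases x) auto

definition pos :: "'m protocol \<Rightarrow> nat \<Rightarrow> nat \<Rightarrow> nat" where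
  "pos A t a = node_of (run S A t) a"

definition plc :: "'m protocol \<Rightarrow> nat \<Rightarrow> nat \<Rightarrow> heading place" where
  "plc A t a = map_place (labelling S (pos A t a)) (place_of (run S A t) a)"

definition sta :: "'m protocol \<Rightarrow> nat \<Rightarrow> nat \<Rightarrow> 'm state" where
  "sta A t a = state_of (run S A t) a"

definition vw :: "'m protocol \<Rightarrow> nat \<Rightarrow> nat \<Rightarrow> view" where
  "vw A t a = view_of S (run S A t) a"

definition go :: "nat \<Rightarrow> nat \<Rightarrow> heading option \<Rightarrow> nat \<times> heading place" where
  "go t v d = (case d of None \<Rightarrow> (v, AtNode)
     | Some h \<Rightarrow> if missing S t = Some (edge_towards n v h) then (v, OutBuf h)
               else (neighbour n v h, InBuf (opposite h)))"

lemma init [simp]: "pos A 0 a = a" "plc A 0 a = AtNode" "sta A 0 a = Active (init_mem A)"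
  by (simp_all add: pos_def plc_def sta_def initial_world_def run.simps)

lemma sta_Suc: "sta A (Suc t) a = fst (decide A (sta A t a) (vw A t a))"
  by (simp add: sta_def vw_def round_step_def run.simps Let_def)

lemma node_Suc: "pos A (Suc t) a = fst (move S t a (pos A t a) (snd (decide A (sta A t a) (vw A t a))))"
  by (simp add: pos_def vw_def sta_def round_step_def run.simps Let_def)

lemma place_Suc:
  "place_of (run S A (Suc t)) a = snd (move S t a (pos A t a) (snd (decide A (sta A t a) (vw A t a))))"
  by (simp add: pos_def vw_def sta_def round_step_def run.simps Let_def)

lemma inv_orientation:
  assumes "a \<in> H" "v < n"
  shows "labelling S v (inv (orientation S a v) s) = hdg a s"
proof -
  have b: "bij (orientation S a v)" using scen assms by (auto simp: scenarios_def)
  have "orientation S a v (inv (orientation S a v) s) = s" using b by (rule bij_f_inv)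
  then have "sd a (labelling S v (inv (orientation S a v) s)) = s"
    using orientation_sd[OF assms] by simp
  then show ?thesis using hdg_sd[OF assms(1), of "labelling S v (inv (orientation S a v) s)"] by simp
qed

lemma pos_less: "a \<in> H \<Longrightarrow> pos A t a < n"
proof (induction t)
  case 0
  then show ?case using H_less by simp
next
  case (Suc t)
  then show ?case
    using n_pos by (auto simp: node_Suc move_def Let_def neighbour_less split: option.splits)
qed

text \<open>All reasoning about motion goes through this equation. The port chosen by
  \<open>move\<close> is the inverse image of a side, and its label turns it back into a heading, so
  that orientations survive only in \<open>hdg\<close>.\<close>

lemma go_Suc:
  assumes a: "a \<in> H"
  shows "(pos A (Suc t) a, plc A (Suc t) a)
    = go t (pos A t a) (map_option (hdg a) (snd (decide A (sta A t a) (vw A t a))))"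
proof -
  let ?d = "snd (decide A (sta A t a) (vw A t a))"
  have v: "pos A t a < n" using pos_less[OF a] .
  show ?thesis
  proof (cases ?d)
    case None
    then show ?thesis
      by (simp add: node_Suc plc_def place_Suc move_def go_def)
  next
    case (Some s)
    let ?p = "inv (orientation S a (pos A t a)) s"
    have h: "labelling S (pos A t a) ?p = hdg a s" using inv_orientation[OF a v] .
    have nb: "neighbour n (pos A t a) (hdg a s) < n" using n_pos neighbour_less by blast
    have m: "move S t a (pos A t a) ?d
      = (if missing S t = Some (edge_towards n (pos A t a) (hdg a s)) then (pos A t a, OutBuf ?p)
         else (neighbour n (pos A t a) (hdg a s),
           InBuf (inv (labelling S (neighbour n (pos A t a) (hdg a s))) (opposite (hdg a s)))))"
      unfolding move_def Some option.case Let_def h ring_size ..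
    show ?thesis
    proof (cases "missing S t = Some (edge_towards n (pos A t a) (hdg a s))")
      case True
      then show ?thesis
        using h unfolding plc_def node_Suc place_Suc m go_def by (simp add: Some)
    next
      case False
      then show ?thesis
        using bij_f_inv[OF bij_lab[OF nb]] unfolding plc_def node_Suc place_Suc m go_def by (simp add: Some)
    qed
  qed
qed

lemma own_name:
  assumes "a \<in> H" "v < n"
  shows "map_place (orientation S a v) p = map_place (sd a) (map_place (labelling S v) p)"
  using assms orientation_sd by (cases p) auto

lemma view_on [simp]: "on_homebase (vw A t a) \<longleftrightarrow> pos A t a \<in> H"
  by (simp add: vw_def view_of_def Let_def pos_def)

lemma view_own: "a \<in> H \<Longrightarrow> own_place (vw A t a) = map_place (sd a) (plc A t a)"
  using pos_less[of a A t] own_name[of a "pos A t a"]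
  by (simp add: vw_def view_of_def Let_def plc_def pos_def)

lemma view_own_simps [simp]:
  assumes "a \<in> H"
  shows "own_place (vw A t a) = AtNode \<longleftrightarrow> plc A t a = AtNode"
    "own_place (vw A t a) = InBuf s \<longleftrightarrow> plc A t a = InBuf (hdg a s)"
    "own_place (vw A t a) = OutBuf s \<longleftrightarrow> plc A t a = OutBuf (hdg a s)"
  using assms by (cases "plc A t a"; auto simp: view_own)+

lemma view_others:
  assumes "a \<in> H"
  shows "others (vw A t a) x
    = card {b \<in> H. b \<noteq> a \<and> pos A t b = pos A t a \<and> plc A t b = map_place (hdg a) x}"
proof -
  have "others (vw A t a) x = card {b \<in> H. b \<noteq> a \<and> pos A t b = pos A t a \<and>
      map_place (orientation S a (pos A t a)) (place_of (run S A t) b) = x}"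
    by (simp add: vw_def view_of_def Let_def pos_def)
  also have "{b \<in> H. b \<noteq> a \<and> pos A t b = pos A t a \<and>
      map_place (orientation S a (pos A t a)) (place_of (run S A t) b) = x}
    = {b \<in> H. b \<noteq> a \<and> pos A t b = pos A t a \<and> plc A t b = map_place (hdg a) x}"
  proof (intro Collect_cong conj_cong refl)
    fix b assume "b \<in> H" "b \<noteq> a" and e: "pos A t b = pos A t a"
    show "(map_place (orientation S a (pos A t a)) (place_of (run S A t) b) = x)
        = (plc A t b = map_place (hdg a) x)"
      using own_name[OF assms pos_less[OF assms], of A t "place_of (run S A t) b"] e
      by (metis assms map_place_hdg_sd map_place_sd_hdg plc_def)
  qed
  finally show ?thesis .
qed

lemma others_pos:
  assumes "a \<in> H"
  shows "0 < others (vw A t a) x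
    \<longleftrightarrow> (\<exists>b\<in>H. b \<noteq> a \<and> pos A t b = pos A t a \<and> plc A t b = map_place (hdg a) x)"
  by (auto simp: view_others[OF assms] card_gt_0_iff)

lemma Term_stays:
  assumes "sta A t a = Term v" "t \<le> t'"
  shows "sta A t' a = Term v"
  using assms(2)
proof (induction t' rule: dec_induct)
  case (step t')
  then show ?case by (simp add: sta_Suc)
qed (use assms in auto)

lemma Term_pos:
  assumes "a \<in> H" "sta A t a = Term v" "t \<le> t'"
  shows "pos A t' a = pos A t a"
  using assms(3)
proof (induction t' rule: dec_induct)
  case (step t')
  have "sta A t' a = Term v" using Term_stays assms step by blast
  then show ?case using go_Suc[OF assms(1), of A t'] step by (simp add: go_def)
qed auto

lemma Term_plc:
  assumes "a \<in> H" "sta A t a = Term v" "t < t'"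
  shows "plc A t' a = AtNode"
proof -
  obtain s where s: "t' = Suc s" "t \<le> s" using assms(3) by (metis Suc_leI less_Suc_eq_le not0_implies_Suc not_less_zero)
  have "sta A s a = Term v" using Term_stays assms s by blast
  then show ?thesis using go_Suc[OF assms(1), of A s] s by (simp add: go_def)
qed

lemma Active_before: "sta A t a = Active m \<Longrightarrow> s \<le> t \<Longrightarrow> \<exists>m'. sta A s a = Active m'"
  by (metis Term_stays state.distinct(1) state.exhaust)

lemma gathered_iff:
  "gathered S (run S A t) \<longleftrightarrow>
     (\<exists>v. \<forall>a\<in>H. pos A t a = v) \<or> (\<exists>v x. \<forall>a\<in>H. pos A t a \<in> {v, neighbour n v x})"
  by (simp add: gathered_def pos_def)

end

section \<open>Encoding of countable memories by natural numbers\<close>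

definition nat_protocol :: "('m::countable) protocol \<Rightarrow> nat protocol" where
  "nat_protocol A = \<lparr>init_mem = to_nat (init_mem A),
     act = (\<lambda>m w. map_prod (map_state to_nat) id (act A (from_nat m) w))\<rparr>"

text \<open>The encoding commutes with every round because \<open>from_nat\<close> undoes
  \<open>to_nat\<close>, and because no view shows the memory, the only component in which the two
  worlds differ.\<close>

lemma run_nat_protocol:
  "node_of (run S (nat_protocol A) t) = node_of (run S A t)
   \<and> place_of (run S (nat_protocol A) t) = place_of (run S A t)
   \<and> state_of (run S (nat_protocol A) t) = map_state to_nat \<circ> state_of (run S A t)"
proof (induction t)
  case 0
  then show ?case by (auto simp: initial_world_def nat_protocol_def run.simps)
next
  case (Suc t)
  have v: "view_of S (run S (nat_protocol A) t) a = view_of S (run S A t) a" for a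
    using Suc by (simp add: view_of_def Let_def)
  have d: "decide (nat_protocol A) (map_state to_nat s) w = map_prod (map_state to_nat) id (decide A s w)"
    for s :: "'a state" and w
    by (cases s) (auto simp: nat_protocol_def)
  show ?case
    using Suc by (auto simp: round_step_def run.simps Let_def v d fun_eq_iff)
qed

lemma state_nat_protocol_Term [simp]:
  "state_of (run S (nat_protocol A) t) a = Term v \<longleftrightarrow> state_of (run S A t) a = Term v"
  by (cases "state_of (run S A t) a") (auto simp: run_nat_protocol)

lemma gathered_nat_protocol [simp]:
  "gathered S (run S (nat_protocol A) t) \<longleftrightarrow> gathered S (run S A t)"
  by (simp add: gathered_def run_nat_protocol)

lemma solves_in_nat_protocol [simp]: "solves_in S (nat_protocol A) \<longleftrightarrow> solves_in S A"
  by (simp add: solves_in_def aware_correctly_def solved_at_def)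

lemma detects_in_nat_protocol [simp]: "detects_in S (nat_protocol A) \<longleftrightarrow> detects_in S A"
  by (simp add: detects_in_def)

section \<open>The protocol\<close>

instance side :: countable
  by countable_datatype

text \<open>If an edge is missing for a whole window, \<open>n\<close> rounds bring all agents to
  its ends, and the \<open>3 * n - 2\<close> rounds left before the probe cover the \<open>n\<close>
  blocked rounds that \<open>okp\<close> asks for.\<close>

definition win :: "nat \<Rightarrow> nat" where
  "win n = 4 * n"

text \<open>Three windows force a move of every unexplored agent, so \<open>3 * n\<close> windows
  explore the ring. An alarm given before their end takes about one more window to reach everybody,
  hence the two extra ones.\<close>

definition tex :: "nat \<Rightarrow> nat" where
  "tex n = (3 * n + 2) * win n"

text \<open>
  Memory during the exploration: round, number of moves, displacement to the left, displacements of
  the homebases seen, number of rounds since the last move, whether the agent sticks to an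
  unexplored companion, whether it is probing and whether so far the probe went as it does at a
  blocked edge, the side it pushes, and the number of companions in the second round of the window.
\<close>

record ex =
  tm :: nat
  mv :: nat
  dsp :: nat
  seen :: "nat list"
  blk :: nat
  att :: bool
  prb :: bool
  okp :: bool
  cur :: side
  cmp :: nat

text \<open>
  Memory after the exploration: round, coordinate in the elected frame, positive side of this frame,
  number of agents, symmetry of the configuration, whether the agent was at the elected node after
  the first stage, number of companions at the beginning of the stage, side from which an arrival was
  first seen, and, once known, whether the agent is in the lower group, with the common positive side.
\<close>

record mt =
  tau :: nat
  xc :: nat
  ps :: side
  kk :: nat
  sy :: bool
  vr :: bool
  c0 :: nat
  arr :: "side option"
  fin :: "(bool \<times> side) option"

instance ex_ext :: (countable) countable
proof (rule countable_classI)
  fix x y :: "'a ex_scheme"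
  assume "to_nat (tm x, mv x, dsp x, seen x, blk x, att x, prb x, okp x, cur x, cmp x, ex.more x)
    = to_nat (tm y, mv y, dsp y, seen y, blk y, att y, prb y, okp y, cur y, cmp y, ex.more y)"
  then show "x = y" by simp
qed

instance mt_ext :: (countable) countable
proof (rule countable_classI)
  fix x y :: "'a mt_scheme"
  assume "to_nat (tau x, xc x, ps x, kk x, sy x, vr x, c0 x, arr x, fin x, mt.more x)
    = to_nat (tau y, xc y, ps y, kk y, sy y, vr y, c0 y, arr y, fin y, mt.more y)"
  then show "x = y" by simp
qed

datatype mem = Ex ex | Mt mt

instance mem :: countable
  by countable_datatype

definition is_in :: "'p place \<Rightarrow> bool" where
  "is_in x \<longleftrightarrow> (\<exists>p. x = InBuf p)"

definition is_out :: "'p place \<Rightarrow> bool" where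
  "is_out x \<longleftrightarrow> (\<exists>p. x = OutBuf p)"

text \<open>Dead reckoning: being in an incoming buffer proves a move in the last round, and the
  buffer opposite to \<open>s\<close> means that the move was towards \<open>s\<close>.\<close>

definition shift :: "nat \<Rightarrow> side \<Rightarrow> side place \<Rightarrow> nat \<Rightarrow> nat" where
  "shift n s p x = (if p = InBuf (opp s) then (x + 1) mod n
     else if p = InBuf s then (x + n - 1) mod n else x)"

text \<open>First half of a round: the outcome of the last move is evaluated, before
  \<open>dec1\<close> chooses the next one. Recording stops at \<open>n\<close> moves, since
  displacements \<open>0\<close> to \<open>n - 1\<close> cover the ring once and \<open>mv\<close>
  is no longer a displacement when the agent may turn.\<close>

definition obs1 :: "nat \<Rightarrow> ex \<Rightarrow> view \<Rightarrow> ex" where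
  "obs1 n m w = (let v = (if is_in (own_place w) then Suc (mv m) else mv m) in
     m\<lparr>mv := v, dsp := shift n Left (own_place w) (dsp m),
       seen := (if v < n \<and> on_homebase w then v # seen m else seen m),
       blk := (if is_out (own_place w) then Suc (blk m) else 0),
       att := (att m \<and> is_out (own_place w))\<rparr>)"

text \<open>
  An agent terminates if it sees a terminated one, if a companion with which it was blocked did not
  come along when the edge returned (so has terminated), or if it is unexplored and has been blocked
  for two windows.
\<close>

definition alarm :: "nat \<Rightarrow> ex \<Rightarrow> view \<Rightarrow> bool" where
  "alarm n m w \<longleftrightarrow> 0 < others w AtNode
     \<or> tm m mod win n = 2 \<and> own_place w = InBuf (opp (cur m)) \<and> others w (InBuf (opp (cur m))) < cmp m
     \<or> tm m mod win n = 1 \<and> mv m < n \<and> 2 * win n + 1 \<le> blk m"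

text \<open>Evaluated at offset \<open>0\<close>, right after a probe that went as planned: a
  companion in the outgoing buffer has not taken part in the probe, so it is unexplored or attached
  itself.\<close>

definition hooked :: "ex \<Rightarrow> view \<Rightarrow> bool" where
  "hooked m w \<longleftrightarrow> prb m \<and> okp m \<and> own_place w = InBuf (opp (cur m)) \<and> 0 < others w (OutBuf (cur m))"

text \<open>All clocks agree, as the agents start together, so all probes fall into the same two
  rounds. Agents probing at the same end step back and return together, and one still pushing there
  has not probed.\<close>

definition dec1 :: "nat \<Rightarrow> ex \<Rightarrow> view \<Rightarrow> ex \<times> side" where
  "dec1 n m w = (let p = tm m mod win n; m' = m\<lparr>tm := Suc (tm m)\<rparr> in
     if p = 0 then
       (let c = (if prb m \<and> \<not> hooked m w then opp (cur m) else cur m)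
        in (m'\<lparr>att := (att m \<or> hooked m w), prb := False, cur := c\<rparr>, c))
     else if p = 1 then
       (m'\<lparr>cmp := (if own_place w = OutBuf (cur m) then others w (OutBuf (cur m)) else 0)\<rparr>, cur m)
     else if p = win n - 2 then
       (let b = (n \<le> mv m \<and> \<not> att m)
        in (m'\<lparr>prb := b, okp := (n \<le> blk m)\<rparr>, if b then opp (cur m) else cur m))
     else if p = win n - 1 then (m'\<lparr>okp := (okp m \<and> own_place w = InBuf (cur m))\<rparr>, cur m)
     else (m', cur m))"

definition tot :: "view \<Rightarrow> nat" where
  "tot w = others w AtNode + others w (InBuf Left) + others w (InBuf Right)
     + others w (OutBuf Left) + others w (OutBuf Right)"

definition obs2 :: "nat \<Rightarrow> mt \<Rightarrow> view \<Rightarrow> mt" where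
  "obs2 n m w = m\<lparr>xc := shift n (ps m) (own_place w) (xc m)\<rparr>"

text \<open>The side must be remembered from the first arrival: one round later the agent that
  arrived is at the node proper and no longer shows where it came from.\<close>

definition arrive :: "mt \<Rightarrow> view \<Rightarrow> side option" where
  "arrive m w = (case arr m of Some s \<Rightarrow> Some s
     | None \<Rightarrow> if 0 < others w (InBuf Left) then Some Left
               else if 0 < others w (InBuf Right) then Some Right else None)"

text \<open>
  The second stage takes the agents not at the elected node there, each in its own positive
  direction. If some but not all arrive, those left behind become the lower group, and all agents
  adopt their orientation.
\<close>

definition finB :: "mt \<Rightarrow> view \<Rightarrow> (bool \<times> side) option" where
  "finB m w =
     (if vr m then map_option (Pair False) (arrive m w)
      else if xc m = 0 then Some (False, opp (ps m))
      else if tot w < c0 m then Some (True, ps m) else None)"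

text \<open>
  In the third stage, which takes place if nobody arrived in the second one, the agents waiting at
  the elected node walk to the others. If nobody arrives again, either group has a single
  orientation, and symmetry tells whether these agree.
\<close>

definition finC :: "mt \<Rightarrow> view \<Rightarrow> (bool \<times> side) option" where
  "finC m w = (case fin m of Some f \<Rightarrow> Some f
     | None \<Rightarrow>
       if vr m then
         (if 0 < others w AtNode then Some (False, opp (ps m))
          else if tot w < c0 m then Some (True, ps m)
          else if sy m then Some (False, opp (ps m)) else Some (True, ps m))
       else (case arrive m w of Some s \<Rightarrow> Some (False, s)
         | None \<Rightarrow> if sy m then Some (True, ps m) else Some (False, ps m)))"

definition upd2 :: "nat \<Rightarrow> mt \<Rightarrow> view \<Rightarrow> mt" where
  "upd2 n m w =
     (if tau m = n then m\<lparr>vr := (xc m = 0), c0 := tot w\<rparr>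
      else if tau m = 2 * n then m\<lparr>fin := finB m w, c0 := tot w, arr := None\<rparr>
      else if tau m = 3 * n then m\<lparr>fin := finC m w\<rparr>
      else if n < tau m \<and> tau m < 3 * n then m\<lparr>arr := arrive m w\<rparr>
      else m)"

text \<open>The elected node is \<open>0\<close> for the lower group and \<open>n\<close> for the upper one.\<close>

definition yc :: "nat \<Rightarrow> mt \<Rightarrow> nat" where
  "yc n m = (let y = (if snd (the (fin m)) = ps m then xc m else (n - xc m) mod n)
     in if \<not> fst (the (fin m)) \<and> y = 0 then n else y)"

text \<open>At a multiple of \<open>n\<close> the value \<open>tau div n - 3\<close> is the phase
  that has just ended, whereas \<open>push2\<close> uses \<open>tau div n - 2\<close> for the
  running one. A lower group still short of its goal then has the upper group exactly on that goal,
  next to it.\<close>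

definition stop2 :: "nat \<Rightarrow> mt \<Rightarrow> bool" where
  "stop2 n m \<longleftrightarrow> 4 * n \<le> tau m \<and> tau m mod n = 0 \<and>
     (if fst (the (fin m)) then yc n m < tau m div n - 3 else yc n m \<le> tau m div n - 3)"

text \<open>In the third stage an agent at the node proper marks the target. Round
  \<open>2 * n\<close> is exempt, because the agents that waited during the second stage are then at
  the node proper themselves.\<close>

definition push2 :: "nat \<Rightarrow> mt \<Rightarrow> view \<Rightarrow> side option" where
  "push2 n m w =
     (if tau m < n then
        (if xc m = 0 then None else if 2 * xc m \<le> n then Some (opp (ps m)) else Some (ps m))
      else if tau m < 2 * n then (if vr m \<or> xc m = 0 then None else Some (ps m))
      else if tau m < 3 * n then
        (if fin m \<noteq> None \<or> \<not> vr m \<or> 2 * n < tau m \<and> 0 < others w AtNode then None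
         else Some (ps m))
      else if fst (the (fin m)) then
        (if yc n m < tau m div n - 2 then Some (snd (the (fin m))) else None)
      else (if tau m div n - 2 < yc n m then Some (opp (snd (the (fin m)))) else None))"

text \<open>Seeing \<open>kk m - 1\<close> others means that everybody is here. All agents see this
  in the same round, so they stop together.\<close>

definition dec2 :: "nat \<Rightarrow> mt \<Rightarrow> view \<Rightarrow> mem state \<times> side option" where
  "dec2 n m w = (let m' = upd2 n m w in
     if tot w = kk m - 1 \<or> stop2 n m' then (Term Gathering_Achieved, None)
     else (Active (Mt (m'\<lparr>tau := Suc (tau m)\<rparr>)), push2 n m' w))"

text \<open>The dihedral group of the ring in coordinates: \<open>i\<close> goes to
  \<open>c + i\<close> or to \<open>c - i\<close> modulo \<open>n\<close>.\<close>

definition aff :: "nat \<Rightarrow> bool \<Rightarrow> nat \<Rightarrow> nat \<Rightarrow> nat" where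
  "aff n b c i = (if b then (i + c) mod n else (c + n - i) mod n)"

text \<open>No symmetry other than the identity and the reflection that fixes \<open>0\<close>.\<close>

definition axial :: "nat \<Rightarrow> nat set \<Rightarrow> bool" where
  "axial n R \<longleftrightarrow> (\<forall>b. \<forall>c<n. aff n b c ` R = R \<longrightarrow> c = 0)"

text \<open>The choice depends on \<open>K\<close> only through its orbit under \<open>aff\<close>,
  so agents with different origins and orientations choose the same set.\<close>

definition canon :: "nat \<Rightarrow> nat set \<Rightarrow> nat set" where
  "canon n K = (SOME R. (\<exists>b. \<exists>c<n. R = aff n b c ` K) \<and> axial n R)"

definition symm :: "nat \<Rightarrow> nat set \<Rightarrow> bool" where
  "symm n R \<longleftrightarrow> aff n False 0 ` R = R"

text \<open>An agent has its own homebase at \<open>0\<close> of its picture, so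
  \<open>aff n b c 0\<close> is the new coordinate of that homebase. Of the two mirror frames of a
  symmetric set, the bound selects opposite ones for mirrored agents.\<close>

definition elect :: "nat \<Rightarrow> nat set \<Rightarrow> (bool \<times> nat) option" where
  "elect n K = (if \<exists>b. \<exists>c<n. axial n (aff n b c ` K)
     then Some (SOME (b, c). c < n \<and> aff n b c ` K = canon n K
       \<and> (symm n (canon n K) \<longrightarrow> 2 * aff n b c 0 \<le> n))
     else None)"

definition start2 :: "nat \<Rightarrow> ex \<Rightarrow> view \<Rightarrow> mem state \<times> side option" where
  "start2 n m w = (case elect n (set (seen m)) of None \<Rightarrow> (Term Config_Excluded, None)
     | Some (b, c) \<Rightarrow> dec2 n \<lparr>tau = 0, xc = aff n b c (dsp m), ps = (if b then Left else Right),
         kk = card (set (seen m)), sy = symm n (canon n (set (seen m))), vr = False, c0 = 0,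
         arr = None, fin = None\<rparr> w)"

definition prot :: "nat \<Rightarrow> mem protocol" where
  "prot n = \<lparr>init_mem = Ex \<lparr>tm = 0, mv = 0, dsp = 0, seen = [], blk = 0, att = False, prb = False,
       okp = False, cur = Left, cmp = 0\<rparr>,
     act = (\<lambda>m w. if n \<le> 2 then (Term Gathering_Achieved, None) else
       (case m of
          Ex e \<Rightarrow>
            (let e' = obs1 n e w in
             if tex n \<le> tm e' then start2 n e' w
             else if alarm n e' w then (Term Gathering_Achieved, None)
             else (Active (Ex (fst (dec1 n e' w))), Some (snd (dec1 n e' w))))
        | Mt e \<Rightarrow> dec2 n (obs2 n e w) w))\<rparr>"

section \<open>Exploration\<close>

locale big = scen +
  assumes n3: "3 \<le> n"
begin

abbreviation X :: "nat \<Rightarrow> nat \<Rightarrow> nat" where "X \<equiv> pos (prot n)"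
abbreviation Q :: "nat \<Rightarrow> nat \<Rightarrow> heading place" where "Q \<equiv> plc (prot n)"
abbreviation st :: "nat \<Rightarrow> nat \<Rightarrow> mem state" where "st \<equiv> sta (prot n)"
abbreviation V :: "nat \<Rightarrow> nat \<Rightarrow> view" where "V \<equiv> vw (prot n)"
abbreviation W :: nat where "W \<equiv> win n"
abbreviation miss :: "nat \<Rightarrow> nat option" where "miss \<equiv> missing S"

lemma W12: "12 \<le> W"
  using n3 by (simp add: win_def)

definition em :: "nat \<Rightarrow> nat \<Rightarrow> ex" where
  "em t a = (case st t a of Active (Ex e) \<Rightarrow> e)"

definition live :: "nat \<Rightarrow> bool" where
  "live t \<longleftrightarrow> (\<forall>a\<in>H. \<exists>e. st t a = Active (Ex e))"

definition ob :: "nat \<Rightarrow> nat \<Rightarrow> ex" where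
  "ob t a = obs1 n (em t a) (V t a)"

definition D :: "nat \<Rightarrow> nat \<Rightarrow> heading" where
  "D t a = hdg a (snd (dec1 n (ob t a) (V t a)))"

definition stuck :: "nat \<Rightarrow> nat \<Rightarrow> bool" where
  "stuck t a \<longleftrightarrow> miss t = Some (edge_towards n (X t a) (D t a))"

definition ring :: "nat \<Rightarrow> nat \<Rightarrow> bool" where
  "ring t a \<longleftrightarrow> alarm n (ob t a) (V t a)"

lemma X_less [simp]: "a \<in> H \<Longrightarrow> X t a < n"
  by (rule pos_less)

lemma st_em: "live t \<Longrightarrow> a \<in> H \<Longrightarrow> st t a = Active (Ex (em t a))"
  by (auto simp: live_def em_def)

lemma live_0: "live 0"
  by (simp add: live_def prot_def)

lemma em_0: "em 0 a = \<lparr>tm = 0, mv = 0, dsp = 0, seen = [], blk = 0, att = False, prb = False,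
       okp = False, cur = Left, cmp = 0\<rparr>"
  by (simp add: em_def prot_def)

lemma act_Ex: "act (prot n) (Ex e) w =
   (if tex n \<le> tm e then start2 n (obs1 n e w) w
    else if alarm n (obs1 n e w) w then (Term Gathering_Achieved, None)
    else (Active (Ex (fst (dec1 n (obs1 n e w) w))), Some (snd (dec1 n (obs1 n e w) w))))"
  using n3 by (simp add: prot_def Let_def obs1_def)

lemma start2_not_Ex: "fst (start2 n e w) \<noteq> Active (Ex e')"
  by (auto simp: start2_def dec2_def Let_def split: option.splits)

lemma tm_dec1 [simp]: "tm (fst (dec1 n m w)) = Suc (tm m)"
  by (simp add: dec1_def Let_def)

lemma tm_obs1 [simp]: "tm (obs1 n m w) = tm m"
  by (simp add: obs1_def Let_def)

lemma dec2_not_Ex: "fst (dec2 n m w) \<noteq> Active (Ex e')"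
  by (auto simp: dec2_def Let_def)

text \<open>Exploring states are never re-entered, so an exploring state determines how the previous
  round went. This is what allows facts about \<open>live\<close> to be carried backwards in
  time.\<close>

lemma Ex_back:
  assumes "st (Suc t) a = Active (Ex e')"
  shows "\<exists>e. st t a = Active (Ex e) \<and> tm e < tex n \<and> \<not> alarm n (obs1 n e (V t a)) (V t a)
     \<and> e' = fst (dec1 n (obs1 n e (V t a)) (V t a))"
proof -
  have s: "fst (decide (prot n) (st t a) (V t a)) = Active (Ex e')"
    using assms by (simp add: sta_Suc)
  show ?thesis
  proof (cases "st t a")
    case (Term v)
    then show ?thesis using s by simp
  next
    case (Active m)
    show ?thesis
    proof (cases m)
      case (Mt x)
      then show ?thesis using s Active n3 dec2_not_Ex by (simp add: prot_def)
    next
      case (Ex e)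
      then show ?thesis using s Active start2_not_Ex[of e] start2_not_Ex
        by (auto simp: act_Ex split: if_splits)
    qed
  qed
qed

lemma live_Suc_D: "live (Suc t) \<Longrightarrow> live t"
  unfolding live_def using Ex_back by blast

lemma live_mono: "live t \<Longrightarrow> s \<le> t \<Longrightarrow> live s"
proof (induction t)
  case (Suc t)
  then show ?case using live_Suc_D by (cases "s = Suc t") auto
qed simp

lemma tm_em: "live t \<Longrightarrow> a \<in> H \<Longrightarrow> tm (em t a) = t"
proof (induction t)
  case 0
  then show ?case by (simp add: em_0)
next
  case (Suc t)
  have "st (Suc t) a = Active (Ex (em (Suc t) a))" using Suc st_em by blast
  from Ex_back[OF this] show ?case
    using Suc live_Suc_D st_em by fastforce
qed

lemma tm_ob [simp]: "live t \<Longrightarrow> a \<in> H \<Longrightarrow> tm (ob t a) = t"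
  by (simp add: ob_def tm_em)

lemma live_Suc:
  assumes "live t" "t < tex n" "\<forall>a\<in>H. \<not> ring t a"
  shows "live (Suc t)"
proof -
  have "st (Suc t) a = Active (Ex (fst (dec1 n (ob t a) (V t a))))" if "a \<in> H" for a
    using that assms st_em[OF assms(1) that] tm_em[OF assms(1) that]
    by (simp add: sta_Suc act_Ex ob_def ring_def)
  then show ?thesis by (auto simp: live_def)
qed

lemma live_SucE:
  assumes "live (Suc t)" "a \<in> H"
  shows "t < tex n" "\<not> ring t a" "em (Suc t) a = fst (dec1 n (ob t a) (V t a))"
    "snd (decide (prot n) (st t a) (V t a)) = Some (snd (dec1 n (ob t a) (V t a)))"
proof -
  have l: "live t" using assms live_Suc_D by blast
  have "st (Suc t) a = Active (Ex (em (Suc t) a))" using assms st_em by blast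
  from Ex_back[OF this] show 1: "t < tex n" "\<not> ring t a" "em (Suc t) a = fst (dec1 n (ob t a) (V t a))"
    using l assms tm_em st_em[OF l assms(2)] by (auto simp: ob_def ring_def)
  show "snd (decide (prot n) (st t a) (V t a)) = Some (snd (dec1 n (ob t a) (V t a)))"
    using 1 st_em[OF l assms(2)] tm_em[OF l assms(2)] by (simp add: act_Ex ob_def ring_def)
qed

lemma ring_Term:
  assumes "live t" "t < tex n" "a \<in> H"
  shows "ring t a \<Longrightarrow> st (Suc t) a = Term Gathering_Achieved"
    "ring t a \<Longrightarrow> X (Suc t) a = X t a" "ring t a \<Longrightarrow> Q (Suc t) a = AtNode"
    "\<not> ring t a \<Longrightarrow> st (Suc t) a = Active (Ex (fst (dec1 n (ob t a) (V t a))))"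
    "\<not> ring t a \<Longrightarrow> X (Suc t) a = (if stuck t a then X t a else neighbour n (X t a) (D t a))"
    "\<not> ring t a \<Longrightarrow> Q (Suc t) a = (if stuck t a then OutBuf (D t a) else InBuf (opposite (D t a)))"
  using go_Suc[OF assms(3), of "prot n" t] st_em[OF assms(1,3)] tm_em[OF assms(1,3)] assms(2)
  by (auto simp: sta_Suc act_Ex ob_def ring_def stuck_def D_def go_def)

lemma X_Suc:
  assumes "live (Suc t)" "a \<in> H"
  shows "X (Suc t) a = (if stuck t a then X t a else neighbour n (X t a) (D t a))"
  using ring_Term(5) live_SucE live_Suc_D assms by blast

lemma Q_Suc:
  assumes "live (Suc t)" "a \<in> H"
  shows "Q (Suc t) a = (if stuck t a then OutBuf (D t a) else InBuf (opposite (D t a)))"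
  using ring_Term(6) live_SucE live_Suc_D assms by blast

lemma em_Suc: "live (Suc t) \<Longrightarrow> a \<in> H \<Longrightarrow> em (Suc t) a = fst (dec1 n (ob t a) (V t a))"
  by (rule live_SucE)

lemma mv_dec1 [simp]: "mv (fst (dec1 n m w)) = mv m" "seen (fst (dec1 n m w)) = seen m"
  "dsp (fst (dec1 n m w)) = dsp m" "blk (fst (dec1 n m w)) = blk m"
  by (simp_all add: dec1_def Let_def)

lemma own_in [simp]: "a \<in> H \<Longrightarrow> is_in (own_place (V t a)) \<longleftrightarrow> is_in (Q t a)"
  by (cases "Q t a") (auto simp: is_in_def view_own)

lemma own_out [simp]: "a \<in> H \<Longrightarrow> is_out (own_place (V t a)) \<longleftrightarrow> is_out (Q t a)"
  by (cases "Q t a") (auto simp: is_out_def view_own)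

lemma is_place [simp]: "is_in (InBuf h)" "\<not> is_in (OutBuf h)" "\<not> is_in AtNode"
  "\<not> is_out (InBuf h)" "is_out (OutBuf h)" "\<not> is_out AtNode"
  by (auto simp: is_in_def is_out_def)

lemma ob_Suc:
  assumes "live (Suc t)" "a \<in> H"
  shows "mv (ob (Suc t) a) = (if stuck t a then mv (ob t a) else Suc (mv (ob t a)))"
    "blk (ob (Suc t) a) = (if stuck t a then Suc (blk (ob t a)) else 0)"
    "att (ob (Suc t) a) \<longleftrightarrow> att (fst (dec1 n (ob t a) (V t a))) \<and> stuck t a"
    "prb (ob (Suc t) a) = prb (fst (dec1 n (ob t a) (V t a)))"
    "okp (ob (Suc t) a) = okp (fst (dec1 n (ob t a) (V t a)))"
    "cur (ob (Suc t) a) = cur (fst (dec1 n (ob t a) (V t a)))"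
    "cmp (ob (Suc t) a) = cmp (fst (dec1 n (ob t a) (V t a)))"
  using assms by (simp_all add: ob_def[of "Suc t"] em_Suc obs1_def Let_def Q_Suc)

lemma ob_0: "a \<in> H \<Longrightarrow> mv (ob 0 a) = 0" "a \<in> H \<Longrightarrow> blk (ob 0 a) = 0" "\<not> att (ob 0 a)" "\<not> prb (ob 0 a)"
   "cur (ob 0 a) = Left"
  by (simp_all add: ob_def obs1_def em_0)

lemma blk_le: "live t \<Longrightarrow> a \<in> H \<Longrightarrow> blk (ob t a) \<le> t"
proof (induction t)
  case (Suc t)
  then show ?case using live_Suc_D by (auto simp: ob_Suc)
qed (simp add: ob_0)

lemma blk_stuck:
  "live t \<Longrightarrow> a \<in> H \<Longrightarrow> s < t \<Longrightarrow> t - s \<le> blk (ob t a) \<Longrightarrow> stuck s a"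
proof (induction t)
  case (Suc t)
  show ?case
  proof (cases "s = t")
    case True
    then show ?thesis using Suc.prems by (auto simp: ob_Suc split: if_splits)
  next
    case False
    then show ?thesis using Suc live_Suc_D by (auto simp: ob_Suc split: if_splits)
  qed
qed simp

lemma stuck_blk:
  "live t \<Longrightarrow> a \<in> H \<Longrightarrow> s \<le> t \<Longrightarrow> (\<forall>r. s \<le> r \<and> r < t \<longrightarrow> stuck r a) \<Longrightarrow> t - s \<le> blk (ob t a)"
proof (induction t)
  case (Suc t)
  show ?case
  proof (cases "s = Suc t")
    case False
    then have "t - s \<le> blk (ob t a)" using Suc live_Suc_D by (intro Suc.IH) auto
    moreover have "stuck t a" using Suc.prems False by auto
    ultimately show ?thesis using Suc.prems False by (auto simp: ob_Suc)
  qed simp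
qed simp

lemma X_stuck:
  "live t \<Longrightarrow> a \<in> H \<Longrightarrow> s \<le> t \<Longrightarrow> (\<forall>r. s \<le> r \<and> r < t \<longrightarrow> stuck r a)
    \<Longrightarrow> X t a = X s a \<and> mv (ob t a) = mv (ob s a)"
proof (induction t)
  case (Suc t)
  show ?case
  proof (cases "s = Suc t")
    case False
    then have "X t a = X s a \<and> mv (ob t a) = mv (ob s a)" using Suc live_Suc_D by (intro Suc.IH) auto
    moreover have "stuck t a" using Suc.prems False by auto
    ultimately show ?thesis using Suc.prems by (auto simp: ob_Suc X_Suc)
  qed simp
qed simp

lemma mv_mono: "live t \<Longrightarrow> a \<in> H \<Longrightarrow> s \<le> t \<Longrightarrow> mv (ob s a) \<le> mv (ob t a)"
proof (induction t)
  case (Suc t)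
  then show ?case using live_Suc_D by (cases "s = Suc t") (auto simp: ob_Suc le_Suc_eq)
qed simp

text \<open>The agents that do not probe at the end of a window.\<close>

definition firm :: "nat \<Rightarrow> nat \<Rightarrow> bool" where
  "firm t a \<longleftrightarrow> mv (ob t a) < n \<or> att (ob t a)"

lemma D_cases:
  assumes "live t" "a \<in> H"
  shows "t mod W \<noteq> 0 \<Longrightarrow> t mod W \<noteq> W - 2 \<Longrightarrow> D t a = hdg a (cur (ob t a))"
    "t mod W = W - 2 \<Longrightarrow> D t a = (if firm t a then hdg a (cur (ob t a)) else opposite (hdg a (cur (ob t a))))"
  using assms W12 by (auto simp: D_def dec1_def Let_def firm_def)

lemma cur_Suc:
  assumes "live (Suc t)" "a \<in> H"
  shows "t mod W \<noteq> 0 \<Longrightarrow> cur (ob (Suc t) a) = cur (ob t a)"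
    "t mod W = 0 \<Longrightarrow> hdg a (cur (ob (Suc t) a)) = D t a"
    "t mod W = 0 \<Longrightarrow> cur (ob (Suc t) a) = (if prb (ob t a) \<and> \<not> hooked (ob t a) (V t a)
       then opp (cur (ob t a)) else cur (ob t a))"
  using assms live_Suc_D by (auto simp: ob_Suc D_def dec1_def Let_def)

lemma att_Suc:
  assumes "live (Suc t)" "a \<in> H"
  shows "t mod W \<noteq> 0 \<Longrightarrow> att (ob (Suc t) a) \<longleftrightarrow> att (ob t a) \<and> stuck t a"
    "t mod W = 0 \<Longrightarrow> att (ob (Suc t) a) \<longleftrightarrow> (att (ob t a) \<or> hooked (ob t a) (V t a)) \<and> stuck t a"
  using assms live_Suc_D by (auto simp: ob_Suc dec1_def Let_def)

lemma prb_Suc: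
  assumes "live (Suc t)" "a \<in> H"
  shows "t mod W = W - 2 \<Longrightarrow> prb (ob (Suc t) a) \<longleftrightarrow> \<not> firm t a"
    "t mod W = 0 \<Longrightarrow> \<not> prb (ob (Suc t) a)"
    "t mod W \<noteq> W - 2 \<Longrightarrow> t mod W \<noteq> 0 \<Longrightarrow> prb (ob (Suc t) a) = prb (ob t a)"
  using assms live_Suc_D W12 by (auto simp: ob_Suc dec1_def Let_def firm_def)

lemma okp_Suc:
  assumes "live (Suc t)" "a \<in> H"
  shows "t mod W = W - 2 \<Longrightarrow> okp (ob (Suc t) a) \<longleftrightarrow> n \<le> blk (ob t a)"
    "t mod W = W - 1 \<Longrightarrow> okp (ob (Suc t) a) \<longleftrightarrow> okp (ob t a) \<and> Q t a = InBuf (hdg a (cur (ob t a)))"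
  using assms live_Suc_D W12 by (auto simp: ob_Suc dec1_def Let_def)

lemma hookedD:
  assumes "a \<in> H" "hooked (ob t a) (V t a)"
  shows "prb (ob t a)" "okp (ob t a)" "Q t a = InBuf (opposite (hdg a (cur (ob t a))))"
    "\<exists>b\<in>H. b \<noteq> a \<and> X t b = X t a \<and> Q t b = OutBuf (hdg a (cur (ob t a)))"
  using assms by (auto simp: hooked_def others_pos)

lemma hookedI:
  assumes "a \<in> H" "prb (ob t a)" "okp (ob t a)" "Q t a = InBuf (opposite (hdg a (cur (ob t a))))"
    "b \<in> H" "X t b = X t a" "Q t b = OutBuf (hdg a (cur (ob t a)))"
  shows "hooked (ob t a) (V t a)"
proof -
  have "b \<noteq> a" using assms by auto
  then show ?thesis using assms unfolding hooked_def by (auto simp: others_pos)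
qed

text \<open>A change of \<open>cur\<close> or \<open>att\<close> needs a probe, and a probe needs
  \<open>n\<close> moves; so an unexplored agent has always gone left.\<close>

lemma unexplored:
  assumes "live t" "a \<in> H" "mv (ob t a) < n"
  shows "cur (ob t a) = Left" "\<not> att (ob t a)" "\<not> prb (ob t a)" "D t a = hdg a Left"
proof -
  have "cur (ob t a) = Left \<and> \<not> att (ob t a) \<and> \<not> prb (ob t a)"
    using assms
  proof (induction t)
    case 0
    then show ?case by (simp add: ob_0)
  next
    case (Suc t)
    have m: "mv (ob t a) < n" using Suc.prems mv_mono[of "Suc t" a t] by linarith
    then have IH: "cur (ob t a) = Left" "\<not> att (ob t a)" "\<not> prb (ob t a)"
      using Suc live_Suc_D by blast+
    have h: "\<not> hooked (ob t a) (V t a)" using IH by (simp add: hooked_def)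
    show ?case
      using cur_Suc[OF Suc.prems(1,2)] att_Suc[OF Suc.prems(1,2)] prb_Suc[OF Suc.prems(1,2)] IH h m
      by (cases "t mod W = 0"; cases "t mod W = W - 2") (auto simp: firm_def)
  qed
  then show *: "cur (ob t a) = Left" "\<not> att (ob t a)" "\<not> prb (ob t a)" by auto
  show "D t a = hdg a Left"
    using * assms by (auto simp: D_def dec1_def Let_def)
qed

text \<open>An attached agent is \<open>firm\<close> at the end of each window, so
  \<open>prb\<close> cannot be set while the attachment lasts.\<close>

lemma att_cases:
  assumes "live t" "a \<in> H" "att (ob t a)"
  shows "\<not> prb (ob t a)" "D t a = hdg a (cur (ob t a))"
proof -
  show p: "\<not> prb (ob t a)"
    using assms
  proof (induction t)
    case (Suc t)
    show ?case
    proof (cases "t mod W = 0")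
      case False
      then have "att (ob t a)" using att_Suc Suc.prems by blast
      then show ?thesis
        using prb_Suc[OF Suc.prems(1,2)] Suc live_Suc_D False by (cases "t mod W = W - 2") (auto simp: firm_def)
    qed (use prb_Suc Suc in auto)
  qed (simp add: ob_0)
  show "D t a = hdg a (cur (ob t a))"
    using p assms by (auto simp: D_def dec1_def Let_def)
qed

end

section \<open>Motion within one window\<close>

context big
begin

lemma win_mod [simp]: "p < W \<Longrightarrow> (j * W + p) mod W = p" "j * W mod W = 0"
  by auto

text \<open>Turning is confined to offset \<open>0\<close> and the probe to the last two rounds, so
  in between the heading is constant.\<close>

lemma D_window:
  assumes "a \<in> H" "p < W - 2" "live (Suc (j * W + p))"
  shows "hdg a (cur (ob (Suc (j * W + p)) a)) = D (j * W) a \<and> D (j * W + p) a = D (j * W) a"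
  using assms(2,3)
proof (induction p)
  case 0
  then show ?case using cur_Suc(2)[of "j * W" a] assms by simp
next
  case (Suc p)
  have l: "live (Suc (j * W + p))" using Suc.prems live_Suc_D by simp
  have IH: "hdg a (cur (ob (Suc (j * W + p)) a)) = D (j * W) a" using Suc l by simp
  have m: "Suc (j * W + p) mod W = Suc p"
    using Suc.prems win_mod(1)[of "Suc p" j] by simp
  have "D (Suc (j * W + p)) a = D (j * W) a"
    using D_cases(1)[OF l assms(1)] m Suc.prems IH by simp
  moreover have "cur (ob (Suc (Suc (j * W + p))) a) = cur (ob (Suc (j * W + p)) a)"
    using cur_Suc(1)[of "Suc (j * W + p)" a] m Suc.prems assms(1) by simp
  ultimately show ?case using IH by simp
qed

lemma D_end:
  assumes "a \<in> H" "live (j * W + (W - 2))"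
  shows "hdg a (cur (ob (j * W + (W - 2)) a)) = D (j * W) a"
    "D (j * W + (W - 2)) a = (if firm (j * W + (W - 2)) a then D (j * W) a else opposite (D (j * W) a))"
    "live (Suc (j * W + (W - 2))) \<Longrightarrow> D (Suc (j * W + (W - 2))) a = D (j * W) a"
    "live (Suc j * W) \<Longrightarrow> hdg a (cur (ob (Suc j * W) a)) = D (j * W) a"
proof -
  define q where "q = W - 3"
  have q: "W - 2 = Suc q" "q < W - 2" "W = Suc (Suc (Suc q))" using W12 by (auto simp: q_def)
  show 1: "hdg a (cur (ob (j * W + (W - 2)) a)) = D (j * W) a"
    using D_window[OF assms(1), of q j] assms q by simp
  have m: "(j * W + (W - 2)) mod W = W - 2" "Suc (j * W + (W - 2)) mod W = W - 1"
    using win_mod(1)[of "W - 2" j] win_mod(1)[of "W - 1" j] W12 by (auto simp: Suc_diff_Suc numeral_2_eq_2)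
  show "D (j * W + (W - 2)) a = (if firm (j * W + (W - 2)) a then D (j * W) a else opposite (D (j * W) a))"
    using D_cases(2)[OF assms(2,1) m(1)] 1 by simp
  show 2: "D (Suc (j * W + (W - 2))) a = D (j * W) a" if "live (Suc (j * W + (W - 2)))"
    using D_cases(1)[OF that assms(1)] m cur_Suc(1)[OF that assms(1)] 1 W12 by auto
  show "hdg a (cur (ob (Suc j * W) a)) = D (j * W) a" if l: "live (Suc j * W)"
  proof -
    have e: "Suc j * W = Suc (Suc (j * W + (W - 2)))" using W12 by simp
    have "live (Suc (j * W + (W - 2)))" using l unfolding e by (rule live_Suc_D)
    then show ?thesis
      using cur_Suc(1)[of "Suc (j * W + (W - 2))" a] cur_Suc(1)[of "j * W + (W - 2)" a] l e m 1 assms W12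
      by simp
  qed
qed

text \<open>Number of moves with heading \<open>h\<close> from node \<open>v\<close> until edge
  \<open>e\<close> lies directly ahead.\<close>

definition dst :: "nat \<Rightarrow> heading \<Rightarrow> nat \<Rightarrow> nat" where
  "dst v h e = (case h of Clockwise \<Rightarrow> if v \<le> e then e - v else e + n - v
     | Counterclockwise \<Rightarrow> if e < v then v - 1 - e else v + n - 1 - e)"

lemma dst_less: "v < n \<Longrightarrow> e < n \<Longrightarrow> dst v h e < n"
  by (cases h) (auto simp: dst_def)

lemma dst_0: "v < n \<Longrightarrow> e < n \<Longrightarrow> dst v h e = 0 \<longleftrightarrow> edge_towards n v h = e"
  by (cases h) (auto simp: dst_def edge_towards_if simp del: edge_towards.simps)

lemma dst_neighbour:
  "v < n \<Longrightarrow> e < n \<Longrightarrow> edge_towards n v h \<noteq> e \<Longrightarrow> Suc (dst (neighbour n v h) h e) = dst v h e"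
  by (cases h) (auto simp: dst_def neighbour_if edge_towards_if
      simp del: neighbour.simps edge_towards.simps)

text \<open>The distance drops by one per round until it is \<open>0\<close>; the bound with
  \<open>max\<close> expresses this without a subtraction of naturals.\<close>

lemma dst_decr:
  assumes "a \<in> H" "e < n" "live (j * W + p + q)" "p + q \<le> W - 2"
    "\<And>t. j * W + p \<le> t \<Longrightarrow> t < j * W + p + q \<Longrightarrow> miss t = Some e"
  shows "dst (X (j * W + p + q) a) (D (j * W) a) e + q \<le> max q (dst (X (j * W + p) a) (D (j * W) a) e)"
  using assms(3-)
proof (induction q)
  case (Suc q)
  let ?t = "j * W + p + q"
  have l: "live (Suc ?t)" using Suc.prems by simp
  have d: "D ?t a = D (j * W) a"
    using D_window[of a "p + q" j] Suc.prems assms(1) by (simp add: add.assoc)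
  have m: "miss ?t = Some e" using Suc.prems by simp
  have IH: "dst (X ?t a) (D (j * W) a) e + q \<le> max q (dst (X (j * W + p) a) (D (j * W) a) e)"
    using Suc live_Suc_D[OF l] by simp
  have x: "X ?t a < n" using assms by simp
  show ?case
  proof (cases "edge_towards n (X ?t a) (D (j * W) a) = e")
    case True
    then have "X (Suc ?t) a = X ?t a" using X_Suc[OF l assms(1)] m d by (simp add: stuck_def)
    moreover have "dst (X ?t a) (D (j * W) a) e = 0" using True dst_0[OF x assms(2)] by simp
    ultimately show ?thesis by simp
  next
    case False
    then have "X (Suc ?t) a = neighbour n (X ?t a) (D (j * W) a)"
      using X_Suc[OF l assms(1)] m d by (simp add: stuck_def)
    then show ?thesis using IH dst_neighbour[OF x assms(2) False] by simp
  qed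
qed simp

text \<open>Only one edge can be missing, so an agent moves in every round until it reaches that edge, which
  is at distance less than \<open>n\<close>.\<close>

lemma attract:
  assumes "a \<in> H" "live (j * W + p + n)" "p + n \<le> W - 2"
    "\<And>t. j * W + p \<le> t \<Longrightarrow> t < j * W + p + n \<Longrightarrow> miss t = Some e" "e < n"
  shows "edge_towards n (X (j * W + p + n) a) (D (j * W) a) = e" "stuck (j * W + p + n - 1) a"
proof -
  let ?d = "\<lambda>t. dst (X t a) (D (j * W) a) e"
  have x: "X t a < n" for t using assms by simp
  have s: "?d (j * W + p) < n" using dst_less assms x by blast
  have "?d (j * W + p + n) + n \<le> max n (?d (j * W + p))"
    using dst_decr[OF assms(1,5,2,3)] assms by blast
  then have "?d (j * W + p + n) = 0" using s by simp
  then show "edge_towards n (X (j * W + p + n) a) (D (j * W) a) = e" using dst_0 x assms by blast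
  \<comment> \<open>The distance is below \<open>n\<close>, so it is already \<open>0\<close> one
    round earlier, and the last of the \<open>n\<close> rounds is spent blocked.\<close>
  define q where "q = n - 1"
  have q: "q < n" "n - 1 = q" "p + q < W - 2" "j * W + p + n - 1 = j * W + p + q" "j * W + p + q \<le> j * W + p + n"
    using n3 assms(3) by (auto simp: q_def)
  have l: "live (j * W + p + q)" using assms(2) q(5) by (rule live_mono)
  have "?d (j * W + p + q) + q \<le> max q (?d (j * W + p))"
    using dst_decr[OF assms(1,5) l] assms q by simp
  then have "?d (j * W + p + q) = 0" using s q by linarith
  then have "edge_towards n (X (j * W + p + q) a) (D (j * W) a) = e" using dst_0 x assms by blast
  moreover have "live (Suc (j * W + (p + q)))" by (rule live_mono[OF assms(2)]) (use q in linarith)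
  then have "D (j * W + p + q) a = D (j * W) a"
    using D_window[of a "p + q" j] assms(1) q by (simp add: add.assoc)
  moreover have "miss (j * W + p + q) = Some e" using assms(4) q by simp
  ultimately show "stuck (j * W + p + n - 1) a" unfolding stuck_def q(4) by simp
qed

lemma stuck_neq: "live (Suc t) \<Longrightarrow> a \<in> H \<Longrightarrow> stuck t a \<longleftrightarrow> X (Suc t) a = X t a"
  using neighbour_neq[of "X t a" n "D t a"] n3 by (auto simp: X_Suc)

lemma Q_out: "live (Suc t) \<Longrightarrow> a \<in> H \<Longrightarrow> Q (Suc t) a = OutBuf h \<longleftrightarrow> stuck t a \<and> D t a = h"
  by (auto simp: Q_Suc)

lemma Q_in: "live (Suc t) \<Longrightarrow> a \<in> H \<Longrightarrow> Q (Suc t) a = InBuf h \<longleftrightarrow> \<not> stuck t a \<and> D t a = opposite h"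
  by (auto simp: Q_Suc)

lemma stuck_cong: "X t b = X t a \<Longrightarrow> D t b = D t a \<Longrightarrow> stuck t b = stuck t a"
  by (simp add: stuck_def)

lemma miss_less: "miss t = Some e \<Longrightarrow> e < n"
  using scen by (auto simp: scenarios_def)

text \<open>This is why probes can be trusted. An attachment is given up with the first move, so it
  lasts only while the agent is blocked together with its companion. The induction is over time for
  all agents at once, because the companion found by a probe may itself only be attached; then the
  claim two rounds earlier applies to it.\<close>

lemma mate:
  assumes "live t" "a \<in> H" "att (ob t a) \<or> t mod W = 0 \<and> hooked (ob t a) (V t a)"
  shows "\<exists>b\<in>H. X t b = X t a \<and> D t b = D t a \<and> mv (ob t b) < n"
  using assms
proof (induction t arbitrary: a rule: less_induct)
  case (less t)
  show ?case
  proof (cases "att (ob t a)")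
    case True
    then obtain s where s: "t = Suc s" using ob_0 by (cases t) auto
    have l: "live (Suc s)" "live s" using less.prems s live_Suc_D by auto
    have as: "att (ob s a) \<or> s mod W = 0 \<and> hooked (ob s a) (V s a)" and st: "stuck s a"
      using True att_Suc[OF l(1) less.prems(2)] s by (cases "s mod W = 0"; simp)+
    obtain b where b: "b \<in> H" "X s b = X s a" "D s b = D s a" "mv (ob s b) < n"
      using less.IH[OF _ l(2) less.prems(2) as] s by auto
    have sb: "stuck s b" using stuck_cong[OF b(2,3)] st by simp
    have m: "mv (ob t b) < n" using ob_Suc(1)[OF l(1) b(1)] sb b s by simp
    have "D t b = D s b"
      using unexplored(4)[OF _ b(1)] m b(4) l s by simp
    moreover have "D t a = D s a"
    proof (cases "s mod W = 0")
      case True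
      then show ?thesis using att_cases[of t a] less.prems \<open>att (ob t a)\<close> cur_Suc(2)[OF l(1)] s by simp
    next
      case False
      then show ?thesis
        using att_cases[of t a] att_cases[of s a] less.prems \<open>att (ob t a)\<close> cur_Suc(1)[OF l(1)] l s as by simp
    qed
    moreover have "X t b = X t a" using X_Suc[OF l(1)] b less.prems(2) st sb s by simp
    ultimately show ?thesis using b m by auto
  next
    case False
    then have tm: "t mod W = 0" and hk: "hooked (ob t a) (V t a)" using less.prems by auto
    have t0: "0 < t" using hookedD(1)[OF less.prems(2) hk] ob_0 by (cases t) auto
    then obtain j where j: "t = Suc j * W"
    proof -
      obtain i where i: "t = W * i" using tm mod_0_imp_dvd dvdE by blast
      then obtain j where "i = Suc j" using t0 by (cases i) auto
      then have "t = Suc j * W" using i by (simp add: mult.commute)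
      then show ?thesis by (rule that)
    qed
    define s where "s = j * W + (W - 2)"
    have ts: "t = Suc (Suc s)" using j W12 by (simp add: s_def)
    have l: "live (Suc (Suc s))" "live (Suc s)" "live s" using less.prems ts live_Suc_D by auto
    have ms: "s mod W = W - 2" "Suc s mod W = W - 1"
      using win_mod(1)[of "W - 2" j] win_mod(1)[of "W - 1" j] W12
      by (auto simp: s_def Suc_diff_Suc numeral_2_eq_2)
    define h where "h = D (j * W) a"
    define u where "u = X s a"
    note De = D_end[of _ j, folded s_def]
    have ca: "hdg a (cur (ob s a)) = h" "hdg a (cur (ob (Suc s) a)) = h" "hdg a (cur (ob t a)) = h"
      "D (Suc s) a = h"
      using De(1,3,4)[OF less.prems(2)] l ts j cur_Suc(1)[OF l(2) less.prems(2)] ms W12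
      by (auto simp: h_def)
    have pr: "\<not> firm s a" using hookedD(1)[OF less.prems(2) hk] prb_Suc(3)[OF l(1) less.prems(2)]
        prb_Suc(1)[OF l(2) less.prems(2)] ms W12 ts by auto
    have ok: "n \<le> blk (ob s a)" "Q (Suc s) a = InBuf h"
      using hookedD(2)[OF less.prems(2) hk] okp_Suc(2)[OF l(1) less.prems(2)]
        okp_Suc(1)[OF l(2) less.prems(2)] ms W12 ts ca by auto
    have Ds: "D s a = opposite h" using De(2) less.prems(2) l pr by (simp add: h_def)
    have na: "\<not> stuck s a" using ok(2) Q_in[OF l(2) less.prems(2)] by simp
    have na2: "\<not> stuck (Suc s) a"
      using hookedD(3)[OF less.prems(2) hk] Q_in[OF l(1) less.prems(2)] ts by simp
    have "X t a = neighbour n (neighbour n u (opposite h)) h"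
      using X_Suc[OF l(1) less.prems(2)] X_Suc[OF l(2) less.prems(2)] na na2 ca Ds ts by (simp add: u_def)
    then have xa: "X t a = u"
      using neighbour_opposite[of u n "opposite h"] less.prems(2) by (simp add: u_def)
    \<comment> \<open>\<open>okp\<close> guarantees that the edge has been missing for the
      \<open>n\<close> rounds before the probe. This is just enough for \<open>attract\<close> to
      place every agent at one of its ends.\<close>
    define p where "p = W - 2 - n"
    have p: "p + n = W - 2" "s = j * W + p + n" using n3 by (auto simp: p_def win_def s_def)
    have stk: "stuck r a" if "j * W + p \<le> r" "r < s" for r
      using blk_stuck[OF l(3) less.prems(2), of r] that ok(1) p by linarith
    define e where "e = edge_towards n u h"
    have en: "e < n" using edge_towards_less[of n u h] n3 less.prems(2) by (simp add: e_def u_def)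
    have mi: "miss r = Some e" if r: "j * W + p \<le> r" "r < j * W + p + n" for r
    proof -
      have lr: "live (Suc r)" using l(3) live_mono r p by auto
      have "D r a = h"
        using D_window[OF less.prems(2), of "r - j * W" j] r p lr by (simp add: h_def)
      moreover have "X s a = X r a" using X_stuck[OF l(3) less.prems(2), of r] stk r p by simp
      ultimately show ?thesis using stk[of r] r p by (simp add: stuck_def e_def u_def)
    qed
    have poised: "edge_towards n (X s c) (D (j * W) c) = e" if "c \<in> H" for c
      using attract(1)[OF that, of j p e] l(3) p mi en by simp
    obtain b where b: "b \<in> H" "X t b = u" "Q t b = OutBuf h"
      using hookedD(4)[OF less.prems(2) hk] ca xa by auto
    have sb: "stuck (Suc s) b" "D (Suc s) b = h" using b(3) Q_out[OF l(1) b(1)] ts by auto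
    have xb1: "X (Suc s) b = u" using sb X_Suc[OF l(1) b(1)] b ts by simp
    have Db: "D (j * W) b = h" using De(3)[OF b(1)] l sb by simp
    have xb: "X s b = u"
      using poised[OF b(1)] Db e_def edge_towards_inj[of "X s b" n u h] b(1) less.prems(2) by (simp add: u_def)
    have sb0: "stuck s b" using stuck_neq[OF l(2) b(1)] xb xb1 by simp
    \<comment> \<open>Had \<open>b\<close> probed too, it would have stepped back along with
      \<open>a\<close>, which was not blocked in round \<open>s\<close>; but \<open>b\<close>
      was.\<close>
    have fb: "firm s b"
    proof (rule ccontr)
      assume "\<not> firm s b"
      then have "D s b = D s a" using De(2)[OF b(1)] l Db Ds by simp
      then show False using stuck_cong[of s b a] xb sb0 na by (simp add: u_def)
    qed
    have Dsb: "D s b = h" using De(2)[OF b(1)] l fb Db by simp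
    have "\<exists>c\<in>H. X s c = u \<and> D s c = h \<and> mv (ob s c) < n"
    proof (cases "mv (ob s b) < n")
      case True
      then show ?thesis using b xb Dsb by blast
    next
      case False
      then have "att (ob s b)" using fb by (simp add: firm_def)
      then show ?thesis using less.IH[of s b] l b xb Dsb ts by auto
    qed
    then obtain c where c: "c \<in> H" "X s c = u" "D s c = h" "mv (ob s c) < n" by blast
    have s1: "stuck s c" using stuck_cong[of s c b] c xb Dsb sb0 by simp
    have m1: "mv (ob (Suc s) c) < n" using ob_Suc(1)[OF l(2) c(1)] s1 c by simp
    have x1: "X (Suc s) c = u" using X_Suc[OF l(2) c(1)] s1 c by simp
    have d1: "D (Suc s) c = h" using unexplored(4)[OF _ c(1)] l m1 c by metis
    have s2: "stuck (Suc s) c" using stuck_cong[of "Suc s" c b] x1 xb1 d1 sb by simp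
    have m2: "mv (ob t c) < n" using ob_Suc(1)[OF l(1) c(1)] s2 m1 ts by simp
    have x2: "X t c = u" using X_Suc[OF l(1) c(1)] s2 x1 ts by simp
    have d2: "D t c = h" using unexplored(4)[OF _ c(1)] l m1 m2 d1 ts by metis
    have "D t a = h" using hk tm less.prems ca(3) by (simp add: D_def dec1_def Let_def)
    then show ?thesis using c x2 xa d2 m2 by auto
  qed
qed

end

section \<open>Causes of alarms, and the effect of a window with one missing edge\<close>

context big
begin

text \<open>While nobody has terminated, the other two causes cannot occur. Agents are at the node
  proper only in round \<open>0\<close>, when they are at distinct nodes; and the companions counted
  at offset \<open>1\<close> push in the same direction, so they cross together.\<close>

lemma alarm_cause:
  assumes "live t" "a \<in> H" "ring t a"
  shows "t mod W = 1" "mv (ob t a) < n" "2 * W + 1 \<le> blk (ob t a)"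
proof -
  have 1: "\<not> 0 < others (V t a) AtNode"
  proof
    assume "0 < others (V t a) AtNode"
    then obtain b where b: "b \<in> H" "b \<noteq> a" "X t b = X t a" "Q t b = AtNode"
      using others_pos[OF assms(2), of "prot n" t AtNode] by auto
    show False
    proof (cases t)
      case 0
      then show ?thesis using b by simp
    next
      case (Suc s)
      then show ?thesis using b Q_Suc[of s b] assms by (auto split: if_splits)
    qed
  qed
  have 2: False if m: "t mod W = 2" and i: "own_place (V t a) = InBuf (opp (cur (ob t a)))"
    and o: "others (V t a) (InBuf (opp (cur (ob t a)))) < cmp (ob t a)"
  proof -
    have "0 < t mod W" using m by simp
    then have "t mod W \<le> t" by simp
    define j where "j = t div W"
    have ts: "t = Suc (Suc (j * W))"
      using m div_mult_mod_eq[of t W] by (simp add: j_def)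
    define s where "s = Suc (j * W)"
    have l: "live (Suc s)" "live s" using assms ts live_Suc_D by (auto simp: s_def)
    have ms: "s mod W = 1" using win_mod(1)[of 1 j] W12 by (simp add: s_def)
    define h where "h = hdg a (cur (ob s a))"
    have c: "cur (ob t a) = cur (ob s a)" using cur_Suc(1)[OF l(1) assms(2)] ms W12 ts by (simp add: s_def)
    have "cmp (ob t a) = (if own_place (V s a) = OutBuf (cur (ob s a)) then others (V s a) (OutBuf (cur (ob s a))) else 0)"
      using ob_Suc(7)[OF l(1) assms(2)] l(2) assms(2) ms W12 ts by (simp add: s_def dec1_def Let_def)
    then have qa: "Q s a = OutBuf h" and
      less: "others (V t a) (InBuf (opp (cur (ob t a)))) < others (V s a) (OutBuf (cur (ob s a)))"
      using o assms(2) by (auto simp: h_def split: if_splits)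
    have pushes: "D s b = h" if "b \<in> H" "Q s b = OutBuf h" for b
      using that Q_out[of "j * W" b h] cur_Suc(2)[of "j * W" b] D_cases(1)[OF l(2), of b] l ms W12
      by (auto simp: s_def)
    have na: "\<not> stuck s a" using i c Q_in[OF l(1) assms(2), of "opposite h"] assms(2) pushes[OF assms(2) qa] ts
      by (simp add: s_def h_def)
    have "{b \<in> H. b \<noteq> a \<and> X s b = X s a \<and> Q s b = map_place (hdg a) (OutBuf (cur (ob s a)))}
      \<subseteq> {b \<in> H. b \<noteq> a \<and> X t b = X t a \<and> Q t b = map_place (hdg a) (InBuf (opp (cur (ob t a))))}"
    proof safe
      fix b assume b: "b \<in> H" "b \<noteq> a" "X s b = X s a" "Q s b = map_place (hdg a) (OutBuf (cur (ob s a)))"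
      have Db: "D s b = h" "D s a = h" using pushes b qa assms(2) by (auto simp: h_def)
      have nb: "\<not> stuck s b" using stuck_cong[of s b a] b(3) Db na by simp
      have t: "t = Suc s" using ts by (simp add: s_def)
      show "X t b = X t a" using X_Suc[OF l(1)] b assms(2) nb na Db t by simp
      show "Q t b = map_place (hdg a) (InBuf (opp (cur (ob t a))))"
        using Q_Suc[OF l(1) b(1)] nb Db t c assms(2) by (simp add: h_def)
    qed
    then have "others (V s a) (OutBuf (cur (ob s a))) \<le> others (V t a) (InBuf (opp (cur (ob t a))))"
      unfolding view_others[OF assms(2)] by (intro card_mono) auto
    then show False using less by simp
  qed
  have "t mod W = 1 \<and> mv (ob t a) < n \<and> 2 * W + 1 \<le> blk (ob t a)"
    using assms 1 2 by (auto simp: ring_def alarm_def)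
  then show "t mod W = 1" "mv (ob t a) < n" "2 * W + 1 \<le> blk (ob t a)" by auto
qed

text \<open>Three windows from a window boundary contain the round with offset \<open>1\<close>
  after two complete windows. An unexplored agent blocked until then would give alarm there,
  contrary to \<open>live\<close>.\<close>

lemma explored:
  "live (3 * i * W) \<Longrightarrow> a \<in> H \<Longrightarrow> min n i \<le> mv (ob (3 * i * W) a)"
proof (induction i)
  case (Suc i)
  let ?s = "3 * i * W" and ?t = "3 * Suc i * W" and ?r = "3 * i * W + (2 * W + 1)"
  have le: "?s \<le> ?t" "?r < ?t" "?s \<le> ?r" using W12 by (auto simp: algebra_simps)
  have ls: "live ?s" "live ?r" "live (Suc ?r)" using Suc.prems(1) live_mono le by auto
  have IH: "min n i \<le> mv (ob ?s a)" using Suc ls by blast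
  have mono: "mv (ob ?s a) \<le> mv (ob ?t a)" using mv_mono Suc.prems le by blast
  show ?case
  proof (rule ccontr)
    assume c: "\<not> ?case"
    then have eq: "mv (ob ?t a) = mv (ob ?s a)" "mv (ob ?t a) < n" using IH mono by auto
    have stk: "stuck q a" if "?s \<le> q" "q < ?t" for q
    proof -
      have lq: "live (Suc q)" using live_mono[OF Suc.prems(1)] that by simp
      have "mv (ob ?s a) \<le> mv (ob q a)" "mv (ob (Suc q) a) \<le> mv (ob ?t a)"
        using mv_mono[of q a ?s] mv_mono[of ?t a "Suc q"] that Suc.prems lq live_Suc_D by auto
      then show ?thesis using eq ob_Suc(1)[OF lq Suc.prems(2)] by (auto split: if_splits)
    qed
    have "?r - ?s \<le> blk (ob ?r a)"
      by (rule stuck_blk[OF ls(2) Suc.prems(2) le(3)]) (use stk le in auto)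
    moreover have "mv (ob ?r a) < n" using mv_mono[OF Suc.prems(1,2), of ?r] le eq by simp
    moreover have "?r mod W = 1"
      using win_mod(1)[of 1 "3 * i + 2"] W12 by (simp add: algebra_simps)
    ultimately have "ring ?r a" using ls Suc.prems(2) by (simp add: ring_def alarm_def)
    then show False using live_SucE(2)[OF ls(3) Suc.prems(2)] by simp
  qed
qed simp

text \<open>The two edges at a node being distinct, the missing one that blocks an agent leaves its
  step back and its return undisturbed. So every probe goes as planned, and only the presence of a
  firm companion decides whether the agent turns.\<close>

lemma window_end:
  assumes gone: "\<forall>t. i * W \<le> t \<and> t < Suc i * W \<longrightarrow> miss t = Some e"
    and live: "live (Suc i * W)" and a: "a \<in> H"
  defines "s \<equiv> i * W + (W - 2)" and "t \<equiv> Suc i * W" and "h \<equiv> D (i * W) a"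
  shows "edge_towards n (X s a) h = e" "X t a = X s a"
    "firm s a \<Longrightarrow> stuck s a \<and> stuck (Suc s) a \<and> firm t a \<and> D t a = h \<and> Q t a = OutBuf h"
    "\<not> firm s a \<Longrightarrow> prb (ob t a) \<and> okp (ob t a) \<and> Q t a = InBuf (opposite h)
       \<and> D t a = (if hooked (ob t a) (V t a) then h else opposite h)"
    "hdg a (cur (ob t a)) = h" "n \<le> r \<Longrightarrow> r \<le> W - 2 \<Longrightarrow> X (i * W + r) a = X s a"
    "n \<le> r \<Longrightarrow> r < W - 2 \<Longrightarrow> stuck (i * W + r) a"
proof -
  have miss: "miss t = Some e" if "i * W \<le> t" "t < Suc i * W" for t using gone that by blast
  have ts: "t = Suc (Suc s)" using W12 by (simp add: s_def t_def)
  have l: "live (Suc (Suc s))" "live (Suc s)" "live s" using live ts live_Suc_D by (auto simp: t_def)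
  have en: "e < n" using miss_less[OF miss[of "i * W"]] W12 by simp
  have ms: "s mod W = W - 2" "Suc s mod W = W - 1" "t mod W = 0"
    using win_mod(1)[of "W - 2" i] win_mod(1)[of "W - 1" i] W12
    by (auto simp: s_def t_def Suc_diff_Suc numeral_2_eq_2)
  have mi: "miss s = Some e" "miss (Suc s) = Some e" using miss W12 by (auto simp: s_def)
  have n2: "n \<le> W - 2" using n3 by (simp add: win_def)
  have at: "edge_towards n (X (i * W + r) a) h = e \<and> stuck (i * W + r - 1) a" if r: "n \<le> r" "r \<le> W - 2" for r
  proof -
    have lr: "live (i * W + (r - n) + n)" using live_mono[OF l(3)] r by (simp add: s_def)
    show ?thesis
      using attract[OF a lr _ _ en] miss r n2 W12 by (simp add: h_def)
  qed
  show e: "edge_towards n (X s a) h = e" using at[of "W - 2"] n2 by (simp add: s_def)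
  have ss: "stuck (i * W + r) a" if "n \<le> r" "r < W - 2" for r
    using at[of "Suc r"] that by simp
  show xr: "X (i * W + r) a = X s a" if "n \<le> r" "r \<le> W - 2" for r
  proof -
    have "X s a = X (i * W + r) a \<and> mv (ob s a) = mv (ob (i * W + r) a)"
    proof (rule X_stuck[OF l(3) a])
      show "i * W + r \<le> s" using that by (simp add: s_def)
      show "\<forall>q. i * W + r \<le> q \<and> q < s \<longrightarrow> stuck q a"
      proof safe
        fix q assume q: "i * W + r \<le> q" "q < s"
        have "q = i * W + (q - i * W)" using q by simp
        moreover have "n \<le> q - i * W" "q - i * W < W - 2" using q that by (auto simp: s_def)
        ultimately show "stuck q a" using ss by metis
      qed
    qed
    then show ?thesis by simp
  qed
  show "stuck (i * W + r) a" if "n \<le> r" "r < W - 2" using ss that .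
  note De = D_end[OF a, of i, folded s_def t_def h_def]
  show cu: "hdg a (cur (ob t a)) = h" using De(4) live l(3) by (simp add: t_def)
  have D1: "D (Suc s) a = h" using De(3) l by simp
  have xs: "X s a < n" using a by simp
  have blk: "n \<le> blk (ob s a)"
  proof -
    have "s - (i * W + n) \<le> blk (ob s a)"
    proof (rule stuck_blk[OF l(3) a])
      show "i * W + n \<le> s" using n2 by (simp add: s_def)
      show "\<forall>q. i * W + n \<le> q \<and> q < s \<longrightarrow> stuck q a"
      proof safe
        fix q assume q: "i * W + n \<le> q" "q < s"
        have "q = i * W + (q - i * W)" using q by simp
        moreover have "n \<le> q - i * W" "q - i * W < W - 2" using q by (auto simp: s_def)
        ultimately show "stuck q a" using ss by metis
      qed
    qed
    then show ?thesis using n3 by (simp add: s_def win_def)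
  qed
  have D_t: "D t a = (if prb (ob t a) \<and> \<not> hooked (ob t a) (V t a) then opposite h else h)"
    using ms(3) live a cu by (simp add: D_def dec1_def Let_def t_def)
  have firmD: "stuck s a \<and> stuck (Suc s) a \<and> firm t a \<and> D t a = h \<and> Q t a = OutBuf h \<and> X t a = X s a"
    if f: "firm s a"
  proof -
    have D0: "D s a = h" using De(2) l f by simp
    have s0: "stuck s a" using D0 e mi by (simp add: stuck_def)
    have x1: "X (Suc s) a = X s a" using X_Suc[OF l(2) a] s0 by simp
    have s1: "stuck (Suc s) a" using D1 e mi x1 by (simp add: stuck_def)
    have x2: "X t a = X s a" using X_Suc[OF l(1) a] s1 x1 ts by simp
    have q: "Q t a = OutBuf h" using Q_Suc[OF l(1) a] s1 D1 ts by simp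
    have m: "mv (ob t a) = mv (ob s a)" using ob_Suc(1)[OF l(1) a] ob_Suc(1)[OF l(2) a] s0 s1 ts by simp
    have at: "att (ob t a) = att (ob s a)"
      using att_Suc(1)[OF l(1) a] att_Suc(1)[OF l(2) a] s0 s1 ts ms W12 by simp
    have np: "\<not> prb (ob t a)"
      using prb_Suc(1)[OF l(2) a] prb_Suc(3)[OF l(1) a] ms f W12 ts by simp
    show ?thesis using s0 s1 x2 q m at f np D_t by (simp add: firm_def)
  qed
  have weakD: "prb (ob t a) \<and> okp (ob t a) \<and> Q t a = InBuf (opposite h) \<and> X t a = X s a"
    if f: "\<not> firm s a"
  proof -
    have D0: "D s a = opposite h" using De(2) l f by simp
    have "edge_towards n (X s a) (opposite h) \<noteq> e" using edge_towards_both[OF xs, of h] n3 e by simp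
    then have s0: "\<not> stuck s a" using D0 mi by (simp add: stuck_def)
    have x1: "X (Suc s) a = neighbour n (X s a) (opposite h)" using X_Suc[OF l(2) a] s0 D0 by simp
    have q1: "Q (Suc s) a = InBuf h" using Q_Suc[OF l(2) a] s0 D0 by simp
    have "edge_towards n (X (Suc s) a) h = edge_towards n (X s a) (opposite h)"
      using edge_towards_opposite[OF xs, of "opposite h"] x1 by simp
    then have s1: "\<not> stuck (Suc s) a"
      using D1 mi edge_towards_both[OF xs, of h] n3 e by (simp add: stuck_def)
    have x2: "X t a = X s a"
      using X_Suc[OF l(1) a] s1 x1 D1 neighbour_opposite[OF xs, of "opposite h"] ts by simp
    have q: "Q t a = InBuf (opposite h)" using Q_Suc[OF l(1) a] s1 D1 ts by simp
    have p: "prb (ob t a)"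
      using prb_Suc(1)[OF l(2) a] prb_Suc(3)[OF l(1) a] ms f W12 ts by simp
    have c1: "hdg a (cur (ob (Suc s) a)) = h"
      using cur_Suc(1)[OF l(2) a] ms W12 De(1) l by simp
    have "okp (ob t a)"
      using okp_Suc(1)[OF l(2) a] okp_Suc(2)[OF l(1) a] ms W12 ts blk q1 c1 by simp
    then show ?thesis using p q x2 by simp
  qed
  show "X t a = X s a" using firmD weakD by blast
  show "firm s a \<Longrightarrow> stuck s a \<and> stuck (Suc s) a \<and> firm t a \<and> D t a = h \<and> Q t a = OutBuf h"
    using firmD by blast
  show "\<not> firm s a \<Longrightarrow> prb (ob t a) \<and> okp (ob t a) \<and> Q t a = InBuf (opposite h)
       \<and> D t a = (if hooked (ob t a) (V t a) then h else opposite h)"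
    using weakD D_t by simp
qed

lemma firm_stays:
  assumes "live t" "a \<in> H" "s \<le> t" "firm s a" "\<forall>r. s \<le> r \<and> r < t \<longrightarrow> stuck r a"
  shows "firm t a"
  using assms
proof (induction t)
  case (Suc t)
  show ?case
  proof (cases "s = Suc t")
    case True
    then show ?thesis using Suc.prems by simp
  next
    case False
    then have f: "firm t a" using Suc live_Suc_D by auto
    have "stuck t a" using Suc.prems False by auto
    then show ?thesis
      using f ob_Suc(1)[OF Suc.prems(1,2)] att_Suc[OF Suc.prems(1,2)]
      by (cases "t mod W = 0") (auto simp: firm_def)
  qed
qed simp

end

section \<open>Positions of all agents at the first alarm\<close>

context big
begin

lemma X_inj:
  "b \<in> H \<Longrightarrow> c \<in> H \<Longrightarrow> edge_towards n (X r b) h = edge_towards n (X q c) h \<Longrightarrow> X r b = X q c"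
  using edge_towards_inj[OF X_less X_less] .

lemma X_facing:
  "b \<in> H \<Longrightarrow> c \<in> H \<Longrightarrow> edge_towards n (X r b) (opposite h) = edge_towards n (X q c) h
    \<Longrightarrow> X r b = neighbour n (X q c) h"
  using edge_towards_facing[OF X_less X_less] .

lemma X_both: "c \<in> H \<Longrightarrow> edge_towards n (X r c) (opposite h) \<noteq> edge_towards n (X r c) h"
  using edge_towards_both[OF X_less] n3 by simp

lemma firm_Suc: "live (Suc t) \<Longrightarrow> a \<in> H \<Longrightarrow> firm t a \<Longrightarrow> stuck t a \<Longrightarrow> firm (Suc t) a"
  by (rule firm_stays[of "Suc t" a t]) (auto simp: less_Suc_eq_le dest: le_antisym)

text \<open>The two windows have different tasks. Agents that turn after the first one had no firm
  agent at their end; as \<open>g\<close> is firm, that end was not the one of \<open>g\<close>, and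
  they walk round to \<open>g\<close>, which their second probe finds. The others stay. The alarm is
  given at offset \<open>1\<close>, when the decisions of offset \<open>0\<close> have been carried
  out and all agents push again.\<close>

lemma poised:
  assumes live: "live (Suc (j * W))" and g: "g \<in> H" and ring: "ring (Suc (j * W)) g"
  shows "\<exists>e. \<forall>c\<in>H. edge_towards n (X (Suc (j * W)) c) (D (Suc (j * W)) c) = e
    \<and> Q (Suc (j * W)) c = OutBuf (D (Suc (j * W)) c) \<and> firm (Suc (j * W)) c
    \<and> D (Suc (j * W)) c = hdg c (cur (ob (Suc (j * W)) c)) \<and> \<not> prb (ob (Suc (j * W)) c)
    \<and> (mv (ob (Suc (j * W)) c) < n \<longrightarrow> W + 1 \<le> blk (ob (Suc (j * W)) c))"
proof -
  define t1 where "t1 = Suc (j * W)"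
  note cause = alarm_cause[OF live g ring]
  \<comment> \<open>The delay of \<open>g\<close> cannot exceed the time, so two complete windows
    lie behind.\<close>
  have "2 * W + 1 \<le> t1" using cause(3) blk_le[OF live g] unfolding t1_def by (rule le_trans)
  then have "2 * W \<le> j * W" unfolding t1_def by linarith
  then have "2 \<le> j" using W12 by simp
  then obtain i where j: "j = Suc (Suc i)" using that[of "j - 2"] by simp
  have lv: "live t1" using live by (simp add: t1_def)
  have gs: "stuck r g" if "i * W \<le> r" "r \<le> j * W" for r
  proof (rule blk_stuck[OF lv g])
    show "r < t1" using that by (simp add: t1_def)
    show "t1 - r \<le> blk (ob t1 g)" using that cause(3) j by (simp add: t1_def)
  qed
  have lr: "live r" if "r \<le> t1" for r using live_mono[OF lv that] .
  have iw: "i * W \<le> t1" by (simp add: t1_def j)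
  have gx: "X t1 g = X r g \<and> mv (ob t1 g) = mv (ob r g)" if "i * W \<le> r" "r \<le> t1" for r
    by (rule X_stuck[OF lv g that(2)]) (use gs that in \<open>auto simp: t1_def\<close>)
  have gm: "mv (ob r g) < n" if "i * W \<le> r" "r \<le> t1" for r
    using gx[OF that] cause(2) by (simp add: t1_def)
  have gD: "D r g = hdg g Left" if "i * W \<le> r" "r \<le> t1" for r
    using unexplored(4)[OF lr g gm] that by blast
  define e where "e = edge_towards n (X t1 g) (hdg g Left)"
  have mi: "miss r = Some e" if "i * W \<le> r" "r \<le> j * W" for r
    using gs[OF that] gx[of r] gD[of r] that by (simp add: stuck_def e_def t1_def)
  define s where "s = i * W + (W - 2)"
  define t where "t = Suc i * W"
  define s' where "s' = Suc i * W + (W - 2)"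
  define t2 where "t2 = j * W"
  have ord: "s < t" "t \<le> s'" "s' < t2" "t2 < t1" "t1 = Suc t2" "i * W \<le> s"
    using W12 by (auto simp: s_def t_def s'_def t2_def t1_def j)
  have m1: "\<forall>r. i * W \<le> r \<and> r < Suc i * W \<longrightarrow> miss r = Some e"
    using mi j by simp
  have m2: "\<forall>r. Suc i * W \<le> r \<and> r < Suc (Suc i) * W \<longrightarrow> miss r = Some e"
    using mi j by simp
  have l1: "live (Suc i * W)" using lr ord by (simp add: t_def)
  have l2: "live (Suc (Suc i) * W)" using lr ord by (simp add: t2_def j)
  note we1 = window_end[of i e, OF m1 l1, folded s_def t_def]
  note we2 = window_end[of "Suc i" e, OF m2 l2, folded s'_def j t2_def, folded t_def]
  have gfirm: "firm r g" if "i * W \<le> r" "r \<le> t1" for r using gm that by (simp add: firm_def)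
  \<comment> \<open>At the ends of a single edge, the node and the heading towards the edge
    determine each other.\<close>
  have same: "D (i * W) b = D (i * W) c \<longleftrightarrow> X s b = X s c" if "b \<in> H" "c \<in> H" for b c
  proof
    assume "D (i * W) b = D (i * W) c"
    then show "X s b = X s c"
      using we1(1)[OF that(1)] we1(1)[OF that(2)] by (intro X_inj[OF that, of s "D (i * W) c" s]) simp
  next
    assume x: "X s b = X s c"
    show "D (i * W) b = D (i * W) c"
    proof (rule ccontr)
      assume "D (i * W) b \<noteq> D (i * W) c"
      then have "D (i * W) c = opposite (D (i * W) b)" by (simp add: heading_neq)
      then show False
        using we1(1)[OF that(1)] we1(1)[OF that(2)] x X_both[OF that(1), of s "D (i * W) b"] by simp
    qed
  qed
  text \<open>An agent that does not turn at the end of the first window stays where it is.\<close>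
  have keep: "firm r c \<and> X r c = X s c \<and> (r \<le> t2 \<longrightarrow> D t c = D (i * W) c)"
    if c: "c \<in> H" and f: "firm s c \<or> hooked (ob t c) (V t c)" and r: "Suc t \<le> r" "r \<le> s'" for r c
  proof -
    have Dt: "D t c = D (i * W) c" using we1(3,4)[OF c] f by metis
    have xt: "X t c = X s c" using we1(2)[OF c] .
    have et: "edge_towards n (X t c) (D t c) = e" using we1(1)[OF c] Dt xt by simp
    have Dq: "D q c = D t c" if "t \<le> q" "q < s'" for q
    proof -
      have "q = t + (q - t)" "q - t < W - 2" using that by (auto simp: s'_def t_def)
      then show ?thesis
        using D_window[OF c, of "q - t" "Suc i"] lr[of "Suc q"] that ord by (simp add: t_def)
    qed
    have xq: "t \<le> q \<Longrightarrow> q < s' \<Longrightarrow> X q c = X t c \<and> stuck q c" for q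
    proof (induction q)
      case 0
      then show ?case using ord by simp
    next
      case (Suc p)
      have x: "X (Suc p) c = X t c"
      proof (cases "Suc p = t")
        case False
        then have "X p c = X t c" "stuck p c" using Suc by auto
        moreover have "live (Suc p)" using lr Suc.prems ord by simp
        ultimately show ?thesis using X_Suc c by simp
      qed simp
      have "miss (Suc p) = Some e" using mi[of "Suc p"] Suc.prems ord by (simp add: t_def j t2_def)
      then show ?case using Dq[OF Suc.prems] x et by (simp add: stuck_def)
    qed
    have sr: "\<forall>q. t \<le> q \<and> q < r \<longrightarrow> stuck q c" using xq r by auto
    have lrr: "live r" using lr r ord by simp
    have tr: "t \<le> r" using r by simp
    have xr: "X r c = X s c" using X_stuck[OF lrr c tr sr] xt by simp
    have lt: "live (Suc t)" using lr ord by simp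
    have f1: "firm (Suc t) c"
    proof (cases "firm s c")
      case True
      then have "firm t c" using we1(3)[OF c] by blast
      then show ?thesis using firm_Suc[OF lt c] xq[of t] ord r by auto
    next
      case False
      then have "hooked (ob t c) (V t c)" using f by simp
      moreover have "t mod W = 0" unfolding t_def by (rule win_mod)
      ultimately have "att (ob (Suc t) c)" using att_Suc(2)[OF lt c] xq[of t] ord r by auto
      then show ?thesis by (simp add: firm_def)
    qed
    have "firm r c" by (rule firm_stays[OF lrr c r(1) f1]) (use sr in auto)
    then show ?thesis using xr Dt by simp
  qed
  text \<open>The others turn and find \<open>g\<close> on the other side of the missing edge.\<close>
  have settled: "firm s' c \<or> hooked (ob t2 c) (V t2 c)" if c: "c \<in> H" for c
  proof (rule ccontr)
    assume n: "\<not> ?thesis"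
    have n1: "\<not> (firm s c \<or> hooked (ob t c) (V t c))"
    proof
      assume "firm s c \<or> hooked (ob t c) (V t c)"
      then show False using keep[OF c, of s'] n W12 by (simp add: s'_def t_def)
    qed
    define u where "u = X s c"
    define h where "h = D (i * W) c"
    have Dt: "D t c = opposite h" using we1(4)[OF c] n1 by (simp add: h_def)
    have q: "prb (ob t c)" "okp (ob t c)" "Q t c = InBuf (opposite (hdg c (cur (ob t c))))"
      using we1(4,5)[OF c] n1 by auto
    have nf: "X s b \<noteq> u" if b: "b \<in> H" "firm s b" for b
    proof
      assume x: "X s b = u"
      have "D (i * W) b = h" using same[OF b(1) c] x by (simp add: u_def h_def)
      then have "Q t b = OutBuf (hdg c (cur (ob t c)))" "X t b = X t c"
        using we1(2,3)[OF b(1)] b we1(2,5)[OF c] x by (auto simp: u_def h_def)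
      then show False using hookedI[OF c q b(1)] n1 by simp
    qed
    have ug: "X s g \<noteq> u" using nf[OF g] gfirm ord by auto
    have "D (i * W) g \<noteq> h" using same[OF g c] ug by (simp add: u_def h_def)
    then have hg: "D (i * W) g = opposite h" using heading_neq[of h] by auto
    have xg: "X s g = neighbour n u h"
      unfolding u_def
      by (rule X_facing[OF g c]) (use we1(1)[OF g] we1(1)[OF c] hg in \<open>simp add: h_def\<close>)
    have "edge_towards n (X s' c) (opposite h) = e" using we2(1)[OF c] Dt by simp
    then have xc: "X s' c = neighbour n u h"
      unfolding u_def
      using X_facing[OF c c, of s' h s] we1(1)[OF c] by (simp add: h_def)
    have q': "prb (ob t2 c)" "okp (ob t2 c)" "Q t2 c = InBuf (opposite (hdg c (cur (ob t2 c))))"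
      "hdg c (cur (ob t2 c)) = opposite h"
      using we2(4,5)[OF c] n Dt by auto
    have xg': "X s' g = X s g" using gx[of s'] gx[of s] ord by auto
    have Dg: "D t g = opposite h" using gD[of t] gD[of "i * W"] hg ord by simp
    have fg: "firm s' g" using gfirm[of s'] ord by simp
    have "Q t2 g = OutBuf (opposite h)" using we2(3)[OF g fg] Dg by simp
    moreover have "X t2 g = X t2 c" using we2(2)[OF g] we2(2)[OF c] xg' xg xc by simp
    ultimately show False using hookedI[OF c q'(1,2,3) g] q'(4) n by simp
  qed
  have lt1: "live (Suc t2)" using lv ord by simp
  have m0: "t2 mod W = 0" "t1 mod W = 1" unfolding t2_def t1_def using win_mod(1)[of 1 j] W12 by auto
  have "edge_towards n (X t1 c) (D t1 c) = e \<and> Q t1 c = OutBuf (D t1 c) \<and> firm t1 c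
    \<and> D t1 c = hdg c (cur (ob t1 c)) \<and> \<not> prb (ob t1 c) \<and> (mv (ob t1 c) < n \<longrightarrow> W + 1 \<le> blk (ob t1 c))"
    if c: "c \<in> H" for c
  proof -
    have D2: "D t2 c = D t c" using we2(3,4)[OF c] settled[OF c] by metis
    have e2: "edge_towards n (X t2 c) (D t2 c) = e" using we2(1,2)[OF c] D2 by simp
    have s2: "stuck t2 c" using e2 mi[of t2] by (simp add: stuck_def t2_def j)
    have x1: "X t1 c = X t2 c" using X_Suc[OF lt1 c] s2 ord by simp
    have q1: "Q t1 c = OutBuf (D t2 c)" using Q_Suc[OF lt1 c] s2 ord by simp
    have c1: "hdg c (cur (ob t1 c)) = D t2 c" using cur_Suc(2)[OF lt1 c] m0 ord by simp
    have D1: "D t1 c = D t2 c" using D_cases(1)[OF lv c] m0 W12 c1 by simp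
    have p1: "\<not> prb (ob t1 c)" using prb_Suc(2)[OF lt1 c] m0 ord by simp
    have f1: "firm t1 c"
    proof (cases "firm s' c")
      case True
      then have f2: "firm t2 c" using we2(3)[OF c] by blast
      show ?thesis using firm_Suc[OF lt1 c f2 s2] ord by simp
    next
      case False
      then have "att (ob t1 c)" using settled[OF c] att_Suc(2)[OF lt1 c] s2 m0 ord by simp
      then show ?thesis by (simp add: firm_def)
    qed
    \<comment> \<open>An unexplored agent never turns, so it has been at the missing edge at least
      since the end of the first window. This bound makes its own alarm due one window after that of
      \<open>g\<close>.\<close>
    have "W + 1 \<le> blk (ob t1 c)" if m: "mv (ob t1 c) < n"
    proof -
      have ms: "mv (ob r c) < n" if "r \<le> t1" for r using mv_mono[OF lv c that] m by simp
      have fs: "firm s c" using ms ord by (simp add: firm_def)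
      have "stuck q c" if q: "t \<le> q" "q < t1" for q
      proof -
        have D_left: "D r c = hdg c Left" if "r \<le> t1" for r
          using unexplored(4)[OF lr[OF that] c ms[OF that]] .
        have et: "edge_towards n (X t c) (hdg c Left) = e"
          using we1(1,2)[OF c] D_left[of "i * W"] ord by simp
        have x: "t \<le> r \<Longrightarrow> r \<le> t2 \<Longrightarrow> X r c = X t c" for r
        proof (induction r)
          case (Suc p)
          show ?case
          proof (cases "Suc p = t")
            case False
            then have p: "t \<le> p" "p < t2" and xp: "X p c = X t c" using Suc by auto
            have "miss p = Some e" using mi[of p] p ord by (simp add: t2_def t_def)
            then have "stuck p c" using xp D_left[of p] p ord et by (simp add: stuck_def)
            moreover have "live (Suc p)" using lr p ord by simp
            ultimately show ?thesis using X_Suc c xp by simp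
          qed simp
        qed (use ord in simp)
        have "miss q = Some e" using mi[of q] q ord by (simp add: t2_def t_def)
        then show ?thesis using x[of q] D_left[of q] q ord et by (simp add: stuck_def)
      qed
      then have "t1 - t \<le> blk (ob t1 c)" by (intro stuck_blk[OF lv c]) (use ord in auto)
      then show ?thesis by (simp add: t1_def t_def j)
    qed
    then show ?thesis using e2 x1 D1 q1 f1 c1 p1 by simp
  qed
  then show ?thesis unfolding t1_def by blast
qed

end

section \<open>Spreading of the alarm\<close>

context big
begin

text \<open>Version of \<open>live\<close> for a single agent, needed once some agent has
  terminated.\<close>

definition alive :: "nat \<Rightarrow> nat \<Rightarrow> bool" where
  "alive t a \<longleftrightarrow> st t a = Active (Ex (em t a)) \<and> tm (em t a) = t"

lemma live_alive: "live t \<Longrightarrow> a \<in> H \<Longrightarrow> alive t a"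
  by (simp add: alive_def st_em tm_em)

lemma alive_ring:
  assumes "alive t a" "t < tex n" "a \<in> H" "ring t a"
  shows "st (Suc t) a = Term Gathering_Achieved" "X (Suc t) a = X t a" "Q (Suc t) a = AtNode"
  using go_Suc[OF assms(3), of "prot n" t] assms
  by (auto simp: alive_def sta_Suc act_Ex ob_def ring_def go_def)

lemma alive_quiet:
  assumes "alive t a" "t < tex n" "a \<in> H" "\<not> ring t a"
  shows "alive (Suc t) a" "em (Suc t) a = fst (dec1 n (ob t a) (V t a))"
    "X (Suc t) a = (if stuck t a then X t a else neighbour n (X t a) (D t a))"
    "Q (Suc t) a = (if stuck t a then OutBuf (D t a) else InBuf (opposite (D t a)))"
proof -
  have s: "st (Suc t) a = Active (Ex (fst (dec1 n (ob t a) (V t a))))"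
    using assms by (simp add: alive_def sta_Suc act_Ex ob_def ring_def)
  show e: "em (Suc t) a = fst (dec1 n (ob t a) (V t a))" using s by (simp add: em_def[of "Suc t"])
  show "alive (Suc t) a" using s e assms by (simp add: alive_def ob_def)
  show "X (Suc t) a = (if stuck t a then X t a else neighbour n (X t a) (D t a))"
    "Q (Suc t) a = (if stuck t a then OutBuf (D t a) else InBuf (opposite (D t a)))"
    using go_Suc[OF assms(3), of "prot n" t] assms
    by (auto simp: alive_def act_Ex ob_def ring_def go_def stuck_def D_def)
qed

lemma ring_AtNode:
  "a \<in> H \<Longrightarrow> b \<in> H \<Longrightarrow> b \<noteq> a \<Longrightarrow> X t b = X t a \<Longrightarrow> Q t b = AtNode \<Longrightarrow> ring t a"
  using others_pos[of a "prot n" t AtNode] by (auto simp: ring_def alarm_def)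

lemma firm_dec:
  assumes "firm t a" "\<not> prb (ob t a)"
  shows "D t a = hdg a (cur (ob t a))" "cur (fst (dec1 n (ob t a) (V t a))) = cur (ob t a)"
    "att (fst (dec1 n (ob t a) (V t a))) = att (ob t a)" "\<not> prb (fst (dec1 n (ob t a) (V t a)))"
  using assms by (auto simp: D_def firm_def dec1_def Let_def hooked_def)

end

text \<open>The agent \<open>g\<close> is one that gives the first alarm. The assumption
  \<open>time\<close> ensures that no agent changes to the second half of the protocol before all
  have stopped.\<close>

locale ringing = big +
  fixes j g :: nat
  assumes live1: "live (Suc (j * W))" and g: "g \<in> H" and ring1: "ring (Suc (j * W)) g"
    and time: "Suc j * W + 5 \<le> tex n"
begin

definition t1 :: nat where "t1 = Suc (j * W)"
definition u :: nat where "u = X t1 g"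
definition h :: heading where "h = D t1 g"
definition u' :: nat where "u' = neighbour n u h"
definition e :: nat where "e = edge_towards n u h"

lemma t1_mod: "t1 mod W = 1" "Suc t1 mod W = 2"
  using win_mod(1)[of 1 j] win_mod(1)[of 2 j] W12 by (auto simp: t1_def)

lemma u_neq: "u' \<noteq> u" "u < n" "u' < n"
  using neighbour_neq[of u n h] n3 neighbour_less[of n u h] X_less[OF g] by (auto simp: u'_def u_def)

lemma e_u': "edge_towards n u' (opposite h) = e"
  using edge_towards_opposite[of u n h] u_neq by (simp add: u'_def e_def)

lemma u_bounce: "neighbour n u' (opposite h) = u"
  using neighbour_opposite[of u n h] u_neq by (simp add: u'_def)

lemma at_t1:
  assumes "c \<in> H"
  shows "edge_towards n (X t1 c) (D t1 c) = e" "Q t1 c = OutBuf (D t1 c)" "firm t1 c"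
    "D t1 c = hdg c (cur (ob t1 c))" "\<not> prb (ob t1 c)"
    "mv (ob t1 c) < n \<Longrightarrow> W + 1 \<le> blk (ob t1 c)" "alive t1 c"
    "X t1 c = u \<and> D t1 c = h \<or> X t1 c = u' \<and> D t1 c = opposite h"
proof -
  obtain e' where e': "\<And>c. c \<in> H \<Longrightarrow> edge_towards n (X t1 c) (D t1 c) = e'
    \<and> Q t1 c = OutBuf (D t1 c) \<and> firm t1 c \<and> D t1 c = hdg c (cur (ob t1 c)) \<and> \<not> prb (ob t1 c)
    \<and> (mv (ob t1 c) < n \<longrightarrow> W + 1 \<le> blk (ob t1 c))"
    using poised[OF live1 g ring1] unfolding t1_def by blast
  have ee: "e' = e" using e'[OF g, THEN conjunct1] by (simp add: e_def u_def h_def)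
  show "edge_towards n (X t1 c) (D t1 c) = e" "Q t1 c = OutBuf (D t1 c)" "firm t1 c"
    "D t1 c = hdg c (cur (ob t1 c))" "\<not> prb (ob t1 c)"
    "mv (ob t1 c) < n \<Longrightarrow> W + 1 \<le> blk (ob t1 c)"
    using e'[OF assms] ee by auto
  show "alive t1 c" using live_alive live1 assms by (simp add: t1_def)
  show "X t1 c = u \<and> D t1 c = h \<or> X t1 c = u' \<and> D t1 c = opposite h"
  proof (cases "D t1 c = h")
    case True
    then have "X t1 c = X t1 g"
      using e'[OF assms, THEN conjunct1] e'[OF g, THEN conjunct1] by (intro X_inj[OF assms g, of t1 h t1]) (simp add: h_def)
    then show ?thesis using True by (simp add: u_def)
  next
    case False
    then have o: "D t1 c = opposite h" using heading_neq by metis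
    then have "X t1 c = neighbour n (X t1 g) h"
      using e'[OF assms, THEN conjunct1] e'[OF g, THEN conjunct1] by (intro X_facing[OF assms g, of t1 h t1]) (simp add: h_def)
    then show ?thesis using o by (simp add: u_def u'_def)
  qed
qed

lemma tlt: "t \<le> Suc j * W + 4 \<Longrightarrow> t < tex n" "t1 \<le> Suc j * W + 4"
  using time by (auto simp: t1_def)

text \<open>An agent at the far end that has not noticed anything: it keeps pushing, and being firm
  it neither probes nor turns. By the last conjunct the delay of an unexplored one reaches
  \<open>2 * W + 1\<close> exactly one window after the first alarm.\<close>

definition K :: "nat \<Rightarrow> nat \<Rightarrow> bool" where
  "K t c \<longleftrightarrow> alive t c \<and> X t c = u' \<and> Q t c = OutBuf (opposite h)
     \<and> hdg c (cur (ob t c)) = opposite h \<and> firm t c \<and> \<not> prb (ob t c)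
     \<and> mv (ob t c) = mv (ob t1 c)
     \<and> (mv (ob t1 c) < n \<longrightarrow> W + 1 + (t - t1) \<le> blk (ob t c))"

lemma K_t1: "c \<in> H \<Longrightarrow> X t1 c \<noteq> u \<Longrightarrow> K t1 c"
  using at_t1[of c] by (auto simp: K_def)

lemma K_D: "K t c \<Longrightarrow> D t c = opposite h"
  using firm_dec(1) by (simp add: K_def)

lemma K_stuck: "K t c \<Longrightarrow> stuck t c \<longleftrightarrow> miss t = Some e"
  using K_D e_u' by (simp add: stuck_def K_def)

lemma K_Suc:
  assumes "K t c" "c \<in> H" "\<not> ring t c" "t \<le> Suc j * W + 4" "t1 \<le> t"
  shows "miss t = Some e \<Longrightarrow> K (Suc t) c"
    "miss t \<noteq> Some e \<Longrightarrow> alive (Suc t) c \<and> X (Suc t) c = u \<and> Q (Suc t) c = InBuf h"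
proof -
  have al: "alive t c" and f: "firm t c" "\<not> prb (ob t c)" using assms by (auto simp: K_def)
  note q = alive_quiet[OF al tlt(1)[OF assms(4)] assms(2,3)]
  note d = firm_dec[OF f]
  show "K (Suc t) c" if m: "miss t = Some e"
  proof -
    have s: "stuck t c" using K_stuck assms m by simp
    have "Q (Suc t) c = OutBuf (opposite h)" using q(4) s K_D assms by simp
    then have o: "ob (Suc t) c = obs1 n (em (Suc t) c) (V (Suc t) c)" "is_out (own_place (V (Suc t) c))"
      "\<not> is_in (own_place (V (Suc t) c))"
      using assms by (auto simp: ob_def)
    show ?thesis
      using assms q s K_D[OF assms(1)] d o f
      by (auto simp: K_def firm_def obs1_def Let_def Suc_diff_le)
  qed
  show "alive (Suc t) c \<and> X (Suc t) c = u \<and> Q (Suc t) c = InBuf h" if m: "miss t \<noteq> Some e"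
    using q K_stuck[OF assms(1)] m K_D[OF assms(1)] assms u_bounce by (auto simp: K_def)
qed

text \<open>The situation while the edge stays missing after the alarm. Agents at the end of
  \<open>g\<close> need no further invariant, since they see \<open>g\<close> at the node proper and
  stop in the next round.\<close>

definition J :: "nat \<Rightarrow> bool" where
  "J t \<longleftrightarrow> st t g = Term Gathering_Achieved \<and> Q t g = AtNode \<and> X t g = u \<and>
     (\<forall>c\<in>H. (X t1 c = u \<longrightarrow> X t c = u \<and> (st t c = Term Gathering_Achieved \<or> alive t c)) \<and>
        (X t1 c \<noteq> u \<longrightarrow> K t c))"

definition over :: "nat \<Rightarrow> bool" where
  "over T \<longleftrightarrow> (\<forall>c\<in>H. st T c = Term Gathering_Achieved)"

definition near :: "nat \<Rightarrow> bool" where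
  "near t \<longleftrightarrow> (\<forall>c\<in>H. X t c \<in> {u, u'})"

lemma Term_Suc:
  assumes "st t c = Term Gathering_Achieved" "c \<in> H"
  shows "st (Suc t) c = Term Gathering_Achieved" "X (Suc t) c = X t c" "Q (Suc t) c = AtNode"
  using assms Term_stays[of "prot n" t c _ "Suc t"] Term_pos[of c "prot n" t _ "Suc t"]
    Term_plc[of c "prot n" t _ "Suc t"] by auto

lemma all_ring:
  assumes "t \<le> Suc j * W + 4"
    "\<And>c. c \<in> H \<Longrightarrow> X t c \<in> {u, u'} \<and> (st t c = Term Gathering_Achieved \<or> alive t c \<and> ring t c)"
  shows "over (Suc t) \<and> near t \<and> near (Suc t)"
proof -
  have "st (Suc t) c = Term Gathering_Achieved \<and> X (Suc t) c = X t c" if "c \<in> H" for c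
    using assms(2)[OF that] Term_Suc[OF _ that] alive_ring[OF _ tlt(1)[OF assms(1)] that] by blast
  then show ?thesis using assms by (simp add: over_def near_def)
qed

lemma J_near: "J t \<Longrightarrow> near t"
  by (auto simp: J_def near_def K_def)

lemma J_ring_u:
  assumes "J t" "c \<in> H" "X t1 c = u" "st t c \<noteq> Term Gathering_Achieved"
  shows "alive t c" "ring t c"
  using assms ring_AtNode[of c g t] g by (auto simp: J_def)

lemma J_ring_u':
  assumes "J t" "c \<in> H" "X t1 c \<noteq> u"
  shows "ring t c \<longleftrightarrow> t mod W = 1 \<and> mv (ob t c) < n \<and> 2 * W + 1 \<le> blk (ob t c)"
proof -
  have k: "K t c" using assms by (simp add: J_def)
  have "\<not> 0 < others (V t c) AtNode"
  proof
    assume "0 < others (V t c) AtNode"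
    then obtain b where b: "b \<in> H" "X t b = u'" "Q t b = AtNode"
      using others_pos[OF assms(2), of "prot n" t AtNode] k by (auto simp: K_def)
    then have "X t1 b \<noteq> u" using assms(1) u_neq by (auto simp: J_def)
    then have "K t b" using assms(1) b by (simp add: J_def)
    then show False using b by (simp add: K_def)
  qed
  moreover have "own_place (V t c) \<noteq> InBuf s" for s using k assms(2) by (simp add: K_def)
  moreover have "tm (ob t c) = t" using k by (simp add: K_def alive_def ob_def)
  ultimately show ?thesis by (auto simp: ring_def alarm_def)
qed

text \<open>If the edge returns, the far agents arrive where \<open>g\<close> is and see it. If not,
  the unexplored agents at the far end give alarm when their own delay is up; their companions see
  them or, should the edge return in that very round, cross and see \<open>g\<close>.\<close>

lemma J_Suc:
  assumes J: "J t" and t: "t1 < t" "t \<le> Suc j * W + 1"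
  shows "(t \<noteq> Suc j * W + 1 \<and> J (Suc t)) \<or> over (Suc (Suc t)) \<and> near (Suc t) \<and> near (Suc (Suc t))"
proof -
  have tl: "t \<le> Suc j * W + 4" "Suc t \<le> Suc j * W + 4" using t by auto
  have g1: "st (Suc t) g = Term Gathering_Achieved" "X (Suc t) g = u" "Q (Suc t) g = AtNode"
    using Term_Suc[of t g] g J by (auto simp: J_def)
  have uu: "st (Suc t) c = Term Gathering_Achieved \<and> X (Suc t) c = u" if "c \<in> H" "X t1 c = u" for c
  proof (cases "st t c = Term Gathering_Achieved")
    case True
    then show ?thesis using Term_Suc[of t c] that J by (auto simp: J_def)
  next
    case False
    then show ?thesis
      using J_ring_u[OF J that False] alive_ring[OF _ tlt(1)[OF tl(1)] that(1)] that J by (auto simp: J_def)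
  qed
  have ku: "K t c" if "c \<in> H" "X t1 c \<noteq> u" for c using J that by (simp add: J_def)
  have open_edge: "alive (Suc t) c \<and> ring (Suc t) c \<and> X (Suc t) c = u"
    if "c \<in> H" "X t1 c \<noteq> u" "\<not> ring t c" "miss t \<noteq> Some e" for c
  proof -
    have "alive (Suc t) c \<and> X (Suc t) c = u \<and> Q (Suc t) c = InBuf h"
      using K_Suc(2)[OF ku[OF that(1,2)] that(1,3) tl(1) _ that(4)] t by simp
    moreover have "g \<noteq> c" using that by (auto simp: u_def)
    ultimately show ?thesis using ring_AtNode[of c g "Suc t"] that g g1 by auto
  qed
  show ?thesis
  proof (cases "t = Suc j * W + 1")
    case False
    have nm: "t mod W \<noteq> 1"
    proof
      assume "t mod W = 1"
      moreover have "t = j * W + (t - j * W)" "t - j * W \<le> W" "1 < t - j * W"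
        using t False by (auto simp: t1_def)
      ultimately show False
        using win_mod(1)[of "t - j * W" j] W12 by (cases "t - j * W = W") auto
    qed
    then have nr: "\<not> ring t c" if "c \<in> H" "X t1 c \<noteq> u" for c using J_ring_u'[OF J that] by simp
    show ?thesis
    proof (cases "miss t = Some e")
      case True
      have "K (Suc t) c" if "c \<in> H" "X t1 c \<noteq> u" for c
        using K_Suc(1)[OF ku[OF that] that(1) nr[OF that] tl(1) _ True] t by simp
      then have "J (Suc t)" using uu g1 by (simp add: J_def)
      then show ?thesis using False by simp
    next
      case o: False
      have "over (Suc (Suc t)) \<and> near (Suc t) \<and> near (Suc (Suc t))"
      proof (rule all_ring[OF tl(2)])
        fix c assume c: "c \<in> H"
        show "X (Suc t) c \<in> {u, u'} \<and> (st (Suc t) c = Term Gathering_Achieved \<or> alive (Suc t) c \<and> ring (Suc t) c)"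
          using uu[OF c] open_edge[OF c _ nr[OF c] o] by (cases "X t1 c = u") auto
      qed
      then show ?thesis ..
    qed
  next
    case tt: True
    have tm: "t mod W = 1" using win_mod(1)[of 1 "Suc j"] W12 tt by simp
    have "over (Suc (Suc t)) \<and> near (Suc t) \<and> near (Suc (Suc t))"
    proof (rule all_ring[OF tl(2)])
      fix c assume c: "c \<in> H"
      show "X (Suc t) c \<in> {u, u'} \<and> (st (Suc t) c = Term Gathering_Achieved \<or> alive (Suc t) c \<and> ring (Suc t) c)"
      proof (cases "X t1 c = u")
        case True
        then show ?thesis using uu[OF c] by simp
      next
        case False
        have kc: "K t c" using ku[OF c False] .
        \<comment> \<open>Firm means unexplored or attached, and in the second case
          \<open>mate\<close> supplies an unexplored companion.\<close>
        obtain b where b: "b \<in> H" "X t1 b = X t1 c" "mv (ob t1 b) < n"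
        proof (cases "mv (ob t1 c) < n")
          case True
          then show ?thesis using that c by blast
        next
          case nl: False
          then have "att (ob t1 c)" using at_t1(3)[OF c] by (simp add: firm_def)
          then show ?thesis using mate[of t1 c] live1 c that by (auto simp: t1_def)
        qed
        have kb: "K t b" using ku[OF b(1)] b False by simp
        have rb: "ring t b"
          using J_ring_u'[OF J b(1)] b False kb tm tt by (simp add: K_def t1_def)
        have bt: "st (Suc t) b = Term Gathering_Achieved \<and> X (Suc t) b = u' \<and> Q (Suc t) b = AtNode"
          using alive_ring[OF _ tlt(1)[OF tl(1)] b(1) rb] kb by (simp add: K_def)
        show ?thesis
        proof (cases "ring t c")
          case True
          then show ?thesis using alive_ring[OF _ tlt(1)[OF tl(1)] c True] kc by (simp add: K_def)
        next
          case nr: False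
          show ?thesis
          proof (cases "miss t = Some e")
            case True
            then have k1: "K (Suc t) c" using K_Suc(1)[OF kc c nr tl(1)] t by simp
            have "b \<noteq> c" using rb nr by auto
            then have "ring (Suc t) c" using ring_AtNode[of c b "Suc t"] c b bt k1 by (simp add: K_def)
            then show ?thesis using k1 by (simp add: K_def)
          next
            case o: False
            then show ?thesis using open_edge[OF c False nr o] by simp
          qed
        qed
      qed
    qed
    then show ?thesis ..
  qed
qed

text \<open>The delicate round is that of the alarm itself. If the edge returns in it, companions of
  \<open>g\<close> cross and lose sight of \<open>g\<close>; they notice that a companion is
  missing, which is what \<open>cmp\<close> is for. Agents crossing in the other direction see
  \<open>g\<close>.\<close>

lemma start_J: "J (Suc t1) \<or> over (Suc (Suc t1)) \<and> near (Suc t1) \<and> near (Suc (Suc t1))"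
proof -
  have tl: "t1 \<le> Suc j * W + 4" "Suc t1 \<le> Suc j * W + 4" by (auto simp: t1_def)
  have rg: "ring t1 g" using ring1 by (simp add: t1_def)
  have g1: "st (Suc t1) g = Term Gathering_Achieved" "X (Suc t1) g = u" "Q (Suc t1) g = AtNode"
    using alive_ring[OF at_t1(7)[OF g] tlt(1)[OF tl(1)] g rg] by (auto simp: u_def)
  note rung = alive_ring[OF at_t1(7) tlt(1)[OF tl(1)]]
  note quiet = alive_quiet[OF at_t1(7) tlt(1)[OF tl(1)]]
  have stuck_iff: "stuck t1 c \<longleftrightarrow> miss t1 = Some e" if "c \<in> H" for c
    using at_t1(1)[OF that] by (simp add: stuck_def)
  have at_u: "X (Suc t1) c = u \<Longrightarrow> c \<in> H \<Longrightarrow> \<not> ring t1 c \<Longrightarrow> ring (Suc t1) c" for c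
    using ring_AtNode[of c g "Suc t1"] g g1 rg by auto
  show ?thesis
  proof (cases "miss t1 = Some e \<and> (\<forall>c\<in>H. X t1 c \<noteq> u \<longrightarrow> \<not> ring t1 c)")
    case True
    have "K (Suc t1) c" if "c \<in> H" "X t1 c \<noteq> u" for c
      using K_Suc(1)[OF K_t1[OF that] that(1) _ tl(1)] True that by simp
    moreover have "X (Suc t1) c = u \<and> (st (Suc t1) c = Term Gathering_Achieved \<or> alive (Suc t1) c)"
      if "c \<in> H" "X t1 c = u" for c
      using rung[OF that(1) that(1)] quiet[OF that(1) that(1)] stuck_iff[OF that(1)] True that by auto
    ultimately have "J (Suc t1)" using g1 by (simp add: J_def)
    then show ?thesis ..
  next
    case False
    have "over (Suc (Suc t1)) \<and> near (Suc t1) \<and> near (Suc (Suc t1))"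
    proof (rule all_ring[OF tl(2)])
      fix c assume c: "c \<in> H"
      show "X (Suc t1) c \<in> {u, u'} \<and> (st (Suc t1) c = Term Gathering_Achieved \<or> alive (Suc t1) c \<and> ring (Suc t1) c)"
      proof (cases "ring t1 c")
        case True
        then show ?thesis using rung[OF c c] at_t1(8)[OF c] by auto
      next
        case nr: False
        note qc = quiet[OF c c nr]
        have "ring (Suc t1) c \<and> X (Suc t1) c \<in> {u, u'}"
        proof (cases "miss t1 = Some e")
          case m: True
          then obtain b where b: "b \<in> H" "X t1 b \<noteq> u" "ring t1 b" using False by auto
          have xc: "X (Suc t1) c = X t1 c" using qc stuck_iff[OF c] m by simp
          show ?thesis
          proof (cases "X t1 c = u")
            case True
            then show ?thesis using at_u[OF _ c nr] xc by simp
          next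
            case nu: False
            then have "X t1 b = X t1 c" using b at_t1(8)[OF c] at_t1(8)[OF b(1)] by auto
            then show ?thesis
              using ring_AtNode[of c b "Suc t1"] rung[OF b(1) b(1) b(3)] b c xc nr at_t1(8)[OF c] by auto
          qed
        next
          case m: False
          have xc: "X (Suc t1) c = neighbour n (X t1 c) (D t1 c)" using qc stuck_iff[OF c] m by simp
          show ?thesis
          proof (cases "X t1 c = u")
            case nu: False
            then have "X (Suc t1) c = u" using xc at_t1(8)[OF c] u_bounce by auto
            then show ?thesis using at_u[OF _ c nr] by simp
          next
            case True
            have Dc: "D t1 c = h" using True at_t1(8)[OF c] u_neq by auto
            have x1: "X (Suc t1) c = u'" using xc Dc True by (simp add: u'_def)
            have q1: "Q (Suc t1) c = InBuf (opposite h)" using qc stuck_iff[OF c] m Dc by simp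
            have cu: "cur (ob (Suc t1) c) = cur (ob t1 c)"
              using qc(2) firm_dec(2)[OF at_t1(3)[OF c] at_t1(5)[OF c]] by (simp add: ob_def[of "Suc t1"] obs1_def Let_def)
            have hc: "hdg c (cur (ob t1 c)) = h" using at_t1(4)[OF c] Dc by simp
            have tmc: "tm (ob t1 c) = t1" "tm (ob (Suc t1) c) = Suc t1"
              using at_t1(7)[OF c] qc(1) by (auto simp: alive_def ob_def)
            have "cmp (ob (Suc t1) c) = others (V t1 c) (OutBuf (cur (ob t1 c)))"
              using qc(2) at_t1(2)[OF c] Dc hc c tmc t1_mod
              by (simp add: ob_def[of "Suc t1"] obs1_def Let_def dec1_def)
            \<comment> \<open>\<open>g\<close> was counted before but stays behind, and nobody is
              gained: whoever arrives in this buffer came from \<open>u\<close> and was counted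
              there.\<close>
            moreover have "others (V (Suc t1) c) (InBuf (opp (cur (ob t1 c)))) < others (V t1 c) (OutBuf (cur (ob t1 c)))"
              unfolding view_others[OF c]
            proof (rule psubset_card_mono)
              let ?A = "{b \<in> H. b \<noteq> c \<and> X (Suc t1) b = X (Suc t1) c \<and> Q (Suc t1) b = map_place (hdg c) (InBuf (opp (cur (ob t1 c))))}"
              let ?B = "{b \<in> H. b \<noteq> c \<and> X t1 b = X t1 c \<and> Q t1 b = map_place (hdg c) (OutBuf (cur (ob t1 c)))}"
              have gc: "g \<noteq> c" using rg nr by auto
              have "g \<in> ?B" using g gc True at_t1(2)[OF g] hc by (simp add: u_def h_def)
              moreover have "g \<notin> ?A" using g1 c by simp
              moreover have "?A \<subseteq> ?B"
              proof safe
                fix b assume b: "b \<in> H" "X (Suc t1) b = X (Suc t1) c" "Q (Suc t1) b = map_place (hdg c) (InBuf (opp (cur (ob t1 c))))"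
                have qb: "Q (Suc t1) b = InBuf (opposite h)" using b c hc by simp
                have nb: "\<not> ring t1 b" using rung(3)[OF b(1) b(1)] qb by auto
                have "D t1 b = h" using quiet(4)[OF b(1) b(1) nb] qb by (auto split: if_splits)
                moreover have "X t1 b = u" using at_t1(8)[OF b(1)] \<open>D t1 b = h\<close> by auto
                ultimately show "X t1 b = X t1 c" "Q t1 b = map_place (hdg c) (OutBuf (cur (ob t1 c)))"
                  using True at_t1(2)[OF b(1)] hc by auto
              qed
              ultimately show "?A \<subset> ?B" by blast
            qed simp
            ultimately have "ring (Suc t1) c"
              using q1 cu hc c tmc t1_mod by (simp add: ring_def alarm_def)
            then show ?thesis using x1 by simp
          qed
        qed
        then show ?thesis using qc(1) by simp
      qed
    qed
    then show ?thesis ..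
  qed
qed

text \<open>Awareness has to be correct in all rounds from the first termination on, not only when
  everybody has stopped.\<close>

definition calm :: "nat \<Rightarrow> bool" where
  "calm t \<longleftrightarrow> (\<forall>r. t1 < r \<and> r \<le> t \<longrightarrow> near r)"

lemma calm_t1: "calm t1"
  unfolding calm_def by (meson leD)

lemma calm_Suc: "calm t \<Longrightarrow> near (Suc t) \<Longrightarrow> calm (Suc t)"
  unfolding calm_def by (metis le_Suc_eq)

lemma calm_end:
  assumes "Suc t1 \<le> t" "t \<le> Suc j * W + 1"
  shows "J t \<and> calm t \<or> (\<exists>T\<le>Suc j * W + 3. t1 < T \<and> over T \<and> calm T)"
  using assms
proof (induction t rule: dec_induct)
  case base
  show ?case
  proof (cases "J (Suc t1)")
    case True
    then show ?thesis using calm_Suc[OF calm_t1] J_near by blast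
  next
    case False
    then have "over (Suc (Suc t1))" "calm (Suc (Suc t1))"
      using start_J calm_Suc[OF calm_t1] calm_Suc[of "Suc t1"] by blast+
    moreover have "Suc (Suc t1) \<le> Suc j * W + 3" "t1 < Suc (Suc t1)" by (auto simp: t1_def)
    ultimately show ?thesis by blast
  qed
next
  case (step t)
  have tt: "t1 < t" "t \<le> Suc j * W + 1" "Suc (Suc t) \<le> Suc j * W + 3" "t1 < Suc (Suc t)"
    using step.hyps step.prems by auto
  show ?case
  proof (cases "J t \<and> calm t")
    case True
    show ?thesis
    proof (cases "J (Suc t)")
      case js: True
      then show ?thesis using calm_Suc[of t] True J_near by blast
    next
      case False
      then have "over (Suc (Suc t))" "calm (Suc (Suc t))"
        using J_Suc[OF _ tt(1,2)] calm_Suc[of t] calm_Suc[of "Suc t"] True by blast+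
      then show ?thesis using tt by blast
    qed
  next
    case False
    then show ?thesis using step.IH tt by blast
  qed
qed

lemma finish: "\<exists>T\<le>Suc j * W + 3. t1 < T \<and> over T \<and> calm T"
proof -
  define t where "t = Suc j * W + 1"
  have t: "Suc t1 \<le> t" "t1 < t" "t \<le> Suc j * W + 1" using W12 by (auto simp: t_def t1_def)
  show ?thesis
  proof (cases "J t \<and> calm t")
    case True
    then have "over (Suc (Suc t))" "calm (Suc (Suc t))"
      using J_Suc[OF _ t(2,3)] calm_Suc[of t] calm_Suc[of "Suc t"] t_def by blast+
    moreover have "Suc (Suc t) \<le> Suc j * W + 3" "t1 < Suc (Suc t)" using t by (auto simp: t_def)
    ultimately show ?thesis by blast
  next
    case False
    then show ?thesis using calm_end[OF t(1,3)] by blast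
  qed
qed

end

context scen
begin

text \<open>Terminated agents do not move, so the situation at \<open>T\<close> persists, and up to
  \<open>t\<close> nobody claims anything. Only the rounds in between have to be examined.\<close>

lemma solvesI:
  assumes "\<forall>a\<in>H. \<exists>m. sta A t a = Active m" "\<forall>a\<in>H. sta A T a = Term Gathering_Achieved"
    "\<forall>r. t < r \<and> r \<le> T \<longrightarrow> gathered S (run S A r)"
  shows "solves_in S A"
proof -
  have early: "\<not> r \<le> t" if a: "a \<in> H" "sta A r a = Term v" for r a v
  proof
    assume "r \<le> t"
    then have "sta A t a = Term v" using Term_stays[OF a(2)] by simp
    then show False using assms(1) a by auto
  qed
  have tT: "t < T"
  proof -
    obtain a where "a \<in> H" using H_ne by blast
    then show ?thesis using early[of a T] assms(2) by simp
  qed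
  have gr: "gathered S (run S A r)" if "t < r" for r
  proof (cases "r \<le> T")
    case True
    then show ?thesis using assms(3) that by blast
  next
    case False
    have "pos A r a = pos A T a" if "a \<in> H" for a
      using Term_pos[OF that, of A T Gathering_Achieved r] assms(2) False that by simp
    then have "gathered S (run S A r) = gathered S (run S A T)" by (simp add: gathered_iff)
    then show ?thesis using assms(3) tT by simp
  qed
  have "aware_correctly S A"
    unfolding aware_correctly_def
  proof (intro allI ballI impI)
    fix r a assume a: "a \<in> homebases S" "state_of (run S A r) a = Term Gathering_Achieved"
    then have "t < r" using early[of a r] by (simp add: sta_def)
    then show "gathered S (run S A r)" by (rule gr)
  qed
  moreover have "solved_at S A T" using assms(2) gr[OF tT] by (simp add: solved_at_def sta_def)
  ultimately show ?thesis by (auto simp: solves_in_def)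
qed

end

context big
begin

text \<open>If exploration is cut short, the first alarm comes from an unexplored agent, hence by
  \<open>explored\<close> within the first \<open>3 * n\<close> windows; the two spare windows of
  \<open>tex\<close> then suffice for \<open>finish\<close>.\<close>

lemma exploration:
  "live (tex n) \<and> (\<forall>a\<in>H. n \<le> mv (ob (tex n) a))
   \<or> solves_in S (prot n) \<and> (\<exists>T\<le>tex n. \<forall>a\<in>H. st T a = Term Gathering_Achieved)"
proof (cases "live (tex n)")
  case True
  have "n \<le> mv (ob (tex n) a)" if "a \<in> H" for a
  proof -
    have le: "3 * n * W \<le> tex n" by (simp add: tex_def)
    have "live (3 * n * W)" using live_mono[OF True le] .
    then have "n \<le> mv (ob (3 * n * W) a)" using explored[of n a] that by simp
    then show ?thesis using mv_mono[OF True that le] by simp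
  qed
  then show ?thesis using True by blast
next
  case False
  define t where "t = (LEAST t. \<not> live t)"
  have nt: "\<not> live t" unfolding t_def using False by (rule LeastI)
  have tle: "t \<le> tex n" unfolding t_def using False by (rule Least_le)
  then obtain s where s: "t = Suc s" using nt live_0 by (cases t) auto
  have ls: "live s" using not_less_Least[of s "\<lambda>t. \<not> live t"] s t_def by auto
  obtain g where g: "g \<in> H" "ring s g" using live_Suc[OF ls] nt s tle by auto
  note c = alarm_cause[OF ls g]
  define j where "j = s div W"
  have sj: "s = Suc (j * W)" using c(1) div_mult_mod_eq[of s W] by (simp add: j_def)
  have "s < 3 * n * W"
  proof (rule ccontr)
    assume "\<not> s < 3 * n * W"
    then have le: "3 * n * W \<le> s" by simp
    have "live (3 * n * W)" using live_mono[OF ls le] .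
    then have "n \<le> mv (ob (3 * n * W) g)" using explored[of n g] g by simp
    then show False using mv_mono[OF ls g(1) le] c by simp
  qed
  then have "j * W < 3 * n * W" using sj by linarith
  then have jn: "j < 3 * n" using mult_less_cancel2 by blast
  have "(Suc j + 1) * W \<le> (3 * n + 2) * W" using jn by (intro mult_le_mono1) simp
  moreover have "(Suc j + 1) * W = Suc j * W + W" by simp
  ultimately have time: "Suc j * W + 5 \<le> tex n" using W12 unfolding tex_def by linarith
  interpret ringing S n H j g
    by unfold_locales (use ls g sj time in auto)
  from finish obtain T
    where T: "T \<le> Suc j * W + 3" "t1 < T" "over T" "calm T"
    by (elim exE conjE)
  have "solves_in S (prot n)"
  proof (rule solvesI[of _ t1 T])
    show "\<forall>a\<in>H. \<exists>m. st t1 a = Active m" using at_t1(7) by (auto simp: alive_def)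
    show "\<forall>a\<in>H. st T a = Term Gathering_Achieved" using T by (simp add: over_def)
    show "\<forall>r. t1 < r \<and> r \<le> T \<longrightarrow> gathered S (run S (prot n) r)"
    proof (intro allI impI)
      fix r assume "t1 < r \<and> r \<le> T"
      then have "near r" using T(4) by (simp add: calm_def)
      then show "gathered S (run S (prot n) r)"
        unfolding gathered_iff by (intro disjI2 exI[of _ u] exI[of _ h]) (simp add: near_def u'_def)
    qed
  qed
  moreover have "T \<le> tex n" using T time by simp
  ultimately show ?thesis using T by (auto simp: over_def)
qed

end

section \<open>Coordinates and election\<close>

definition sg :: "heading \<Rightarrow> int" where
  "sg h = (case h of Clockwise \<Rightarrow> 1 | Counterclockwise \<Rightarrow> - 1)"

text \<open>The number of steps with heading \<open>h\<close> from \<open>z\<close> to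
  \<open>v\<close>. Working with signed residues covers both headings by one formula.\<close>

definition coord :: "nat \<Rightarrow> nat \<Rightarrow> heading \<Rightarrow> nat \<Rightarrow> nat" where
  "coord n z h v = nat ((sg h * (int v - int z)) mod int n)"

definition pt :: "nat \<Rightarrow> nat \<Rightarrow> heading \<Rightarrow> nat \<Rightarrow> nat" where
  "pt n z h i = nat ((int z + sg h * int i) mod int n)"

lemma sg_simps [simp]: "sg Clockwise = 1" "sg Counterclockwise = - 1" "sg (opposite h) = - sg h"
  "sg h * sg h = 1" "sg h * (sg h * x) = x"
  by (cases h; simp add: sg_def)+

lemma int_coord: "0 < n \<Longrightarrow> int (coord n z h v) = (sg h * (int v - int z)) mod int n"
  by (simp add: coord_def)

lemma int_pt: "0 < n \<Longrightarrow> int (pt n z h i) = (int z + sg h * int i) mod int n"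
  by (simp add: pt_def)

lemma coord_less: "0 < n \<Longrightarrow> coord n z h v < n"
  by (simp add: coord_def nat_less_iff)

lemma pt_less: "0 < n \<Longrightarrow> pt n z h i < n"
  by (simp add: pt_def nat_less_iff)

lemma int_aff: "0 < n \<Longrightarrow> i \<le> n \<Longrightarrow> int (aff n b c i) = ((if b then int i else - int i) + int c) mod int n"
proof (cases b)
  case False
  assume "0 < n" "i \<le> n"
  then have "int (aff n b c i) = (int c + int n - int i) mod int n"
    using False by (simp add: aff_def of_nat_mod of_nat_diff)
  also have "int c + int n - int i = (- int i + int c) + int n" by simp
  also have "(- int i + int c + int n) mod int n = (- int i + int c) mod int n" by (rule mod_add_self2)
  finally show ?thesis using False by simp
qed (simp add: aff_def of_nat_mod)

lemma aff_less: "0 < n \<Longrightarrow> aff n b c i < n"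
  by (simp add: aff_def)

lemma coord_pt: "i < n \<Longrightarrow> coord n z h (pt n z h i) = i"
proof -
  assume i: "i < n"
  then have n: "0 < n" by simp
  have "int (coord n z h (pt n z h i)) = (sg h * ((int z + sg h * int i) mod int n - int z)) mod int n"
    using n by (simp add: int_coord int_pt)
  also have "\<dots> = (sg h * ((int z + sg h * int i) - int z)) mod int n"
    by (metis mod_diff_left_eq mod_mult_right_eq)
  also have "\<dots> = int i mod int n" by simp
  finally show ?thesis using i by simp
qed

lemma pt_coord: "v < n \<Longrightarrow> pt n z h (coord n z h v) = v"
proof -
  assume v: "v < n"
  then have n: "0 < n" by simp
  have "int (pt n z h (coord n z h v)) = (int z + sg h * ((sg h * (int v - int z)) mod int n)) mod int n"
    using n by (simp add: int_coord int_pt)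
  also have "\<dots> = (int z + sg h * (sg h * (int v - int z))) mod int n"
    by (metis mod_add_right_eq mod_mult_right_eq)
  also have "\<dots> = int v" using v by simp
  finally show ?thesis by simp
qed

lemma coord_inj: "v < n \<Longrightarrow> w < n \<Longrightarrow> coord n z h v = coord n z h w \<Longrightarrow> v = w"
  by (metis pt_coord)

lemma coord_self [simp]: "coord n z h z = 0"
  by (simp add: coord_def)

lemma coord_0: "v < n \<Longrightarrow> z < n \<Longrightarrow> coord n z h v = 0 \<longleftrightarrow> v = z"
  by (metis coord_inj coord_self)

lemma coord_opposite: "0 < n \<Longrightarrow> coord n z (opposite h) v = (n - coord n z h v) mod n"
proof -
  assume n: "0 < n"
  have "int ((n - coord n z h v) mod n) = (int n - int (coord n z h v)) mod int n"
    using coord_less[OF n, of z h v] by (simp add: of_nat_mod of_nat_diff)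
  also have "\<dots> = (- (sg h * (int v - int z))) mod int n"
    using n by (simp add: int_coord mod_simps)
  also have "\<dots> = int (coord n z (opposite h) v)" using n by (simp add: int_coord)
  finally show ?thesis by simp
qed

lemma int_pred: "0 < n \<Longrightarrow> int ((v + n - 1) mod n) = (int v - 1) mod int n"
proof -
  assume "0 < n"
  then have "int ((v + n - 1) mod n) = ((int v - 1) + int n) mod int n"
    by (simp add: of_nat_mod of_nat_diff algebra_simps)
  then show ?thesis by (simp only: mod_add_self2)
qed

lemma int_neighbour: "0 < n \<Longrightarrow> int (neighbour n v h) = (int v + sg h) mod int n"
  using int_pred[of n v] by (cases h) (simp_all add: of_nat_mod add.commute)

lemma coord_neighbour:
  assumes "0 < n"
  shows "coord n z h (neighbour n v h) = (coord n z h v + 1) mod n"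
    "coord n z h (neighbour n v (opposite h)) = (coord n z h v + n - 1) mod n"
proof -
  have e: "int (coord n z h (neighbour n v h')) = (sg h * (int v - int z) + sg h * sg h') mod int n" for h'
  proof -
    have "int (coord n z h (neighbour n v h')) = (sg h * ((int v + sg h') mod int n - int z)) mod int n"
      using assms by (simp add: int_coord int_neighbour del: neighbour.simps)
    also have "\<dots> = (sg h * ((int v + sg h') - int z)) mod int n"
      by (metis mod_diff_left_eq mod_mult_right_eq)
    finally show ?thesis by (simp add: algebra_simps)
  qed
  have "int (coord n z h (neighbour n v h)) = int ((coord n z h v + 1) mod n)"
    using assms by (simp add: e of_nat_mod int_coord mod_simps add.commute del: neighbour.simps)
  then show "coord n z h (neighbour n v h) = (coord n z h v + 1) mod n" by linarith
  have "int ((coord n z h v + n - 1) mod n) = (int (coord n z h v) - 1) mod int n"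
    using assms by (rule int_pred)
  also have "\<dots> = (sg h * (int v - int z) - 1) mod int n"
    using assms by (simp add: int_coord mod_simps)
  also have "\<dots> = int (coord n z h (neighbour n v (opposite h)))"
    by (simp add: e)
  finally show "coord n z h (neighbour n v (opposite h)) = (coord n z h v + n - 1) mod n" by linarith
qed

text \<open>What an agent does to its private picture becomes a change of frame on the ring;
  \<open>coord_aff\<close> is the converse, any two frames being related by some
  \<open>aff\<close>.\<close>

lemma aff_coord:
  assumes "0 < n"
  shows "aff n b c (coord n a h v)
    = coord n (pt n a (if b then opposite h else h) c) (if b then h else opposite h) v"
proof -
  have "int (aff n b c (coord n a h v))
      = ((if b then 1 else - 1) * (sg h * (int v - int a)) + int c) mod int n"
    using assms coord_less[OF assms, of a h v]
    by (cases b) (simp_all add: int_aff int_coord mod_simps)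
  moreover have "int (coord n (pt n a (if b then opposite h else h) c) (if b then h else opposite h) v)
      = ((if b then 1 else - 1) * (sg h * (int v - int a)) + int c) mod int n"
  proof -
    let ?s = "(if b then 1 else - 1) * sg h"
    have "int (coord n (pt n a (if b then opposite h else h) c) (if b then h else opposite h) v)
      = (?s * (int v - (int a - ?s * int c) mod int n)) mod int n"
      using assms by (cases b) (simp_all add: int_coord int_pt)
    also have "\<dots> = (?s * (int v - (int a - ?s * int c))) mod int n"
      by (metis mod_diff_right_eq mod_mult_right_eq)
    also have "?s * (int v - (int a - ?s * int c)) = (if b then 1 else - 1) * (sg h * (int v - int a)) + int c"
      by (cases b) (simp_all add: algebra_simps)
    finally show ?thesis .
  qed
  ultimately show ?thesis by simp
qed

lemma coord_aff:
  assumes "0 < n"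
  shows "coord n z' h' v = aff n (h = h') (coord n z' h' z) (coord n z h v)"
proof -
  have "int (aff n (h = h') (coord n z' h' z) (coord n z h v))
      = ((if h = h' then 1 else - 1) * (sg h * (int v - int z)) + sg h' * (int z - int z')) mod int n"
    using assms coord_less[OF assms, of z h v]
    by (cases "h = h'") (simp_all add: int_aff int_coord mod_simps)
  also have "(if h = h' then 1 else - 1) * (sg h * (int v - int z)) + sg h' * (int z - int z')
      = sg h' * (int v - int z')"
    by (cases h; cases h') (simp_all add: algebra_simps)
  finally show ?thesis using assms by (simp add: int_coord[symmetric])
qed

text \<open>The condition for a successful election, expressed without reference to an
  agent.\<close>

definition axial_frame :: "nat \<Rightarrow> nat set \<Rightarrow> bool" where
  "axial_frame n H \<longleftrightarrow> (\<exists>z<n. \<exists>h. axial n (coord n z h ` H))"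

lemma coord_aff_image:
  assumes "0 < n"
  shows "coord n z' h' ` H = aff n (h = h') (coord n z' h' z) ` coord n z h ` H"
  unfolding image_image by (intro image_cong refl coord_aff[OF assms])

text \<open>The right-hand side does not mention the agent \<open>a\<close> or its orientation. This
  is the reason why choices made privately by \<open>SOME\<close> are common to all agents.\<close>

lemma orbit:
  assumes "0 < n" "a < n"
  shows "(\<exists>b. \<exists>c<n. R = aff n b c ` coord n a l ` H) \<longleftrightarrow> (\<exists>z<n. \<exists>h. R = coord n z h ` H)"
proof
  assume "\<exists>b. \<exists>c<n. R = aff n b c ` coord n a l ` H"
  then obtain b c where "R = aff n b c ` coord n a l ` H" by blast
  then have "R = coord n (pt n a (if b then opposite l else l) c) (if b then l else opposite l) ` H"
    using aff_coord[OF assms(1)] by (simp add: image_image)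
  then show "\<exists>z<n. \<exists>h. R = coord n z h ` H" using pt_less[OF assms(1)] by blast
next
  assume "\<exists>z<n. \<exists>h. R = coord n z h ` H"
  then obtain z h where "R = coord n z h ` H" by blast
  moreover have "coord n z h ` H = aff n (l = h) (coord n z h a) ` coord n a l ` H"
    by (rule coord_aff_image[OF assms(1)])
  ultimately have "R = aff n (l = h) (coord n z h a) ` coord n a l ` H" by simp
  then show "\<exists>b. \<exists>c<n. R = aff n b c ` coord n a l ` H" using coord_less[OF assms(1)] by blast
qed

lemma neg_image:
  assumes "0 < n"
  shows "coord n z (opposite h) ` H = aff n False 0 ` coord n z h ` H"
  using coord_aff_image[OF assms, of z "opposite h" H h z] by simp

lemma elect_None:
  assumes "0 < n" "a < n"
  shows "elect n (coord n a l ` H) = None \<longleftrightarrow> \<not> axial_frame n H"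
proof -
  have "(\<exists>b. \<exists>c<n. axial n (aff n b c ` coord n a l ` H)) \<longleftrightarrow> axial_frame n H"
  proof -
    have "(\<exists>b. \<exists>c<n. axial n (aff n b c ` coord n a l ` H))
      \<longleftrightarrow> (\<exists>R. (\<exists>b. \<exists>c<n. R = aff n b c ` coord n a l ` H) \<and> axial n R)" by blast
    also have "\<dots> \<longleftrightarrow> axial_frame n H" unfolding orbit[OF assms] axial_frame_def by blast
    finally show ?thesis .
  qed
  then show ?thesis by (simp add: elect_def)
qed

definition rep :: "nat \<Rightarrow> nat set \<Rightarrow> nat set" where
  "rep n H = (SOME R. (\<exists>z<n. \<exists>h. R = coord n z h ` H) \<and> axial n R)"

lemma rep:
  assumes "axial_frame n H"
  shows "\<exists>z<n. \<exists>h. rep n H = coord n z h ` H" "axial n (rep n H)"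
proof -
  have "\<exists>R. (\<exists>z<n. \<exists>h. R = coord n z h ` H) \<and> axial n R"
    using assms unfolding axial_frame_def by blast
  from someI_ex[OF this] have *: "(\<exists>z<n. \<exists>h. rep n H = coord n z h ` H) \<and> axial n (rep n H)"
    unfolding rep_def .
  show "\<exists>z<n. \<exists>h. rep n H = coord n z h ` H" by (rule conjunct1[OF *])
  show "axial n (rep n H)" by (rule conjunct2[OF *])
qed

lemma canon_rep:
  assumes "0 < n" "a < n"
  shows "canon n (coord n a l ` H) = rep n H"
  unfolding canon_def rep_def orbit[OF assms] ..

text \<open>Only the half-ring condition needs an argument. If the own homebase is in the wrong
  half, the mirror frame with the same origin shows the same symmetric set and puts the homebase
  into the other half.\<close>

lemma elect_Some:
  assumes "0 < n" "a < n" "axial_frame n H"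
  shows "\<exists>b c. elect n (coord n a l ` H) = Some (b, c) \<and> aff n b c ` coord n a l ` H = rep n H
    \<and> (symm n (rep n H) \<longrightarrow> 2 * aff n b c 0 \<le> n)"
proof -
  let ?K = "coord n a l ` H"
  let ?P = "\<lambda>(b, c). c < n \<and> aff n b c ` ?K = rep n H \<and> (symm n (rep n H) \<longrightarrow> 2 * aff n b c 0 \<le> n)"
  have "elect n ?K \<noteq> None" using elect_None[OF assms(1,2)] assms(3) by simp
  then have ex: "\<exists>b. \<exists>c<n. axial n (aff n b c ` ?K)" unfolding elect_def by (meson)
  have ne: "elect n ?K = Some (SOME p. ?P p)"
    unfolding elect_def canon_rep[OF assms(1,2)] using ex by (simp only: if_True simp_thms)
  have "\<exists>b. \<exists>c<n. rep n H = aff n b c ` ?K"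
    using rep(1)[OF assms(3)] unfolding orbit[OF assms(1,2)] .
  then obtain b c where bc: "c < n" "aff n b c ` ?K = rep n H" by metis
  have "\<exists>p. ?P p"
  proof (cases "symm n (rep n H) \<longrightarrow> 2 * aff n b c 0 \<le> n")
    case True
    then show ?thesis using bc by (intro exI[of _ "(b, c)"]) simp
  next
    case False
    let ?z = "pt n a (if b then opposite l else l) c" and ?h = "if b then l else opposite l"
    have e: "aff n b c (coord n a l v) = coord n ?z ?h v" for v by (rule aff_coord[OF assms(1)])
    define b' c' where "b' = (l = opposite ?h)" and "c' = coord n ?z (opposite ?h) a"
    have e': "aff n b' c' (coord n a l v) = coord n ?z (opposite ?h) v" for v
      unfolding b'_def c'_def by (rule coord_aff[OF assms(1), symmetric])
    have "aff n b' c' ` ?K = coord n ?z (opposite ?h) ` H" by (simp add: image_image e')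
    also have "\<dots> = aff n False 0 ` coord n ?z ?h ` H" by (rule neg_image[OF assms(1)])
    also have "coord n ?z ?h ` H = rep n H" using bc(2) by (simp add: image_image e)
    also have "aff n False 0 ` rep n H = rep n H" using False by (simp add: symm_def)
    finally have 1: "aff n b' c' ` ?K = rep n H" .
    have "aff n b' c' 0 = (n - aff n b c 0) mod n"
      using e[of a] e'[of a] coord_opposite[OF assms(1), of ?z ?h a] by simp
    moreover have x: "n < 2 * aff n b c 0" "aff n b c 0 < n"
      using False aff_less[OF assms(1), of b c 0] by auto
    moreover have "(n - aff n b c 0) mod n = n - aff n b c 0" using x by (intro mod_less) linarith
    ultimately have 2: "2 * aff n b' c' 0 \<le> n" by linarith
    have "c' < n" unfolding c'_def by (rule coord_less[OF assms(1)])
    then show ?thesis using 1 2 by (intro exI[of _ "(b', c')"]) simp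
  qed
  then have P: "?P (SOME p. ?P p)" by (rule someI_ex)
  obtain b c where bc: "(SOME p. ?P p) = (b, c)" by (rule prod.exhaust)
  show ?thesis
  proof (intro exI conjI)
    show "elect n ?K = Some (b, c)" unfolding ne bc ..
    show "aff n b c ` ?K = rep n H" "symm n (rep n H) \<longrightarrow> 2 * aff n b c 0 \<le> n"
      using P unfolding bc by simp_all
  qed
qed

text \<open>Two frames showing the same set differ by a symmetry of this set, and an axial set
  admits only the identity and the reflection that fixes the origin.\<close>

lemma axial_unique:
  assumes n: "3 \<le> n" and z: "z < n" "z' < n"
    and r: "coord n z h ` H = R" "coord n z' h' ` H = R" "axial n R"
  shows "z = z'" "h \<noteq> h' \<Longrightarrow> symm n R"
proof -
  have n0: "0 < n" using n by simp
  have "aff n (h = h') (coord n z' h' z) ` R = R"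
    using coord_aff_image[OF n0, of z' h' H h z] unfolding r(1,2) by (rule sym)
  then have "coord n z' h' z = 0"
    using r(3) coord_less[OF n0, of z' h' z] unfolding axial_def by blast
  then show zz: "z = z'" using coord_0[OF z] by blast
  assume "h \<noteq> h'"
  then have "h' = opposite h" using heading_neq by blast
  then have 1: "coord n z (opposite h) ` H = R" using r(2) zz by blast
  show "symm n R" using neg_image[OF n0, of z h H] unfolding r(1) 1 symm_def by (rule sym)
qed

text \<open>With a single heading all homebases would have coordinates at most \<open>n / 2\<close>,
  which by symmetry leaves only \<open>0\<close> and \<open>n / 2\<close>. Two agents occupy both,
  and then the half turn is another symmetry, which \<open>axial\<close> forbids.\<close>

lemma symm_types:
  assumes n: "3 \<le> n" and z: "z < n" and H: "H \<subseteq> {..<n}" "2 \<le> card H"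
    and r: "\<And>a. a \<in> H \<Longrightarrow> coord n z (hh a) ` H = R" "axial n R" "symm n R"
    and half: "\<And>a. a \<in> H \<Longrightarrow> 2 * coord n z (hh a) a \<le> n"
  shows "\<exists>a\<in>H. \<exists>b\<in>H. hh a \<noteq> hh b"
proof (rule ccontr)
  assume no: "\<not> ?thesis"
  have n0: "0 < n" using n by simp
  have ne: "H \<noteq> {}" using H(2) by auto
  obtain a0 where a0: "a0 \<in> H" using ne by blast
  define h where "h = hh a0"
  have hh: "hh a = h" if "a \<in> H" for a using no a0 that unfolding h_def by blast
  have R: "R = coord n z h ` H" using r(1)[OF a0] by (simp add: h_def)
  have sub: "R \<subseteq> {0, n div 2}"
  proof
    fix y assume y: "y \<in> R"
    then obtain v where v: "v \<in> H" "y = coord n z h v" using R by auto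
    have 1: "2 * y \<le> n" using half[OF v(1)] hh v by simp
    have "aff n False 0 y \<in> R" using r(3) y unfolding symm_def by blast
    then obtain w where w: "w \<in> H" "aff n False 0 y = coord n z h w" using R by auto
    have "2 * aff n False 0 y \<le> n" using half[OF w(1)] hh w by simp
    moreover have "y < n" using 1 n by simp
    ultimately show "y \<in> {0, n div 2}" using 1 by (cases "y = 0") (auto simp: aff_def)
  qed
  have "inj_on (coord n z h) H" using H(1) coord_inj by (intro inj_onI) blast
  then have c2: "2 \<le> card R" using H(2) R by (simp add: card_image)
  have "card {0, n div 2} \<le> 2" by (simp add: card_insert_if)
  then have R2: "R = {0, n div 2}" using c2 by (intro card_seteq sub) auto
  have ev: "n div 2 + n div 2 = n"
  proof -
    have "n div 2 \<in> R" using R2 by simp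
    then have "aff n False 0 (n div 2) \<in> R" using r(3) unfolding symm_def by blast
    moreover have "aff n False 0 (n div 2) = n - n div 2" using n by (simp add: aff_def)
    ultimately have "n - n div 2 = 0 \<or> n - n div 2 = n div 2" unfolding R2 by simp
    then show ?thesis using n by linarith
  qed
  have "aff n True (n div 2) ` R = R"
  proof -
    have "aff n True (n div 2) 0 = n div 2" "aff n True (n div 2) (n div 2) = 0"
      using n ev by (simp_all add: aff_def)
    then show ?thesis unfolding R2 by (simp add: insert_commute)
  qed
  moreover have "n div 2 < n" using n by simp
  ultimately have "n div 2 = 0" using r(2) unfolding axial_def by blast
  then show False using n by simp
qed

section \<open>Configurations without an axial frame\<close>

locale config =
  fixes n :: nat and H :: "nat set"
  assumes conf: "H \<in> configurations n"
begin

abbreviation k :: nat where "k \<equiv> card H"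
abbreviation hb :: "nat \<Rightarrow> nat" where "hb \<equiv> homebase H"

lemma sub: "H \<subseteq> {..<n}" and ne: "H \<noteq> {}"
  using conf by (auto simp: configurations_def)

lemma fin: "finite H"
  using sub finite_subset by blast

lemma k_pos: "0 < k"
  using fin ne by (simp add: card_gt_0_iff)

lemma hb_mem: "i < k \<Longrightarrow> hb i \<in> H"
  using fin nth_mem[of i "sorted_list_of_set H"] by (simp add: homebase_def)

lemma hb_less: "i < k \<Longrightarrow> hb i < n"
  using hb_mem sub by blast

lemma hb_ex: "v \<in> H \<Longrightarrow> \<exists>i<k. hb i = v"
  using fin in_set_conv_nth[of v "sorted_list_of_set H"] by (auto simp: homebase_def)

lemma hb_mono: "i < j \<Longrightarrow> j < k \<Longrightarrow> hb i < hb j"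
  using sorted_wrt_nth_less[OF strict_sorted_list_of_set[of H], of i j] by (simp add: homebase_def)

lemma hb_inj: "i < k \<Longrightarrow> j < k \<Longrightarrow> hb i = hb j \<Longrightarrow> i = j"
  using hb_mono by (metis less_irrefl linorder_neqE_nat)

lemma hb_mono_iff: "i < k \<Longrightarrow> j < k \<Longrightarrow> hb i < hb j \<longleftrightarrow> i < j"
  using hb_mono by (metis less_asym less_irrefl linorder_neqE_nat)

text \<open>Gaps are described by the nodes following \<open>hb i\<close> round the ring instead of
  by the sorted list, so that rotations and reflections can be applied to them; \<open>gapI\<close>
  is the converse.\<close>

lemma gap_props:
  assumes i: "i < k"
  shows "0 < gap n H i" "gap n H i \<le> n" "(hb i + gap n H i) mod n = hb (Suc i mod k)"
    "0 < d \<Longrightarrow> d < gap n H i \<Longrightarrow> (hb i + d) mod n \<notin> H"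
proof -
  have "0 < gap n H i \<and> gap n H i \<le> n \<and> (hb i + gap n H i) mod n = hb (Suc i mod k)
    \<and> (0 < d \<and> d < gap n H i \<longrightarrow> (hb i + d) mod n \<notin> H)"
  proof (cases "Suc i < k")
    case True
    have l: "hb i < hb (Suc i)" "hb (Suc i) < n" using hb_mono hb_less True by auto
    have g: "gap n H i = hb (Suc i) - hb i" using True by (simp add: gap_def)
    have "(hb i + d) mod n \<notin> H" if d: "0 < d" "d < gap n H i"
    proof
      assume m: "(hb i + d) mod n \<in> H"
      have "hb i + d < n" using d g l by simp
      then obtain j where j: "j < k" "hb j = hb i + d" using hb_ex m by fastforce
      then have "i < j" "j < Suc i"
        using hb_mono_iff[of i j] hb_mono_iff[of j "Suc i"] i True d g l by auto
      then show False by simp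
    qed
    then show ?thesis using l g True by auto
  next
    case False
    then have ki: "Suc i = k" using i by simp
    have l: "hb 0 \<le> hb i" using hb_mono[of 0 i] i by (cases "i = 0") auto
    have hi: "hb i < n" using hb_less i by blast
    have g: "gap n H i = hb 0 + n - hb i" using False by (simp add: gap_def)
    have h0: "hb 0 < n" using hb_less k_pos by blast
    have "(hb i + d) mod n \<notin> H" if d: "0 < d" "d < gap n H i"
    proof
      assume m: "(hb i + d) mod n \<in> H"
      then obtain j where j: "j < k" "hb j = (hb i + d) mod n" using hb_ex by blast
      have ji: "hb j \<le> hb i" using hb_mono[of j i] j i ki by (cases "j = i") auto
      have j0: "hb 0 \<le> hb j" using hb_mono[of 0 j] j by (cases "j = 0") auto
      show False
      proof (cases "hb i + d < n")
        case True
        then show ?thesis using j ji d by simp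
      next
        case False
        then have "(hb i + d) mod n = hb i + d - n" using d g h0 l by (simp add: mod_if)
        then show ?thesis using j j0 d g False by simp
      qed
    qed
    moreover have "(hb i + gap n H i) mod n = hb 0" using g l hi h0 by simp
    ultimately show ?thesis using g l hi ki by auto
  qed
  then show "0 < gap n H i" "gap n H i \<le> n" "(hb i + gap n H i) mod n = hb (Suc i mod k)"
    "0 < d \<Longrightarrow> d < gap n H i \<Longrightarrow> (hb i + d) mod n \<notin> H" by auto
qed

lemma gapI:
  assumes "i < k" "0 < d" "(hb i + d) mod n \<in> H" "\<And>d'. 0 < d' \<Longrightarrow> d' < d \<Longrightarrow> (hb i + d') mod n \<notin> H"
  shows "gap n H i = d" "hb (Suc i mod k) = (hb i + d) mod n"
proof -
  have m: "(hb i + gap n H i) mod n \<in> H"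
    using gap_props(3)[OF assms(1)] hb_mem[of "Suc i mod k"] k_pos by simp
  show "gap n H i = d"
    using gap_props(1,4)[OF assms(1)] assms(2-4) m by (metis linorder_neqE_nat)
  then show "hb (Suc i mod k) = (hb i + d) mod n" using gap_props(3)[OF assms(1)] by simp
qed

text \<open>A rotation preserves the cyclic order, so it shifts the indices of homebases by a fixed
  \<open>p\<close> and preserves gaps. Periodicity asks for a divisor of \<open>k\<close>; by Bezout
  some multiple of \<open>p\<close> is congruent to \<open>gcd p k\<close> modulo
  \<open>k\<close>.\<close>

lemma translation_periodic:
  assumes c: "0 < c" "c < n" and inv: "\<And>v. v < n \<Longrightarrow> (v + c) mod n \<in> H \<longleftrightarrow> v \<in> H"
  shows "periodic n H"
proof -
  have n: "0 < n" using c by simp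
  have H0: "(hb 0 + c) mod n \<in> H" using inv hb_mem hb_less k_pos by blast
  then obtain p where p: "p < k" "hb p = (hb 0 + c) mod n" using hb_ex by metis
  have p0: "0 < p"
  proof (rule ccontr)
    assume "\<not> 0 < p"
    then have e: "hb 0 = (hb 0 + c) mod n" using p by simp
    have "hb 0 < n" using hb_less k_pos by blast
    moreover have "(hb 0 + c) mod n = hb 0 + c - n" if "n \<le> hb 0 + c"
      using that c \<open>hb 0 < n\<close> by (subst le_mod_geq) auto
    ultimately show False using e c by (cases "hb 0 + c < n") auto
  qed
  have step: "gap n H ((i + p) mod k) = gap n H i \<and> hb (Suc ((i + p) mod k) mod k) = (hb (Suc i mod k) + c) mod n"
    if i: "i < k" and h: "hb ((i + p) mod k) = (hb i + c) mod n" for i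
  proof -
    have ip: "(i + p) mod k < k" using k_pos by simp
    have sh: "(hb ((i + p) mod k) + d) mod n = ((hb i + d) mod n + c) mod n" for d
      using h by (simp add: mod_simps algebra_simps)
    have eq: "(hb ((i + p) mod k) + d) mod n \<in> H \<longleftrightarrow> (hb i + d) mod n \<in> H" for d
      unfolding sh using inv n by simp
    have m: "(hb i + gap n H i) mod n \<in> H"
      using gap_props(3)[OF i] hb_mem[of "Suc i mod k"] k_pos by simp
    note g = gapI[OF ip gap_props(1)[OF i]]
    have "gap n H ((i + p) mod k) = gap n H i"
      by (rule g(1)) (use eq m gap_props(4)[OF i] in auto)
    moreover have "hb (Suc ((i + p) mod k) mod k) = (hb ((i + p) mod k) + gap n H i) mod n"
      by (rule g(2)) (use eq m gap_props(4)[OF i] in auto)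
    ultimately show ?thesis using sh gap_props(3)[OF i] by simp
  qed
  have hbp: "i < k \<Longrightarrow> hb ((i + p) mod k) = (hb i + c) mod n" for i
  proof (induction i)
    case 0
    then show ?case using p by simp
  next
    case (Suc i)
    then have "hb (Suc ((i + p) mod k) mod k) = (hb (Suc i mod k) + c) mod n" using step[of i] by simp
    then show ?case using Suc.prems by (simp add: mod_Suc_eq)
  qed
  have gp: "gap n H ((i + q * p) mod k) = gap n H (i mod k)" for i q
  proof (induction q)
    case (Suc q)
    have l: "(i + q * p) mod k < k" using k_pos by simp
    have "(i + Suc q * p) mod k = ((i + q * p) mod k + p) mod k" by (simp add: mod_simps algebra_simps)
    then show ?case using step[OF l hbp[OF l]] Suc.IH by simp
  qed simp
  obtain x y where xy: "p * x = k * y + gcd p k" using bezout_nat[of p k] p0 by auto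
  have "gap n H i = gap n H ((i + gcd p k) mod k)" if "i < k" for i
  proof -
    have "i + x * p = (i + gcd p k) + k * y" using xy by (simp add: mult.commute)
    then have "(i + x * p) mod k = (i + gcd p k) mod k" by (simp only: mod_mult_self2)
    then show ?thesis using gp[of i x] that by simp
  qed
  moreover have "gcd p k \<le> p" using p0 by (intro gcd_le1_nat) simp
  then have "gcd p k dvd k" "gcd p k < k" using p by auto
  ultimately show ?thesis unfolding periodic_def by blast
qed

text \<open>The reflection reverses the cyclic order, taking index \<open>i\<close> to
  \<open>s - i\<close> modulo \<open>k\<close>. Hence the gaps read forwards from a homebase are the
  gaps read backwards from its mirror image, in particular for the minimal sequence. As
  \<open>c\<close> is odd and \<open>n\<close> even, mirror images have different parity, which
  gives odd distances.\<close>

lemma reflection_edge_edge: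
  assumes c: "c < n" "odd c" "even n" and np: "\<not> periodic n H"
    and inv: "\<And>v. v < n \<Longrightarrow> (c + n - v) mod n \<in> H \<longleftrightarrow> v \<in> H"
  shows "edge_edge n H"
proof -
  have n: "0 < n" using c by simp
  obtain s where s: "s < k" "hb s = (c + n - hb 0) mod n"
    using inv hb_mem hb_less hb_ex k_pos by metis
  have rr: "(c + n - (c + n - v) mod n) mod n = v" if "v < n" for v
  proof -
    have "int ((c + n - (c + n - v) mod n) mod n) = (int c + int n - (int c + int n - int v) mod int n) mod int n"
      using n that by (simp add: of_nat_mod of_nat_diff less_imp_le trans_le_add2)
    also have "\<dots> = int v mod int n" by (simp add: mod_simps)
    finally show ?thesis using that by simp
  qed
  have step: "gap n H j = gap n H i \<and> hb (Suc j mod k) = (c + n - hb i) mod n"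
    if i: "i < k" and j: "j < k" "hb j = (c + n - hb (Suc i mod k)) mod n" for i j
  proof -
    let ?g = "gap n H i"
    have hi: "hb i < n" using hb_less i by blast
    have w: "hb (Suc i mod k) = (hb i + ?g) mod n" using gap_props(3)[OF i] by simp
    have eq: "(hb j + d) mod n = (c + n - (hb i + (?g - d)) mod n) mod n" if "d \<le> ?g" for d
    proof -
      define x where "x = (hb i + ?g) mod n"
      have "(hb j + d) mod n = ((c + n - x) + d) mod n" using j(2) w by (simp only: x_def mod_add_left_eq)
      moreover have "int (c + n - x) = int c + int n - int x"
        using mod_less_divisor[OF n, of "hb i + ?g"] unfolding x_def by (subst of_nat_diff) linarith+
      ultimately have "int ((hb j + d) mod n) = (int c + int n - int ((hb i + ?g) mod n) + int d) mod int n"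
        by (simp only: of_nat_mod of_nat_add x_def)
      also have "\<dots> = (int c + int n - (int (hb i) + int ?g) + int d) mod int n"
        unfolding of_nat_mod of_nat_add by (metis mod_add_left_eq mod_diff_right_eq)
      also have "\<dots> = (int c + int n - (int (hb i) + (int ?g - int d))) mod int n"
        by (simp add: algebra_simps)
      also have "\<dots> = (int c + int n - int ((hb i + (?g - d)) mod n)) mod int n"
        using that by (simp add: of_nat_mod of_nat_diff mod_simps add_diff_eq)
      also have "\<dots> = int ((c + n - (hb i + (?g - d)) mod n) mod n)"
        using n by (simp add: of_nat_mod of_nat_diff less_imp_le trans_le_add2)
      finally show ?thesis by linarith
    qed
    have mem: "(hb j + d) mod n \<in> H \<longleftrightarrow> (hb i + (?g - d)) mod n \<in> H" if "d \<le> ?g" for d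
      unfolding eq[OF that] using inv n by simp
    have e: "(hb j + ?g) mod n = (c + n - hb i) mod n" using eq[of ?g] hi by simp
    note g = gapI[OF j(1) gap_props(1)[OF i]]
    have m: "(hb j + ?g) mod n \<in> H" using mem[of ?g] hb_mem[OF i] hi by simp
    have nm: "(hb j + d) mod n \<notin> H" if "0 < d" "d < ?g" for d
      using mem[of d] gap_props(4)[OF i, of "?g - d"] that by simp
    show ?thesis using g(1)[OF m nm] g(2)[OF m nm] e by simp
  qed
  have back_idx: "i < k \<Longrightarrow> hb ((s + k - i) mod k) = (c + n - hb i) mod n" for i
  proof (induction i)
    case 0
    then show ?case using s by simp
  next
    case (Suc i)
    have i: "i < k" using Suc.prems by simp
    have IH: "hb ((s + k - i) mod k) = (c + n - hb i) mod n" using Suc i by simp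
    obtain j where j: "j < k" "hb j = (c + n - hb (Suc i mod k)) mod n"
      using inv hb_mem hb_less hb_ex k_pos mod_less_divisor by metis
    have "hb (Suc j mod k) = hb ((s + k - i) mod k)" using step[OF i j] IH by simp
    then have "Suc j mod k = (s + k - i) mod k" using hb_inj k_pos by simp
    also have "s + k - i = Suc (s + k - Suc i)" using i s by simp
    finally have "Suc j mod k = Suc ((s + k - Suc i) mod k) mod k" by (simp add: mod_Suc_eq)
    then have "j = (s + k - Suc i) mod k"
      using j(1) k_pos by (auto simp: mod_Suc split: if_splits)
    then show ?case using j Suc.prems by simp
  qed
  have gap_back: "gap n H ((s + k - Suc i) mod k) = gap n H i" if i: "i < k" for i
  proof -
    have "hb ((s + k - Suc i) mod k) = (c + n - hb (Suc i mod k)) mod n"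
    proof (cases "Suc i < k")
      case True
      then show ?thesis using back_idx[of "Suc i"] by simp
    next
      case False
      then have "Suc i = k" using i by simp
      then show ?thesis using s by simp
    qed
    then show ?thesis using step[OF i, of "(s + k - Suc i) mod k"] k_pos by simp
  qed
  have seqs: "seq_minus n H ((s + k - i) mod k) = seq_plus n H i" if i: "i < k" for i
  proof -
    have "gap n H (((s + k - i) mod k + k - Suc m) mod k) = gap n H ((i + m) mod k)" if m: "m < k" for m
    proof -
      let ?x = "(i + m) mod k"
      have x: "?x < k" using k_pos by simp
      have "int (((s + k - i) mod k + k - Suc m) mod k) = ((int s + int k - int i) mod int k + int k - int (Suc m)) mod int k"
        using i m by (simp add: of_nat_mod of_nat_diff trans_le_add2 Suc_leI)
      also have "(int s + int k - int i) mod int k + int k - int (Suc m)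
        = (int s + int k - int i) mod int k - int (Suc m) + int k" by simp
      also have "\<dots> mod int k = ((int s + int k - int i) mod int k - int (Suc m)) mod int k"
        by (rule mod_add_self2)
      also have "\<dots> = (int s + int k - int i - int (Suc m)) mod int k" by (rule mod_diff_left_eq)
      also have "int s + int k - int i - int (Suc m) = int s + int k - 1 - (int i + int m)" by simp
      also have "\<dots> mod int k = (int s + int k - 1 - (int i + int m) mod int k) mod int k"
        by (rule mod_diff_right_eq[symmetric])
      also have "\<dots> = (int s + int k - int ?x - 1) mod int k"
        by (rule arg_cong[of _ _ "\<lambda>y. y mod int k"]) (simp add: of_nat_mod)
      also have "\<dots> = int ((s + k - Suc ?x) mod k)"
        using x by (simp add: of_nat_mod of_nat_diff Suc_leI trans_le_add2 diff_diff_eq add.commute)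
      finally have "((s + k - i) mod k + k - Suc m) mod k = (s + k - Suc ?x) mod k" by linarith
      then show ?thesis using gap_back[OF x] by simp
    qed
    then show ?thesis by (auto simp: seq_minus_def seq_plus_def)
  qed
  have inv_idx: "(s + k - (s + k - j) mod k) mod k = j" if "j < k" for j
  proof -
    have "int ((s + k - (s + k - j) mod k) mod k) = (int s + int k - (int s + int k - int j) mod int k) mod int k"
      using k_pos that by (simp add: of_nat_mod of_nat_diff less_imp_le trans_le_add2)
    also have "\<dots> = int j mod int k" by (simp add: mod_simps)
    finally show ?thesis using that by simp
  qed
  have "seq_min n H \<in> seq_plus n H ` {..<k} \<union> seq_minus n H ` {..<k}"
    unfolding seq_min_def using k_pos by (intro Min_in) auto
  then obtain i where i: "i < k" "seq_min n H = seq_plus n H i"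
  proof
    assume "seq_min n H \<in> seq_minus n H ` {..<k}"
    then obtain j where j: "j < k" "seq_min n H = seq_minus n H j" by auto
    \<comment> \<open>Here the minimum is a backward sequence; the mirror index carries the same
      sequence forwards.\<close>
    have "(s + k - j) mod k < k" using k_pos by simp
    then show thesis using that[of "(s + k - j) mod k"] seqs[of "(s + k - j) mod k"] inv_idx[OF j(1)] j by simp
  qed (use that in auto)
  define j where "j = (s + k - i) mod k"
  have jk: "j < k" using k_pos by (simp add: j_def)
  have hj: "hb j = (c + n - hb i) mod n" using back_idx[OF i(1)] by (simp add: j_def)
  have hin: "hb i < n" "hb j < n" using hb_less i jk by auto
  have par: "even (hb j) \<longleftrightarrow> even (c + n - hb i)" using hj c(3) by (simp add: dvd_mod_iff)
  have odd_ij: "even (hb j) \<longleftrightarrow> odd (hb i)" using par hin c by (simp add: even_diff_nat)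
  have "i \<noteq> j" using odd_ij by auto
  then have pp: "palindrome_pair n H i j"
    using i jk seqs[OF i(1)] by (simp add: palindrome_pair_def j_def)
  moreover have "odd (cw_distance n (hb i) (hb j))" "odd (cw_distance n (hb j) (hb i))"
    using odd_ij c(3) hin by (simp_all add: cw_distance_def dvd_mod_iff even_diff_nat)
  ultimately show ?thesis using np unfolding edge_edge_def double_palindrome_def by blast
qed

text \<open>Turns an invariance of the coordinate set into one of \<open>H\<close>, node by node.
  The equivalence needs that the map induced on nodes is injective.\<close>

lemma image_iff_mod:
  assumes n: "0 < n" and z: "z < n" and e: "aff n b c ` coord n z Clockwise ` H = coord n z Clockwise ` H"
    and c: "c < n" and v: "v < n"
  shows "pt n z Clockwise (aff n b c (coord n z Clockwise v)) \<in> H \<longleftrightarrow> v \<in> H"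
proof -
  let ?f = "\<lambda>v. pt n z Clockwise (aff n b c (coord n z Clockwise v))"
  have cH: "coord n z Clockwise (pt n z Clockwise i) = i" if "i < n" for i using coord_pt that by blast
  have im: "?f ` H = H"
  proof -
    have "?f ` H = pt n z Clockwise ` (aff n b c ` coord n z Clockwise ` H)" by (simp only: image_image)
    also have "aff n b c ` coord n z Clockwise ` H = coord n z Clockwise ` H" by (rule e)
    also have "pt n z Clockwise ` coord n z Clockwise ` H = (\<lambda>v. pt n z Clockwise (coord n z Clockwise v)) ` H"
      by (simp only: image_image)
    also have "\<dots> = (\<lambda>v. v) ` H" by (rule image_cong) (use sub pt_coord in auto)
    also have "\<dots> = H" by simp
    finally show ?thesis .
  qed
  have inj: "x = y" if "x < n" "y < n" "?f x = ?f y" for x y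
  proof -
    have "aff n b c (coord n z Clockwise x) = aff n b c (coord n z Clockwise y)"
      using arg_cong[OF that(3), of "coord n z Clockwise"] unfolding cH[OF aff_less[OF n]] .
    then have "coord n (pt n z (if b then opposite Clockwise else Clockwise) c) (if b then Clockwise else opposite Clockwise) x
      = coord n (pt n z (if b then opposite Clockwise else Clockwise) c) (if b then Clockwise else opposite Clockwise) y"
      unfolding aff_coord[OF n] .
    then show ?thesis using coord_inj that by blast
  qed
  show ?thesis
  proof
    assume "?f v \<in> H"
    then have "?f v \<in> ?f ` H" unfolding im .
    then obtain w where w: "?f v = ?f w" "w \<in> H" by (rule imageE)
    have "v = w" by (rule inj[OF v _ w(1)]) (use w(2) sub in auto)
    then show "v \<in> H" using w(2) by simp
  next
    assume "v \<in> H"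
    then have "?f v \<in> ?f ` H" by (rule imageI)
    then show "?f v \<in> H" unfolding im .
  qed
qed

text \<open>Every node \<open>z\<close> sees a symmetry with \<open>c\<close> nonzero in its own
  frame: a rotation, which means periodicity, or a reflection moving \<open>z\<close>. Take the
  reflection from \<open>v\<close> to \<open>c - v\<close> found for node \<open>0\<close>. A node
  \<open>z\<close> with \<open>2 * z\<close> congruent to \<open>c\<close> would be fixed by it, and
  composing it with a reflection that moves \<open>z\<close> gives a rotation. So the congruence has
  no solution, which means that \<open>c\<close> is odd and \<open>n\<close> even.\<close>

lemma not_axial:
  assumes n3: "3 \<le> n" and na: "\<not> axial_frame n H"
  shows "periodic n H \<or> edge_edge n H"
proof (rule ccontr)
  assume no: "\<not> ?thesis"
  have n: "0 < n" using n3 by simp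
  have sy: "\<exists>c. 0 < c \<and> c < n \<and> (\<forall>v<n. nat ((2 * int z + int c - int v) mod int n) \<in> H \<longleftrightarrow> v \<in> H)"
    if z: "z < n" for z
  proof -
    obtain b c where bc: "c < n" "aff n b c ` coord n z Clockwise ` H = coord n z Clockwise ` H" "c \<noteq> 0"
      using na z unfolding axial_frame_def axial_def by metis
    note m = image_iff_mod[OF n z bc(2,1)]
    have e: "pt n z Clockwise (aff n b c (coord n z Clockwise v))
        = nat ((int z + (if b then int v - int z else int z - int v) + int c) mod int n)" for v
    proof -
      have "int (pt n z Clockwise (aff n b c (coord n z Clockwise v)))
          = (int z + (if b then int v - int z else int z - int v) + int c) mod int n"
        using n coord_less[OF n, of z Clockwise v]
        by (cases b) (simp_all add: int_pt int_aff int_coord mod_simps algebra_simps)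
      then show ?thesis by linarith
    qed
    have "\<not> b"
    proof
      assume b
      then have "(v + c) mod n \<in> H \<longleftrightarrow> v \<in> H" if "v < n" for v
        using m[OF that] e[of v] by (simp add: nat_mod_as_int)
      then show False using translation_periodic[of c] bc no by simp
    qed
    then have "nat ((2 * int z + int c - int v) mod int n) \<in> H \<longleftrightarrow> v \<in> H" if "v < n" for v
      using m[OF that] e[of v] by (simp add: algebra_simps)
    then show ?thesis using bc by auto
  qed
  obtain c where c: "0 < c" "c < n" "\<And>v. v < n \<Longrightarrow> nat ((int c - int v) mod int n) \<in> H \<longleftrightarrow> v \<in> H"
    using sy[of 0] n by auto
  have nz: "(2 * int z) mod int n \<noteq> int c" if z: "z < n" for z
  proof
    assume e: "(2 * int z) mod int n = int c"
    obtain d where d: "0 < d" "d < n" "\<And>v. v < n \<Longrightarrow> nat ((2 * int z + int d - int v) mod int n) \<in> H \<longleftrightarrow> v \<in> H"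
      using sy[OF z] by auto
    have "(v + d) mod n \<in> H \<longleftrightarrow> v \<in> H" if v: "v < n" for v
    proof -
      \<comment> \<open>\<open>w\<close> is the image of \<open>v\<close> under the first
        reflection; the second one takes it to \<open>v + d\<close>.\<close>
      define w where "w = nat ((int c - int v) mod int n)"
      have w: "w < n" using n by (simp add: w_def nat_less_iff)
      have iw: "int w = (int c - int v) mod int n" using n by (simp add: w_def)
      have "(2 * int z + int d - int w) mod int n = (int c + int d - (int c - int v)) mod int n"
        unfolding iw e[symmetric] by (simp add: mod_simps)
      then have "nat ((2 * int z + int d - int w) mod int n) = (v + d) mod n"
        by (simp add: nat_mod_as_int add.commute)
      then have "(v + d) mod n \<in> H \<longleftrightarrow> w \<in> H" using d(3)[OF w] by simp
      also have "\<dots> \<longleftrightarrow> v \<in> H" using c(3)[OF v] by (simp add: w_def)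
      finally show ?thesis .
    qed
    then show False using translation_periodic[of d] d no by simp
  qed
  have oc: "odd c"
  proof
    assume "even c"
    then obtain z where "c = 2 * z" by blast
    then show False using nz[of z] c by simp
  qed
  have en: "even n"
  proof (rule ccontr)
    assume "odd n"
    then have "even (c + n)" using oc by simp
    then obtain z where z: "c + n = 2 * z" by blast
    then have "(2 * int z) mod int n = int c" using c by (metis add.commute mod_add_self1 mod_less of_nat_add of_nat_mod of_nat_mult of_nat_numeral)
    then show False using nz[of z] z c by simp
  qed
  have "(c + n - v) mod n \<in> H \<longleftrightarrow> v \<in> H" if v: "v < n" for v
  proof -
    have "int ((c + n - v) mod n) = ((int c - int v) + int n) mod int n"
      using v by (simp add: of_nat_mod of_nat_diff algebra_simps)
    then have "(c + n - v) mod n = nat ((int c - int v) mod int n)" by simp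
    then show ?thesis using c(3)[OF v] by simp
  qed
  then show False using reflection_edge_edge[of c] c oc en no by blast
qed

end

section \<open>Gathering\<close>

context big
begin

lemma n0: "0 < n"
  using n3 by simp

lemma shift_coord:
  assumes a: "a \<in> H" and z: "coord n z (hdg a s) v = x"
    and q: "v' = v \<and> (p = AtNode \<or> p = OutBuf h) \<or> v' = neighbour n v h \<and> p = InBuf (opposite h)"
  shows "shift n s (map_place (sd a) p) x = coord n z (hdg a s) v'"
proof (cases "v' = v \<and> (p = AtNode \<or> p = OutBuf h)")
  case True
  then show ?thesis using z by (auto simp: shift_def)
next
  case False
  then have v': "v' = neighbour n v h" "p = InBuf (opposite h)" using q by auto
  have e: "map_place (sd a) p = InBuf (opp (sd a h))" using v' a by simp
  show ?thesis
  proof (cases "sd a h = s")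
    case True
    then have "h = hdg a s" using a by (metis hdg_sd)
    then show ?thesis using e True v' z coord_neighbour(1)[OF n0] by (simp add: shift_def)
  next
    case False
    then have s: "opp (sd a h) = s" using side_neq by fastforce
    then have "hdg a s = opposite h" using a by (metis hdg_opp hdg_sd)
    then have "h = opposite (hdg a s)" by simp
    then show ?thesis using e s False v' z coord_neighbour(2)[OF n0] by (simp add: shift_def)
  qed
qed

lemma dsp_coord: "live t \<Longrightarrow> a \<in> H \<Longrightarrow> dsp (ob t a) = coord n a (hdg a Left) (X t a)"
proof (induction t)
  case 0
  then show ?case by (simp add: ob_def obs1_def em_0 shift_def view_own)
next
  case (Suc t)
  have IH: "dsp (ob t a) = coord n a (hdg a Left) (X t a)" using Suc live_Suc_D by blast
  have "dsp (ob (Suc t) a) = shift n Left (map_place (sd a) (Q (Suc t) a)) (dsp (ob t a))"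
    using Suc.prems by (simp add: ob_def[of "Suc t"] obs1_def Let_def em_Suc view_own)
  also have "\<dots> = coord n a (hdg a Left) (X (Suc t) a)"
    by (rule shift_coord[OF Suc.prems(2) IH[symmetric], of _ _ "D t a"])
      (use X_Suc[OF Suc.prems] Q_Suc[OF Suc.prems] in auto)
  finally show ?case .
qed

text \<open>An unexplored agent has only gone left, so the number of its moves is its displacement.
  This is what makes \<open>seen\<close> a picture of the ring.\<close>

lemma dsp_mv: "live t \<Longrightarrow> a \<in> H \<Longrightarrow> mv (ob t a) < n \<Longrightarrow> X t a = pt n a (hdg a Left) (mv (ob t a))"
proof -
  assume a: "a \<in> H"
  have "live t \<Longrightarrow> mv (ob t a) < n \<Longrightarrow> coord n a (hdg a Left) (X t a) = mv (ob t a)"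
  proof (induction t)
    case 0
    then show ?case using a by (simp add: ob_0)
  next
    case (Suc t)
    have l: "live t" using Suc.prems live_Suc_D by blast
    have m: "mv (ob t a) < n" using mv_mono[OF Suc.prems(1) a, of t] Suc.prems(2) by simp
    have IH: "coord n a (hdg a Left) (X t a) = mv (ob t a)" using Suc l m by blast
    have d: "D t a = hdg a Left" using unexplored(4)[OF l a m] .
    show ?case
      using X_Suc[OF Suc.prems(1) a] ob_Suc(1)[OF Suc.prems(1) a] IH d coord_neighbour(1)[OF n0] Suc.prems(2)
      by auto
  qed
  then show "live t \<Longrightarrow> mv (ob t a) < n \<Longrightarrow> X t a = pt n a (hdg a Left) (mv (ob t a))"
    using pt_coord[of "X t a" n a "hdg a Left"] a by simp
qed

lemma seen_set:
  "live t \<Longrightarrow> a \<in> H \<Longrightarrow>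
    set (seen (ob t a)) = {i. i < n \<and> i \<le> mv (ob t a) \<and> pt n a (hdg a Left) i \<in> H}"
proof (induction t)
  case 0
  have "pt n a (hdg a Left) 0 = a" using 0 H_less by (simp add: pt_def)
  then show ?case using 0 n0 by (auto simp: ob_def obs1_def em_0 Let_def is_in_def view_own)
next
  case (Suc t)
  have l: "live t" using Suc.prems live_Suc_D by blast
  have IH: "set (seen (ob t a)) = {i. i < n \<and> i \<le> mv (ob t a) \<and> pt n a (hdg a Left) i \<in> H}"
    using Suc l by blast
  let ?v = "mv (ob (Suc t) a)"
  have s: "seen (ob (Suc t) a) = (if ?v < n \<and> X (Suc t) a \<in> H then ?v # seen (ob t a) else seen (ob t a))"
    using Suc.prems by (simp add: ob_def[of "Suc t"] obs1_def Let_def em_Suc)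
  have x: "?v < n \<Longrightarrow> X (Suc t) a = pt n a (hdg a Left) ?v"
    using dsp_mv[OF Suc.prems] by blast
  have v: "y \<le> ?v \<longleftrightarrow> y = ?v \<or> y \<le> mv (ob t a)" for y
    using ob_Suc(1)[OF Suc.prems] by (cases "stuck t a") auto
  show ?case
  proof (rule set_eqI)
    fix y
    have "y \<in> set (seen (ob (Suc t) a)) \<longleftrightarrow> (?v < n \<and> X (Suc t) a \<in> H \<and> y = ?v) \<or> y \<in> set (seen (ob t a))"
      unfolding s by (cases "?v < n \<and> X (Suc t) a \<in> H") auto
    also have "\<dots> \<longleftrightarrow> (?v < n \<and> pt n a (hdg a Left) ?v \<in> H \<and> y = ?v)
        \<or> (y < n \<and> y \<le> mv (ob t a) \<and> pt n a (hdg a Left) y \<in> H)"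
      unfolding IH using x by (metis (mono_tags, lifting) mem_Collect_eq)
    also have "\<dots> \<longleftrightarrow> y < n \<and> y \<le> ?v \<and> pt n a (hdg a Left) y \<in> H"
      unfolding v by blast
    finally show "y \<in> set (seen (ob (Suc t) a)) \<longleftrightarrow>
        y \<in> {i. i < n \<and> i \<le> ?v \<and> pt n a (hdg a Left) i \<in> H}" by simp
  qed
qed

lemma seen_explored:
  assumes "live t" "a \<in> H" "n \<le> mv (ob t a)"
  shows "set (seen (ob t a)) = coord n a (hdg a Left) ` H"
proof -
  have "set (seen (ob t a)) = {i. i < n \<and> pt n a (hdg a Left) i \<in> H}"
    unfolding seen_set[OF assms(1,2)] by (intro Collect_cong) (use assms(3) in linarith)
  also have "\<dots> = coord n a (hdg a Left) ` H"
  proof safe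
    fix i assume i: "i < n" "pt n a (hdg a Left) i \<in> H"
    show "i \<in> coord n a (hdg a Left) ` H"
      by (rule image_eqI[OF _ i(2)]) (use coord_pt[OF i(1)] in simp)
  next
    fix v assume v: "v \<in> H"
    show "coord n a (hdg a Left) v < n" by (rule coord_less[OF n0])
    show "pt n a (hdg a Left) (coord n a (hdg a Left) v) \<in> H" unfolding pt_coord[OF H_less[OF v]] by (rule v)
  qed
  finally show ?thesis .
qed

lemma card_coord: "card (coord n z h ` H) = card H"
  using coord_inj H_less by (intro card_image inj_onI) blast

text \<open>The five places are disjoint and exhaust a node, so their separate counts add
  up.\<close>

lemma tot_eq:
  assumes "a \<in> H"
  shows "tot (V t a) = card {b \<in> H. b \<noteq> a \<and> X t b = X t a}"
proof -
  let ?B = "\<lambda>x. {b \<in> H. b \<noteq> a \<and> X t b = X t a \<and> Q t b = map_place (hdg a) x}"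
  have all: "(\<exists>x\<in>{AtNode, InBuf Left, InBuf Right, OutBuf Left, OutBuf Right}. q = map_place (hdg a) x)" for q
  proof -
    have s: "\<exists>s. h = hdg a s \<and> (s = Left \<or> s = Right)" for h
      using assms by (intro exI[of _ "sd a h"]) (auto intro: side.exhaust)
    show ?thesis
    proof (cases q)
      case (InBuf h)
      then show ?thesis using s[of h] by auto
    next
      case (OutBuf h)
      then show ?thesis using s[of h] by auto
    qed auto
  qed
  have eq: "{b \<in> H. b \<noteq> a \<and> X t b = X t a}
    = (\<Union>x\<in>{AtNode, InBuf Left, InBuf Right, OutBuf Left, OutBuf Right}. ?B x)"
  proof (rule set_eqI)
    fix b
    show "b \<in> {b \<in> H. b \<noteq> a \<and> X t b = X t a} \<longleftrightarrow>
      b \<in> (\<Union>x\<in>{AtNode, InBuf Left, InBuf Right, OutBuf Left, OutBuf Right}. ?B x)"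
      using all[of "Q t b"] by blast
  qed
  have "card {b \<in> H. b \<noteq> a \<and> X t b = X t a}
    = (\<Sum>x\<in>{AtNode, InBuf Left, InBuf Right, OutBuf Left, OutBuf Right}. card (?B x))"
    unfolding eq
  proof (rule card_UN_disjoint)
    show "\<forall>i\<in>{AtNode, InBuf Left, InBuf Right, OutBuf Left, OutBuf Right}.
       \<forall>j\<in>{AtNode, InBuf Left, InBuf Right, OutBuf Left, OutBuf Right}. i \<noteq> j \<longrightarrow> ?B i \<inter> ?B j = {}"
      using assms by auto
  qed auto
  then show ?thesis by (simp add: tot_def view_others[OF assms])
qed

lemma tot_all:
  assumes "a \<in> H"
  shows "tot (V t a) = card H - 1 \<longleftrightarrow> (\<forall>b\<in>H. X t b = X t a)"
proof -
  have s: "{b \<in> H. b \<noteq> a \<and> X t b = X t a} \<subseteq> H - {a}" by auto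
  have c: "card (H - {a}) = card H - 1" using assms by simp
  have "tot (V t a) = card H - 1 \<longleftrightarrow> {b \<in> H. b \<noteq> a \<and> X t b = X t a} = H - {a}"
    unfolding tot_eq[OF assms] c[symmetric] using s card_subset_eq[of "H - {a}"] by auto
  also have "\<dots> \<longleftrightarrow> (\<forall>b\<in>H. X t b = X t a)" by auto
  finally show ?thesis .
qed

end

text \<open>All agents leave the exploration simultaneously in round \<open>tex n\<close>, which
  counts as round \<open>0\<close> from here on.\<close>

locale meet = big +
  assumes known: "live (tex n)" "\<And>a. a \<in> H \<Longrightarrow> n \<le> mv (ob (tex n) a)" and axial: "axial_frame n H"
begin

abbreviation T1 :: nat where "T1 \<equiv> tex n"

definition R :: "nat set" where "R = rep n H"

definition frame :: "nat \<Rightarrow> bool \<times> nat" where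
  "frame a = the (elect n (coord n a (hdg a Left) ` H))"

definition plus :: "nat \<Rightarrow> side" where
  "plus a = (if fst (frame a) then Left else Right)"

definition hh :: "nat \<Rightarrow> heading" where
  "hh a = hdg a (plus a)"

definition zz :: "nat \<Rightarrow> nat" where
  "zz a = pt n a (if fst (frame a) then opposite (hdg a Left) else hdg a Left) (snd (frame a))"

definition z :: nat where "z = zz (SOME a. a \<in> H)"

lemma frame:
  assumes a: "a \<in> H"
  shows "elect n (coord n a (hdg a Left) ` H) = Some (frame a)"
    "aff n (fst (frame a)) (snd (frame a)) (coord n a (hdg a Left) v) = coord n (zz a) (hh a) v"
    "coord n (zz a) (hh a) ` H = R" "symm n R \<Longrightarrow> 2 * coord n (zz a) (hh a) a \<le> n"
proof -
  obtain b c where bc: "elect n (coord n a (hdg a Left) ` H) = Some (b, c)"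
    "aff n b c ` coord n a (hdg a Left) ` H = R" "symm n R \<longrightarrow> 2 * aff n b c 0 \<le> n"
    using elect_Some[OF n0 H_less[OF a] axial, of "hdg a Left"] unfolding R_def by (elim exE conjE)
  have f: "frame a = (b, c)" using bc by (simp add: frame_def)
  show "elect n (coord n a (hdg a Left) ` H) = Some (frame a)" using bc f by simp
  show e: "aff n (fst (frame a)) (snd (frame a)) (coord n a (hdg a Left) v) = coord n (zz a) (hh a) v" for v
  proof -
    have "hh a = (if b then hdg a Left else opposite (hdg a Left))"
      using a hdg_opp[OF a, of Left] by (simp add: hh_def plus_def f)
    then show ?thesis using aff_coord[OF n0, of b c a "hdg a Left" v] by (simp add: zz_def f)
  qed
  have "coord n (zz a) (hh a) ` H = aff n b c ` coord n a (hdg a Left) ` H"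
    unfolding image_image by (intro image_cong refl) (use e f in simp)
  then show "coord n (zz a) (hh a) ` H = R" using bc by simp
  show "symm n R \<Longrightarrow> 2 * coord n (zz a) (hh a) a \<le> n"
    using bc(3) e[of a] f by simp
qed

lemma zz_z: "a \<in> H \<Longrightarrow> zz a = z"
proof -
  assume a: "a \<in> H"
  define a0 where "a0 = (SOME a. a \<in> H)"
  have a0: "a0 \<in> H" unfolding a0_def using a by (rule someI)
  have l: "zz b < n" for b unfolding zz_def by (rule pt_less[OF n0])
  have "axial n R" unfolding R_def by (rule rep(2)[OF axial])
  from axial_unique(1)[OF n3 l l frame(3)[OF a] frame(3)[OF a0] this]
  show "zz a = z" by (simp add: z_def a0_def)
qed

lemma z_less: "z < n"
  unfolding z_def zz_def by (rule pt_less[OF n0])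

lemma plus_frame:
  assumes a: "a \<in> H"
  shows "coord n z (hh a) ` H = R" "symm n R \<Longrightarrow> 2 * coord n z (hh a) a \<le> n"
    "aff n (fst (frame a)) (snd (frame a)) (coord n a (hdg a Left) v) = coord n z (hh a) v"
  using frame[OF a] zz_z[OF a] by auto

lemma axial_R: "axial n R"
  unfolding R_def by (rule rep(2)[OF axial])

lemma same_types: "\<not> symm n R \<Longrightarrow> a \<in> H \<Longrightarrow> b \<in> H \<Longrightarrow> hh a = hh b"
  using axial_unique(2)[OF n3 z_less z_less plus_frame(1) plus_frame(1) axial_R] by blast

lemma both_types: "symm n R \<Longrightarrow> 2 \<le> card H \<Longrightarrow> \<exists>a\<in>H. \<exists>b\<in>H. hh a \<noteq> hh b"
proof (rule symm_types[OF n3 z_less _ _ plus_frame(1) axial_R])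
  show "H \<subseteq> {..<n}" using H_less by auto
qed (use plus_frame(2) in auto)

definition m0 :: "nat \<Rightarrow> mt" where
  "m0 a = \<lparr>tau = 0, xc = coord n z (hh a) (X T1 a), ps = plus a, kk = card H, sy = symm n R,
     vr = False, c0 = 0, arr = None, fin = None\<rparr>"

text \<open>Memory after the observation of the round. Round \<open>0\<close> is special: the stored
  state is still an exploring one, from which \<open>m0\<close> is built on the spot.\<close>

definition om :: "nat \<Rightarrow> nat \<Rightarrow> mt" where
  "om \<tau> a = (if \<tau> = 0 then m0 a
     else obs2 n (case st (T1 + \<tau>) a of Active (Mt x) \<Rightarrow> x) (V (T1 + \<tau>) a))"

abbreviation Y :: "nat \<Rightarrow> nat \<Rightarrow> nat" where "Y \<tau> a \<equiv> X (T1 + \<tau>) a"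
abbreviation U :: "nat \<Rightarrow> nat \<Rightarrow> heading place" where "U \<tau> a \<equiv> Q (T1 + \<tau>) a"
abbreviation VV :: "nat \<Rightarrow> nat \<Rightarrow> view" where "VV \<tau> a \<equiv> V (T1 + \<tau>) a"

definition on :: "nat \<Rightarrow> bool" where
  "on \<tau> \<longleftrightarrow> (\<forall>a\<in>H. \<tau> = 0 \<or> (\<exists>x. st (T1 + \<tau>) a = Active (Mt x)))"

definition up :: "nat \<Rightarrow> nat \<Rightarrow> mt" where
  "up \<tau> a = upd2 n (om \<tau> a) (VV \<tau> a)"

definition halt :: "nat \<Rightarrow> nat \<Rightarrow> bool" where
  "halt \<tau> a \<longleftrightarrow> tot (VV \<tau> a) = kk (om \<tau> a) - 1 \<or> stop2 n (up \<tau> a)"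

definition push :: "nat \<Rightarrow> nat \<Rightarrow> heading option" where
  "push \<tau> a = map_option (hdg a) (push2 n (up \<tau> a) (VV \<tau> a))"

lemma on_0: "on 0"
  by (simp add: on_def)

lemma decide_om:
  assumes "on \<tau>" "a \<in> H"
  shows "decide (prot n) (st (T1 + \<tau>) a) (VV \<tau> a) = dec2 n (om \<tau> a) (VV \<tau> a)"
proof (cases "\<tau> = 0")
  case True
  have s: "st T1 a = Active (Ex (em T1 a))" "tm (em T1 a) = T1"
    using st_em tm_em known(1) assms by auto
  have seen: "set (seen (ob T1 a)) = coord n a (hdg a Left) ` H"
    using seen_explored[OF known(1) assms(2) known(2)[OF assms(2)]] .
  have cn: "canon n (coord n a (hdg a Left) ` H) = R"
    using canon_rep[OF n0 H_less[OF assms(2)]] by (simp add: R_def)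
  have x: "aff n (fst (frame a)) (snd (frame a)) (dsp (ob T1 a)) = coord n z (hh a) (X T1 a)"
    unfolding dsp_coord[OF known(1) assms(2)] by (rule plus_frame(3)[OF assms(2)])
  have "start2 n (ob T1 a) (V T1 a) = dec2 n (m0 a) (V T1 a)"
    unfolding start2_def seen cn card_coord frame(1)[OF assms(2)] m0_def option.case
    using x by (cases "frame a") (simp add: plus_def)
  then show ?thesis using True s by (simp add: om_def act_Ex ob_def)
next
  case False
  then obtain x where x: "st (T1 + \<tau>) a = Active (Mt x)" using assms by (auto simp: on_def)
  then show ?thesis using False n3 by (simp add: om_def prot_def)
qed

lemma halt_step:
  assumes "on \<tau>" "a \<in> H" "halt \<tau> a"
  shows "st (T1 + Suc \<tau>) a = Term Gathering_Achieved" "Y (Suc \<tau>) a = Y \<tau> a"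
  using go_Suc[OF assms(2), of "prot n" "T1 + \<tau>"] decide_om[OF assms(1,2)] assms(3)
  by (auto simp: sta_Suc dec2_def Let_def halt_def up_def go_def)

lemma move_step:
  assumes "on \<tau>" "a \<in> H" "\<not> halt \<tau> a"
  shows "st (T1 + Suc \<tau>) a = Active (Mt ((up \<tau> a)\<lparr>tau := Suc (tau (om \<tau> a))\<rparr>))"
    "(Y (Suc \<tau>) a, U (Suc \<tau>) a) = go (T1 + \<tau>) (Y \<tau> a) (push \<tau> a)"
  using go_Suc[OF assms(2), of "prot n" "T1 + \<tau>"] decide_om[OF assms(1,2)] assms(3)
  by (auto simp: sta_Suc dec2_def Let_def halt_def up_def push_def)

text \<open>The only doubtful case is an exploring state after round \<open>tex n\<close>; it is
  excluded because such a state carries its own clock.\<close>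

lemma on_Suc_D: "on (Suc \<tau>) \<Longrightarrow> on \<tau>"
proof -
  assume o: "on (Suc \<tau>)"
  have "\<exists>x. st (T1 + \<tau>) a = Active (Mt x)" if a: "a \<in> H" and t: "\<tau> \<noteq> 0" for a
  proof -
    obtain x where x: "st (Suc (T1 + \<tau>)) a = Active (Mt x)" using o a by (auto simp: on_def)
    then obtain y where y: "st (T1 + \<tau>) a = Active y"
      using Active_before[of "prot n" "Suc (T1 + \<tau>)" a "Mt x" "T1 + \<tau>"] by auto
    show ?thesis
    proof (cases y)
      case (Ex e)
      have r: "tm e' = r" if "st r a = Active (Ex e')" for r e'
        using that
      proof (induction r arbitrary: e')
        case 0
        then show ?case using st_em[OF live_0 a] tm_em[OF live_0 a] by simp
      next
        case (Suc r)
        from Ex_back[OF Suc.prems(1)] obtain f where f: "st r a = Active (Ex f)"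
          "e' = fst (dec1 n (obs1 n f (V r a)) (V r a))" by blast
        then show ?case using Suc.IH[OF f(1)] by simp
      qed
      obtain s where s: "\<tau> = Suc s" using t by (cases \<tau>) auto
      have "st (Suc (T1 + s)) a = Active (Ex e)" using y Ex s by simp
      from Ex_back[OF this] obtain f where f: "st (T1 + s) a = Active (Ex f)" "tm f < T1" by blast
      then show ?thesis using r[OF f(1)] s by auto
    qed (use y in simp)
  qed
  then show "on \<tau>" by (auto simp: on_def)
qed

lemma on_Suc:
  assumes "on (Suc \<tau>)" "a \<in> H"
  shows "\<not> halt \<tau> a" "om (Suc \<tau>) a = obs2 n ((up \<tau> a)\<lparr>tau := Suc (tau (om \<tau> a))\<rparr>) (VV (Suc \<tau>) a)"
    "(Y (Suc \<tau>) a, U (Suc \<tau>) a) = go (T1 + \<tau>) (Y \<tau> a) (push \<tau> a)"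
proof -
  have o: "on \<tau>" using assms on_Suc_D by blast
  obtain x where x: "st (T1 + Suc \<tau>) a = Active (Mt x)" using assms unfolding on_def by auto
  show nh: "\<not> halt \<tau> a"
  proof
    assume "halt \<tau> a"
    then show False using halt_step(1)[OF o assms(2)] x by simp
  qed
  show "om (Suc \<tau>) a = obs2 n ((up \<tau> a)\<lparr>tau := Suc (tau (om \<tau> a))\<rparr>) (VV (Suc \<tau>) a)"
    using move_step(1)[OF o assms(2) nh] by (simp add: om_def)
  show "(Y (Suc \<tau>) a, U (Suc \<tau>) a) = go (T1 + \<tau>) (Y \<tau> a) (push \<tau> a)"
    by (rule move_step(2)[OF o assms(2) nh])
qed

lemma on_SucI: "on \<tau> \<Longrightarrow> \<forall>a\<in>H. \<not> halt \<tau> a \<Longrightarrow> on (Suc \<tau>)"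
  using move_step(1) by (auto simp: on_def)

definition halted :: "nat \<Rightarrow> nat \<Rightarrow> bool" where
  "halted \<tau> a \<longleftrightarrow> miss (T1 + \<tau>) = Some (edge_towards n (Y \<tau> a) (the (push \<tau> a)))"

lemma move:
  assumes "on (Suc \<tau>)" "a \<in> H"
  shows "push \<tau> a = None \<Longrightarrow> Y (Suc \<tau>) a = Y \<tau> a \<and> U (Suc \<tau>) a = AtNode"
    "push \<tau> a = Some h \<Longrightarrow> Y (Suc \<tau>) a = (if halted \<tau> a then Y \<tau> a else neighbour n (Y \<tau> a) h)"
    "push \<tau> a = Some h \<Longrightarrow> U (Suc \<tau>) a = (if halted \<tau> a then OutBuf h else InBuf (opposite h))"
  using on_Suc(3)[OF assms] by (auto simp: go_def halted_def split: if_splits)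

lemma upd2_simps [simp]: "tau (upd2 n m w) = tau m" "xc (upd2 n m w) = xc m" "ps (upd2 n m w) = ps m"
  "kk (upd2 n m w) = kk m" "sy (upd2 n m w) = sy m"
  by (simp_all add: upd2_def)

lemma obs2_simps [simp]: "tau (obs2 n m w) = tau m" "ps (obs2 n m w) = ps m"
  "kk (obs2 n m w) = kk m" "sy (obs2 n m w) = sy m" "vr (obs2 n m w) = vr m" "c0 (obs2 n m w) = c0 m"
  "arr (obs2 n m w) = arr m" "fin (obs2 n m w) = fin m"
  by (simp_all add: obs2_def)

lemma om_const:
  "on \<tau> \<Longrightarrow> a \<in> H \<Longrightarrow> tau (om \<tau> a) = \<tau> \<and> ps (om \<tau> a) = plus a \<and> kk (om \<tau> a) = card H
     \<and> sy (om \<tau> a) = symm n R \<and> xc (om \<tau> a) = coord n z (hh a) (Y \<tau> a)"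
proof (induction \<tau>)
  case 0
  then show ?case by (simp add: om_def m0_def)
next
  case (Suc \<tau>)
  have IH: "tau (om \<tau> a) = \<tau>" "ps (om \<tau> a) = plus a" "kk (om \<tau> a) = card H"
    "sy (om \<tau> a) = symm n R" "xc (om \<tau> a) = coord n z (hh a) (Y \<tau> a)"
    using Suc on_Suc_D by blast+
  note o = on_Suc(2)[OF Suc.prems]
  have "xc (om (Suc \<tau>) a) = shift n (plus a) (map_place (sd a) (U (Suc \<tau>) a)) (xc (om \<tau> a))"
    using o IH(2) Suc.prems(2) by (simp add: obs2_def up_def view_own)
  also have "\<dots> = coord n z (hh a) (Y (Suc \<tau>) a)"
    unfolding hh_def
  proof (rule shift_coord[OF Suc.prems(2)])
    show "coord n z (hdg a (plus a)) (Y \<tau> a) = xc (om \<tau> a)" using IH by (simp add: hh_def)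
    show "Y (Suc \<tau>) a = Y \<tau> a \<and> (U (Suc \<tau>) a = AtNode \<or> U (Suc \<tau>) a = OutBuf (the (push \<tau> a)))
      \<or> Y (Suc \<tau>) a = neighbour n (Y \<tau> a) (the (push \<tau> a)) \<and> U (Suc \<tau>) a = InBuf (opposite (the (push \<tau> a)))"
      using move[OF Suc.prems] by (cases "push \<tau> a") auto
  qed
  finally show ?case using o IH by (simp add: up_def)
qed

lemma up_const:
  assumes "on \<tau>" "a \<in> H"
  shows "tau (up \<tau> a) = \<tau>" "ps (up \<tau> a) = plus a" "kk (up \<tau> a) = card H"
     "sy (up \<tau> a) = symm n R" "xc (up \<tau> a) = coord n z (hh a) (Y \<tau> a)"
  using om_const[OF assms] by (auto simp: up_def)

lemma om_Suc:
  assumes "on (Suc \<tau>)" "a \<in> H"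
  shows "vr (om (Suc \<tau>) a) = vr (up \<tau> a)" "c0 (om (Suc \<tau>) a) = c0 (up \<tau> a)"
    "arr (om (Suc \<tau>) a) = arr (up \<tau> a)" "fin (om (Suc \<tau>) a) = fin (up \<tau> a)"
  using on_Suc(2)[OF assms] by auto

definition near2 :: "nat \<Rightarrow> bool" where
  "near2 \<tau> \<longleftrightarrow> (\<exists>v. \<forall>a\<in>H. Y \<tau> a = v) \<or> (\<exists>v h. \<forall>a\<in>H. Y \<tau> a \<in> {v, neighbour n v h})"

text \<open>All agents are active up to the common halting round, and halting moves nobody, so being
  gathered in that one round suffices.\<close>

lemma win:
  assumes "on \<tau>" "\<forall>a\<in>H. halt \<tau> a" "near2 \<tau>"
  shows "solves_in S (prot n)" "\<forall>a\<in>H. st (T1 + Suc \<tau>) a = Term Gathering_Achieved"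
proof -
  show t: "\<forall>a\<in>H. st (T1 + Suc \<tau>) a = Term Gathering_Achieved" using halt_step(1) assms by blast
  show "solves_in S (prot n)"
  proof (rule solvesI[OF _ t, of "T1 + \<tau>"])
    show "\<forall>a\<in>H. \<exists>m. st (T1 + \<tau>) a = Active m"
    proof
      fix a assume a: "a \<in> H"
      show "\<exists>m. st (T1 + \<tau>) a = Active m"
        using assms(1) a st_em[OF known(1) a] by (cases "\<tau> = 0") (auto simp: on_def)
    qed
    show "\<forall>r. T1 + \<tau> < r \<and> r \<le> T1 + Suc \<tau> \<longrightarrow> gathered S (run S (prot n) r)"
    proof (intro allI impI)
      fix r assume "T1 + \<tau> < r \<and> r \<le> T1 + Suc \<tau>"
      then have r: "r = T1 + Suc \<tau>" by simp
      have "\<forall>a\<in>H. Y (Suc \<tau>) a = Y \<tau> a" using halt_step(2) assms by blast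
      then show "gathered S (run S (prot n) r)"
        using assms(3) unfolding gathered_iff near2_def r by simp
    qed
  qed
qed

end

section \<open>Sweeps towards a common target\<close>

context meet
begin

lemma on_mono: "on t \<Longrightarrow> s \<le> t \<Longrightarrow> on s"
proof (induction t)
  case (Suc t)
  then show ?case using on_Suc_D by (cases "s = Suc t") auto
qed simp

lemma Y_less: "a \<in> H \<Longrightarrow> Y \<tau> a < n"
  by simp

lemma coord_step:
  assumes "w < n" "v < n" "v \<noteq> w"
  shows "Suc (coord n w (opposite h) (neighbour n v h)) = coord n w (opposite h) v"
proof -
  have "coord n w (opposite h) (neighbour n v h) = (coord n w (opposite h) v + n - 1) mod n"
    using coord_neighbour(2)[OF n0, of w "opposite h" v] by simp
  moreover have "coord n w (opposite h) v < n" "coord n w (opposite h) v \<noteq> 0"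
    using coord_less[OF n0] coord_0[OF assms(2,1)] assms(3) by auto
  ultimately show ?thesis using mod_pred[of "coord n w (opposite h) v" n] by auto
qed

lemma coord_sum:
  assumes "w < n" "v < n" "v \<noteq> w"
  shows "coord n w (opposite h) v + coord n w h v = n"
proof -
  have "coord n w h v < n" "coord n w h v \<noteq> 0"
    using coord_less[OF n0] coord_0[OF assms(2,1)] assms(3) by auto
  then show ?thesis using coord_opposite[OF n0, of w h v] by simp
qed

end

text \<open>Common form of the three stages: for \<open>n\<close> rounds everybody off the target
  \<open>w\<close> walks there with a fixed heading \<open>g a\<close>. The second rule is demanded
  only at positions no farther from \<open>w\<close> than the start, because in the first stage the
  direction is computed from the current position.\<close>

locale sweep = meet +
  fixes s w :: nat and g :: "nat \<Rightarrow> heading"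
  assumes w: "w < n" and on_end: "on (s + n)"
    and pushes: "\<And>\<tau> a. s \<le> \<tau> \<Longrightarrow> \<tau> < s + n \<Longrightarrow> a \<in> H \<Longrightarrow> Y \<tau> a = w \<Longrightarrow> push \<tau> a = None"
      "\<And>\<tau> a. s \<le> \<tau> \<Longrightarrow> \<tau> < s + n \<Longrightarrow> a \<in> H \<Longrightarrow> Y \<tau> a \<noteq> w
        \<Longrightarrow> coord n w (opposite (g a)) (Y \<tau> a) \<le> coord n w (opposite (g a)) (Y s a) \<Longrightarrow> push \<tau> a = Some (g a)"
    and pairs: "\<And>a b. a \<in> H \<Longrightarrow> b \<in> H \<Longrightarrow> Y s a \<noteq> w \<Longrightarrow> Y s b \<noteq> w \<Longrightarrow>
      Y s a = Y s b \<and> g a = g b \<or>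
      coord n w (opposite (g a)) (Y s a) + coord n w (opposite (g b)) (Y s b) \<le> n"
begin

text \<open>The number of steps left to the target.\<close>

definition rem :: "nat \<Rightarrow> nat \<Rightarrow> nat" where
  "rem \<tau> a = coord n w (opposite (g a)) (Y \<tau> a)"

lemma rem_0: "a \<in> H \<Longrightarrow> rem \<tau> a = 0 \<longleftrightarrow> Y \<tau> a = w"
  using coord_0[OF Y_less w] by (simp add: rem_def)

lemma on_s: "\<tau> \<le> s + n \<Longrightarrow> on \<tau>"
  using on_mono on_end by blast

lemma rem_le: "a \<in> H \<Longrightarrow> s \<le> \<tau> \<Longrightarrow> \<tau> \<le> s + n \<Longrightarrow> rem \<tau> a \<le> rem s a"
proof (induction \<tau>)
  case (Suc \<tau>)
  show ?case
  proof (cases "s = Suc \<tau>")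
    case False
    then have IH: "rem \<tau> a \<le> rem s a" and t: "s \<le> \<tau>" "\<tau> < s + n" using Suc by auto
    have o: "on (Suc \<tau>)" using on_s Suc.prems by blast
    show ?thesis
    proof (cases "Y \<tau> a = w")
      case True
      then have "Y (Suc \<tau>) a = w" using move(1)[OF o Suc.prems(1)] pushes(1)[OF t Suc.prems(1)] by simp
      then show ?thesis using rem_0[OF Suc.prems(1), of "Suc \<tau>"] by simp
    next
      case nw: False
      have "push \<tau> a = Some (g a)" using pushes(2)[OF t Suc.prems(1) nw] IH by (simp add: rem_def)
      then show ?thesis
        using move(2)[OF o Suc.prems(1)] IH coord_step[OF w Y_less[OF Suc.prems(1)] nw, of "g a"]
        by (auto simp: rem_def)
    qed
  qed simp
qed simp

lemma push_eq:
  assumes "a \<in> H" "s \<le> \<tau>" "\<tau> < s + n"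
  shows "push \<tau> a = (if Y \<tau> a = w then None else Some (g a))"
  using pushes(1)[OF assms(2,3,1)] pushes(2)[OF assms(2,3,1)] rem_le[OF assms(1,2)] assms(3)
  by (simp add: rem_def)

lemma stay: "a \<in> H \<Longrightarrow> s \<le> \<tau> \<Longrightarrow> \<tau> \<le> \<tau>' \<Longrightarrow> \<tau>' \<le> s + n \<Longrightarrow> Y \<tau> a = w \<Longrightarrow> Y \<tau>' a = w"
proof (induction \<tau>')
  case (Suc t)
  show ?case
  proof (cases "\<tau> = Suc t")
    case False
    then have "Y t a = w" using Suc by simp
    then show ?thesis
      using move(1)[of t a] push_eq[of a t] on_s[of "Suc t"] Suc.prems False by simp
  qed (use Suc in simp)
qed simp

lemma rem_Suc:
  assumes "a \<in> H" "s \<le> \<tau>" "\<tau> < s + n" "Y \<tau> a \<noteq> w"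
  shows "rem \<tau> a = rem (Suc \<tau>) a + (if halted \<tau> a then 0 else 1)"
  using move(2)[of \<tau> a "g a"] push_eq[OF assms(1-3)] on_s[of "Suc \<tau>"] assms
    coord_step[OF w Y_less[OF assms(1)] assms(4), of "g a"]
  by (auto simp: rem_def)

lemma lock:
  assumes "a \<in> H" "b \<in> H" "g a = g b" "s \<le> \<tau>" "\<tau> \<le> \<tau>'" "\<tau>' \<le> s + n" "Y \<tau> a = Y \<tau> b"
  shows "Y \<tau>' a = Y \<tau>' b"
  using assms(5,6)
proof (induction \<tau>' rule: dec_induct)
  case (step t)
  then have e: "Y t a = Y t b" by simp
  have p: "push t a = push t b" using push_eq[of _ t] assms step e by simp
  have h: "halted t a = halted t b" using p e by (simp add: halted_def)
  have o: "on (Suc t)" using on_s step by simp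
  show ?case
  proof (cases "push t a")
    case None
    then show ?thesis
      using move(1)[OF o assms(1) None] move(1)[OF o assms(2)] p e by simp
  next
    case (Some x)
    then have q: "push t b = Some x" using p by simp
    show ?thesis
      using move(2)[OF o assms(1) Some] move(2)[OF o assms(2) q] h e by simp
  qed
qed (use assms in simp)

text \<open>Two agents blocked by one edge with opposite headings are at its two ends. Their ways to
  \<open>w\<close> then cover the ring, and this edge twice, so the distances would add up to
  \<open>n + 1\<close>.\<close>

lemma not_both:
  assumes ab: "a \<in> H" "b \<in> H" and t: "s \<le> \<tau>" "\<tau> < s + n" and nw: "Y \<tau> a \<noteq> w" "Y \<tau> b \<noteq> w"
    and h: "halted \<tau> a" "halted \<tau> b" and sum: "rem \<tau> a + rem \<tau> b \<le> n"
  shows "Y \<tau> a = Y \<tau> b \<and> g a = g b"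
proof -
  have e: "edge_towards n (Y \<tau> a) (g a) = edge_towards n (Y \<tau> b) (g b)"
    using h push_eq[OF ab(1) t] push_eq[OF ab(2) t] nw by (simp add: halted_def)
  show ?thesis
  proof (cases "g a = g b")
    case True
    then show ?thesis using e edge_towards_inj[OF Y_less[OF ab(1)] Y_less[OF ab(2)]] by simp
  next
    case False
    then have o: "g a = opposite (g b)" using heading_neq by metis
    then have ya: "Y \<tau> a = neighbour n (Y \<tau> b) (g b)"
      using e edge_towards_facing[OF Y_less[OF ab(1)] Y_less[OF ab(2)]] by simp
    have "Suc (coord n w (opposite (g b)) (Y \<tau> a)) = rem \<tau> b"
      using coord_step[OF w Y_less[OF ab(2)] nw(2), of "g b"] ya by (simp add: rem_def)
    moreover have "coord n w (opposite (g b)) (Y \<tau> a) + rem \<tau> a = n"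
      using coord_sum[OF w Y_less[OF ab(1)] nw(1), of "g b"] o by (simp add: rem_def)
    ultimately show ?thesis using sum by simp
  qed
qed

text \<open>While both are underway and not together with the same heading, at least one of them
  advances in each round. The sum of the distances is at most \<open>n\<close>, hence exhausted
  after \<open>n\<close> rounds.\<close>

lemma merge:
  assumes ab: "a \<in> H" "b \<in> H" and nw: "Y (s + n) a \<noteq> w" "Y (s + n) b \<noteq> w"
  shows "Y (s + n) a = Y (s + n) b \<and> g a = g b"
proof (rule ccontr)
  assume no: "\<not> ?thesis"
  have out: "Y \<tau> c \<noteq> w" if "c = a \<or> c = b" "s \<le> \<tau>" "\<tau> \<le> s + n" for \<tau> c
    using stay[of c \<tau> "s + n"] that ab nw by auto
  have apart: "\<not> (Y \<tau> a = Y \<tau> b \<and> g a = g b)" if "s \<le> \<tau>" "\<tau> \<le> s + n" for \<tau>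
    using lock[OF ab _ that(1) that(2)] no by auto
  have ne: "\<not> (Y s a = Y s b \<and> g a = g b)" using apart[of s] by simp
  have sum0: "rem s a + rem s b \<le> n"
    using pairs[OF ab] out[of _ s] ne by (simp add: rem_def)
  have "\<tau> \<le> n \<Longrightarrow> rem (s + \<tau>) a + rem (s + \<tau>) b + \<tau> \<le> n" for \<tau>
  proof (induction \<tau>)
    case 0
    then show ?case using sum0 by simp
  next
    case (Suc \<tau>)
    then have IH: "rem (s + \<tau>) a + rem (s + \<tau>) b + \<tau> \<le> n" by simp
    have t: "s \<le> s + \<tau>" "s + \<tau> < s + n" using Suc.prems by auto
    have oa: "Y (s + \<tau>) a \<noteq> w" "Y (s + \<tau>) b \<noteq> w" using out t by auto
    have "\<not> (halted (s + \<tau>) a \<and> halted (s + \<tau>) b)"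
      using not_both[OF ab t oa] apart[of "s + \<tau>"] t IH by auto
    then show ?case
      using rem_Suc[OF ab(1) t oa(1)] rem_Suc[OF ab(2) t oa(2)] IH by (auto split: if_splits)
  qed
  from this[of n] have "rem (s + n) a = 0" by simp
  then show False using rem_0[OF ab(1)] nw by simp
qed

lemma U_in:
  assumes "b \<in> H" "s < \<tau>" "\<tau> \<le> s + n" "U \<tau> b = InBuf h"
  shows "h = opposite (g b) \<and> Y s b \<noteq> w"
proof -
  obtain t where t: "\<tau> = Suc t" using assms(2) by (cases \<tau>) auto
  have p: "push t b = (if Y t b = w then None else Some (g b))" using push_eq assms t by simp
  have o: "on (Suc t)" using on_s assms t by blast
  have "Y t b \<noteq> w" using move(1)[OF o assms(1)] p assms(4) t by auto
  then show ?thesis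
    using move(3)[OF o assms(1), of "g b"] p assms t stay[of b s t] by (auto split: if_splits)
qed

lemma U_arrive:
  assumes "b \<in> H" "s \<le> \<tau>" "\<tau> < s + n" "Y \<tau> b \<noteq> w" "Y (Suc \<tau>) b = w"
  shows "U (Suc \<tau>) b = InBuf (opposite (g b))"
proof -
  have p: "push \<tau> b = Some (g b)" using push_eq assms by simp
  have o: "on (Suc \<tau>)" using on_s assms by simp
  show ?thesis using move(2,3)[OF o assms(1) p] assms by (auto split: if_splits)
qed

lemma in_side:
  assumes "v \<in> H"
  shows "(0 < others (VV \<tau> v) (InBuf Left) \<or> 0 < others (VV \<tau> v) (InBuf Right))
    \<longleftrightarrow> (\<exists>b\<in>H. b \<noteq> v \<and> Y \<tau> b = Y \<tau> v \<and> (\<exists>h. U \<tau> b = InBuf h))" (is "?L \<longleftrightarrow> ?R")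
proof
  note l = others_pos[OF assms, of "prot n" "T1 + \<tau>" "InBuf Left"]
  note r = others_pos[OF assms, of "prot n" "T1 + \<tau>" "InBuf Right"]
  show "?L \<Longrightarrow> ?R" using l r by fastforce
  assume ?R
  then obtain b h where b: "b \<in> H" "b \<noteq> v" "Y \<tau> b = Y \<tau> v" "U \<tau> b = InBuf h" by blast
  show ?L
  proof (cases "sd v h")
    case Left
    then have "h = hdg v Left" using hdg_sd[OF assms, of h] by simp
    then show ?thesis using l b by auto
  next
    case Right
    then have "h = hdg v Right" using hdg_sd[OF assms, of h] by simp
    then show ?thesis using r b by auto
  qed
qed

text \<open>Every arrival passes through an incoming buffer at \<open>w\<close>, whose side reveals
  the heading, and nobody leaves \<open>w\<close> again. So what is recorded first stays
  true.\<close>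

lemma watch:
  assumes v: "v \<in> H" "Y s v = w" and a0: "arr (om (Suc s) v) = None"
    and arr: "\<And>\<tau>. s < \<tau> \<Longrightarrow> \<tau> < s + n \<Longrightarrow> arr (up \<tau> v) = arrive (om \<tau> v) (VV \<tau> v)"
  shows "s < \<tau> \<Longrightarrow> \<tau> \<le> s + n \<Longrightarrow>
    (\<forall>d. arrive (om \<tau> v) (VV \<tau> v) = Some d \<longrightarrow>
      (\<exists>b\<in>H. Y s b \<noteq> w \<and> Y \<tau> b = w \<and> hdg v d = opposite (g b)))
    \<and> (arrive (om \<tau> v) (VV \<tau> v) = None \<longrightarrow> (\<forall>b\<in>H. Y s b \<noteq> w \<longrightarrow> Y \<tau> b \<noteq> w))"
proof (induction \<tau>)
  case (Suc \<tau>)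
  have o: "on (Suc \<tau>)" using on_s Suc.prems by blast
  have yv: "Y (Suc \<tau>) v = w" using stay[OF v(1), of s "Suc \<tau>"] v Suc.prems by simp
  have new: "\<exists>b\<in>H. Y s b \<noteq> w \<and> Y (Suc \<tau>) b = w \<and> hdg v d = opposite (g b)"
    if "0 < others (VV (Suc \<tau>) v) (InBuf d)" for d
  proof -
    have "\<exists>b\<in>H. b \<noteq> v \<and> Y (Suc \<tau>) b = Y (Suc \<tau>) v \<and> U (Suc \<tau>) b = InBuf (hdg v d)"
      using iffD1[OF others_pos[OF v(1), of "prot n" "T1 + Suc \<tau>" "InBuf d"] that] unfolding place.map .
    then obtain b where b: "b \<in> H" "Y (Suc \<tau>) b = w" "U (Suc \<tau>) b = InBuf (hdg v d)"
      unfolding yv by blast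
    then show ?thesis using U_in[OF b(1) Suc.prems b(3)] by auto
  qed
  show ?case
  proof (cases "arr (om (Suc \<tau>) v)")
    case None
    have a: "arrive (om (Suc \<tau>) v) (VV (Suc \<tau>) v)
      = (if 0 < others (VV (Suc \<tau>) v) (InBuf Left) then Some Left
         else if 0 < others (VV (Suc \<tau>) v) (InBuf Right) then Some Right else None)"
      by (simp add: arrive_def None)
    have old: "Y \<tau> b \<noteq> w" if "b \<in> H" "Y s b \<noteq> w" for b
    proof (cases "s = \<tau>")
      case False
      then have t: "s < \<tau>" "\<tau> < s + n" using Suc.prems by auto
      have "arrive (om \<tau> v) (VV \<tau> v) = None" using None om_Suc(3)[OF o v(1)] arr[OF t] by simp
      then show ?thesis using Suc.IH t that by simp
    qed (use that in simp)
    have "Y (Suc \<tau>) b \<noteq> w" if n: "arrive (om (Suc \<tau>) v) (VV (Suc \<tau>) v) = None" and b: "b \<in> H" "Y s b \<noteq> w" for b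
    proof
      assume y: "Y (Suc \<tau>) b = w"
      have "U (Suc \<tau>) b = InBuf (opposite (g b))"
        using U_arrive[OF b(1) _ _ old[OF b] y] Suc.prems by simp
      moreover have "b \<noteq> v" using b v by auto
      ultimately have "0 < others (VV (Suc \<tau>) v) (InBuf Left) \<or> 0 < others (VV (Suc \<tau>) v) (InBuf Right)"
        using in_side[OF v(1), of "Suc \<tau>"] b y yv by auto
      then show False using n a by (auto split: if_splits)
    qed
    then show ?thesis using a new by (auto split: if_splits)
  next
    case (Some d)
    have ns: "\<tau> \<noteq> s" using Some a0 by auto
    then have t: "s < \<tau>" "\<tau> < s + n" using Suc.prems by auto
    have ar: "arrive (om (Suc \<tau>) v) (VV (Suc \<tau>) v) = Some d" by (simp add: arrive_def Some)
    have "arrive (om \<tau> v) (VV \<tau> v) = Some d" using Some om_Suc(3)[OF o v(1)] arr[OF t] by simp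
    then obtain b where b: "b \<in> H" "Y s b \<noteq> w" "Y \<tau> b = w" "hdg v d = opposite (g b)"
      using Suc.IH t by auto
    have "Y (Suc \<tau>) b = w" using stay[OF b(1), of \<tau> "Suc \<tau>"] b t by simp
    then show ?thesis using ar b by auto
  qed
qed simp

lemma watch_end:
  assumes v: "v \<in> H" "Y s v = w" and a0: "arr (om (Suc s) v) = None"
    and arr: "\<And>\<tau>. s < \<tau> \<Longrightarrow> \<tau> < s + n \<Longrightarrow> arr (up \<tau> v) = arrive (om \<tau> v) (VV \<tau> v)"
  shows "arrive (om (s + n) v) (VV (s + n) v) = Some d \<Longrightarrow>
      \<exists>b\<in>H. Y s b \<noteq> w \<and> Y (s + n) b = w \<and> hdg v d = opposite (g b)"
    "arrive (om (s + n) v) (VV (s + n) v) = None \<Longrightarrow> b \<in> H \<Longrightarrow> Y s b \<noteq> w \<Longrightarrow> Y (s + n) b \<noteq> w"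
  using watch[OF v a0 arr, of "s + n"] n0 by auto

text \<open>By \<open>merge\<close> those who do not arrive remain together, and nobody joins them.
  Hence a group shrinks precisely if one of its members has arrived.\<close>

lemma companions:
  assumes a: "a \<in> H" "Y (s + n) a \<noteq> w"
    and together: "\<forall>b\<in>H. Y s b \<noteq> w \<longrightarrow> Y s b = Y s a"
  shows "tot (VV (s + n) a) < tot (VV s a) \<longleftrightarrow> (\<exists>b\<in>H. Y s b \<noteq> w \<and> Y (s + n) b = w)"
proof -
  have st: "Y s b = w \<Longrightarrow> b \<in> H \<Longrightarrow> Y (s + n) b = w" for b
    using stay[of b s "s + n"] by simp
  have a0: "Y s a \<noteq> w" using st[of a] a by blast
  define A where "A = {b \<in> H. b \<noteq> a \<and> Y (s + n) b = Y (s + n) a}"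
  define B where "B = {b \<in> H. b \<noteq> a \<and> Y s b = Y s a}"
  have fB: "finite B" by (simp add: B_def)
  have sub: "A \<subseteq> B"
  proof
    fix b assume "b \<in> A"
    then have b: "b \<in> H" "b \<noteq> a" "Y (s + n) b = Y (s + n) a" by (simp_all add: A_def)
    then have "Y s b \<noteq> w" using st[of b] a(2) by metis
    then show "b \<in> B" using together b(1,2) by (simp add: B_def)
  qed
  have "tot (VV (s + n) a) < tot (VV s a) \<longleftrightarrow> card A < card B"
    unfolding tot_eq[OF a(1)] A_def B_def ..
  also have "\<dots> \<longleftrightarrow> A \<noteq> B"
    using sub psubset_card_mono[OF fB, of A] by blast
  also have "\<dots> \<longleftrightarrow> (\<exists>b\<in>H. Y s b \<noteq> w \<and> Y (s + n) b = w)"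
  proof
    assume "A \<noteq> B"
    then have "\<exists>b. b \<in> B \<and> b \<notin> A" using sub by blast
    then obtain b where bA: "b \<in> B" "b \<notin> A" by blast
    then have b: "b \<in> H" "b \<noteq> a" "Y s b = Y s a" by (simp_all add: B_def)
    have nb: "Y (s + n) b \<noteq> Y (s + n) a" using bA(2) b(1,2) by (simp add: A_def)
    have "Y (s + n) b = w" using merge[OF b(1) a(1) _ a(2)] nb by blast
    then show "\<exists>b\<in>H. Y s b \<noteq> w \<and> Y (s + n) b = w" using b(1) b(3) a0 by metis
  next
    assume "\<exists>b\<in>H. Y s b \<noteq> w \<and> Y (s + n) b = w"
    then obtain b where b: "b \<in> H" "Y s b \<noteq> w" "Y (s + n) b = w" by blast
    have "b \<in> B" using together b a(2) by (auto simp: B_def)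
    moreover have "b \<notin> A" using b(3) a(2) by (simp add: A_def)
    ultimately show "A \<noteq> B" by blast
  qed
  finally show ?thesis .
qed

text \<open>Agents starting at one node with the same heading cannot be separated, as they are
  blocked by the same edge.\<close>

lemma reached_opposite:
  assumes a: "a \<in> H" "Y (s + n) a \<noteq> w" and b: "b \<in> H" "Y (s + n) b = w" "Y s b = Y s a"
  shows "g b = opposite (g a)"
proof (rule ccontr)
  assume "\<not> ?thesis"
  then have "g b = g a" using heading_neq by metis
  then show False using lock[OF b(1) a(1), of s "s + n"] a b by simp
qed

end

text \<open>Basis of an argument by contradiction. In particular the agents are never all at one
  node, since they would see it and halt; this provides an agent at the target and one elsewhere
  whenever they are needed.\<close>

locale elude = meet +
  assumes nowin: "\<And>\<tau>. \<tau> \<le> (n + 3) * n \<Longrightarrow> on \<tau> \<Longrightarrow> \<forall>a\<in>H. halt \<tau> a \<Longrightarrow> \<not> near2 \<tau>"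
begin

lemma tot_on: "on \<tau> \<Longrightarrow> a \<in> H \<Longrightarrow> tot (VV \<tau> a) = kk (om \<tau> a) - 1 \<longleftrightarrow> (\<forall>b\<in>H. Y \<tau> b = Y \<tau> a)"
  using tot_all[of a "T1 + \<tau>"] om_const[of \<tau> a] by simp

lemma apart:
  assumes "on \<tau>" "\<tau> \<le> (n + 3) * n"
  shows "\<not> (\<forall>a\<in>H. Y \<tau> a = v)"
proof
  assume e: "\<forall>a\<in>H. Y \<tau> a = v"
  have "\<forall>a\<in>H. halt \<tau> a" unfolding halt_def using tot_on[OF assms(1)] e by simp
  moreover have "near2 \<tau>" unfolding near2_def using e by blast
  ultimately show False using nowin[OF assms(2,1)] by blast
qed

lemma halt_iff:
  assumes "on \<tau>" "\<tau> \<le> (n + 3) * n" "a \<in> H"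
  shows "halt \<tau> a \<longleftrightarrow> stop2 n (up \<tau> a)"
  using tot_on[OF assms(1,3)] apart[OF assms(1,2), of "Y \<tau> a"] unfolding halt_def by blast

lemma on_next:
  assumes "on \<tau>" "\<tau> \<le> (n + 3) * n" "\<forall>a\<in>H. \<not> stop2 n (up \<tau> a)"
  shows "on (Suc \<tau>)"
  using on_SucI[OF assms(1)] halt_iff[OF assms(1,2)] assms(3) by blast

lemma no_stop2: "on \<tau> \<Longrightarrow> a \<in> H \<Longrightarrow> \<tau> < 4 * n \<or> \<tau> mod n \<noteq> 0 \<Longrightarrow> \<not> stop2 n (up \<tau> a)"
  using up_const(1)[of \<tau> a] by (auto simp: stop2_def)

lemma four: "4 * n \<le> (n + 3) * n"
  using n0 by (intro mult_le_mono1) simp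

lemma on_early: "\<tau> \<le> 4 * n \<Longrightarrow> on \<tau>"
proof (induction \<tau>)
  case 0
  then show ?case by (simp add: on_0)
next
  case (Suc \<tau>)
  then have o: "on \<tau>" by simp
  have l: "\<tau> < 4 * n" using Suc by simp
  show ?case
  proof (rule on_next[OF o])
    show "\<tau> \<le> (n + 3) * n" using l four by linarith
    show "\<forall>a\<in>H. \<not> stop2 n (up \<tau> a)" using no_stop2[OF o] l by blast
  qed
qed

lemma up_eq:
  assumes "on \<tau>" "a \<in> H"
  shows "up \<tau> a = (if \<tau> = n then (om \<tau> a)\<lparr>vr := (Y \<tau> a = z), c0 := tot (VV \<tau> a)\<rparr>
      else if \<tau> = 2 * n then (om \<tau> a)\<lparr>fin := finB (om \<tau> a) (VV \<tau> a), c0 := tot (VV \<tau> a), arr := None\<rparr>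
      else if \<tau> = 3 * n then (om \<tau> a)\<lparr>fin := finC (om \<tau> a) (VV \<tau> a)\<rparr>
      else if n < \<tau> \<and> \<tau> < 3 * n then (om \<tau> a)\<lparr>arr := arrive (om \<tau> a) (VV \<tau> a)\<rparr>
      else om \<tau> a)"
proof -
  have t: "tau (om \<tau> a) = \<tau>" and x: "xc (om \<tau> a) = 0 \<longleftrightarrow> Y \<tau> a = z"
    using om_const[OF assms] coord_0[OF Y_less[OF assms(2)] z_less, of "hh a" \<tau>] by auto
  show ?thesis unfolding up_def upd2_def t x ..
qed

lemma early: "\<tau> < n \<Longrightarrow> a \<in> H \<Longrightarrow> arr (up \<tau> a) = None \<and> fin (up \<tau> a) = None"
proof (induction \<tau>)
  case 0
  then show ?case using up_eq[OF on_0 0(2)] by (simp add: om_def m0_def)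
next
  case (Suc \<tau>)
  have o: "on (Suc \<tau>)" using on_early Suc by simp
  show ?case using up_eq[OF o Suc(3)] om_Suc[OF o Suc(3)] Suc by simp
qed

lemma om_n: "a \<in> H \<Longrightarrow> arr (om n a) = None \<and> fin (om n a) = None"
proof -
  assume a: "a \<in> H"
  obtain t where t: "n = Suc t" using n0 by (cases n) auto
  have o: "on (Suc t)" using on_early t by simp
  show ?thesis using om_Suc[OF o a] early[of t a] a t by simp
qed

lemma vr_up: "n \<le> \<tau> \<Longrightarrow> on \<tau> \<Longrightarrow> a \<in> H \<Longrightarrow> vr (up \<tau> a) = (Y n a = z)"
proof (induction \<tau> rule: dec_induct)
  case base
  then show ?case using up_eq[OF base] by simp
next
  case (step \<tau>)
  have o: "on \<tau>" using step on_Suc_D by blast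
  have "vr (up (Suc \<tau>) a) = vr (om (Suc \<tau>) a)"
    using om_const[OF step.prems] step(1) by (simp add: up_def upd2_def)
  then show ?case using om_Suc(1)[OF step.prems] step.IH[OF o step.prems(2)] by simp
qed

lemma vr_om: "n < \<tau> \<Longrightarrow> on \<tau> \<Longrightarrow> a \<in> H \<Longrightarrow> vr (om \<tau> a) = (Y n a = z)"
proof (cases \<tau>)
  case (Suc t)
  assume "n < \<tau>" "on \<tau>" "a \<in> H"
  then show ?thesis using om_Suc(1)[of t a] vr_up[of t a] on_Suc_D[of t] Suc by simp
qed simp

lemma up_n: "a \<in> H \<Longrightarrow> arr (up n a) = None \<and> fin (up n a) = None \<and> c0 (up n a) = tot (VV n a)"
  using up_eq[of n a] om_n[of a] on_early[of n] by simp

lemma stageB_fields: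
  "n \<le> \<tau> \<Longrightarrow> \<tau> < 2 * n \<Longrightarrow> a \<in> H \<Longrightarrow> fin (up \<tau> a) = None \<and> c0 (up \<tau> a) = tot (VV n a)"
proof (induction \<tau> rule: dec_induct)
  case base
  then show ?case using up_n by simp
next
  case (step \<tau>)
  have o: "on (Suc \<tau>)" using on_early step by simp
  show ?case using up_eq[OF o step.prems(2)] om_Suc[OF o step.prems(2)] step by simp
qed

lemma arr_up: "n < \<tau> \<Longrightarrow> \<tau> < 3 * n \<Longrightarrow> \<tau> \<noteq> 2 * n \<Longrightarrow> a \<in> H \<Longrightarrow> arr (up \<tau> a) = arrive (om \<tau> a) (VV \<tau> a)"
  using up_eq[OF on_early[of \<tau>], of a] by simp

lemma om_2n: "a \<in> H \<Longrightarrow> fin (om (2 * n) a) = None \<and> c0 (om (2 * n) a) = tot (VV n a)"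
proof -
  assume a: "a \<in> H"
  obtain t where t: "2 * n = Suc t" using n0 by (cases "2 * n") auto
  have o: "on (Suc t)" using on_early[of "2 * n"] t by simp
  have "n \<le> t" "t < 2 * n" using t n0 by auto
  from stageB_fields[OF this a] show ?thesis using om_Suc[OF o a] t by simp
qed

lemma up_2n: "a \<in> H \<Longrightarrow> arr (up (2 * n) a) = None \<and> c0 (up (2 * n) a) = tot (VV (2 * n) a)
    \<and> fin (up (2 * n) a) = finB (om (2 * n) a) (VV (2 * n) a)"
  using up_eq[of "2 * n" a] on_early[of "2 * n"] n0 by simp

lemma stageC_fields:
  "2 * n \<le> \<tau> \<Longrightarrow> \<tau> < 3 * n \<Longrightarrow> a \<in> H \<Longrightarrow>
    fin (up \<tau> a) = fin (up (2 * n) a) \<and> c0 (up \<tau> a) = tot (VV (2 * n) a)"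
proof (induction \<tau> rule: dec_induct)
  case base
  then show ?case using up_2n by simp
next
  case (step \<tau>)
  have o: "on (Suc \<tau>)" using on_early step by simp
  have "Suc \<tau> \<noteq> n" using step by linarith
  then show ?case using up_eq[OF o step.prems(2)] om_Suc[OF o step.prems(2)] step by simp
qed

lemma om_3n: "a \<in> H \<Longrightarrow> fin (om (3 * n) a) = fin (up (2 * n) a) \<and> c0 (om (3 * n) a) = tot (VV (2 * n) a)"
proof -
  assume a: "a \<in> H"
  obtain t where t: "3 * n = Suc t" using n0 by (cases "3 * n") auto
  have o: "on (Suc t)" using on_early[of "3 * n"] t by simp
  have "2 * n \<le> t" "t < 3 * n" using t n0 by auto
  from stageC_fields[OF this a] show ?thesis using om_Suc[OF o a] t by simp
qed

lemma fin_search: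
  "3 * n \<le> \<tau> \<Longrightarrow> on \<tau> \<Longrightarrow> a \<in> H \<Longrightarrow> fin (up \<tau> a) = finC (om (3 * n) a) (VV (3 * n) a)"
proof (induction \<tau> rule: dec_induct)
  case base
  then show ?case using up_eq[OF base] n0 by simp
next
  case (step \<tau>)
  have o: "on \<tau>" using step on_Suc_D by blast
  have "Suc \<tau> \<noteq> n" "Suc \<tau> \<noteq> 2 * n" using step by linarith+
  then show ?case using up_eq[OF step.prems] om_Suc[OF step.prems] step o by simp
qed

end

section \<open>First and second stage\<close>

context elude
begin

lemma hdg_plus: "a \<in> H \<Longrightarrow> hdg a (plus a) = hh a" "a \<in> H \<Longrightarrow> hdg a (opp (plus a)) = opposite (hh a)"
  by (simp_all add: hh_def)

lemma z_coord: "a \<in> H \<Longrightarrow> coord n z h (Y \<tau> a) = 0 \<longleftrightarrow> Y \<tau> a = z"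
  by (rule coord_0[OF Y_less z_less])

text \<open>From a common start the two ways round the ring to the target add up to
  \<open>n\<close>.\<close>

lemma together_pairs:
  assumes "w < n" "v < n" "v \<noteq> w"
  shows "v = v \<and> h = h' \<or> coord n w (opposite h) v + coord n w (opposite h') v \<le> n"
proof (cases "h = h'")
  case False
  then have "h' = opposite h" using heading_neq by metis
  then show ?thesis using coord_sum[OF assms, of h] by simp
qed simp

lemma push_A:
  assumes "\<tau> < n" "a \<in> H"
  shows "push \<tau> a = (if Y \<tau> a = z then None else if 2 * coord n z (hh a) (Y \<tau> a) \<le> n
    then Some (opposite (hh a)) else Some (hh a))"
proof -
  have o: "on \<tau>" using on_early assms by simp
  show ?thesis
    using assms up_const[OF o assms(2)] z_coord[OF assms(2), of "hh a" \<tau>] hdg_plus[OF assms(2)]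
    by (simp add: push_def push2_def)
qed

definition short :: "nat \<Rightarrow> heading" where
  "short a = (if 2 * coord n z (hh a) (Y 0 a) \<le> n then opposite (hh a) else hh a)"

text \<open>Shorter ways have at most \<open>n / 2\<close> steps, so any two add up to at most
  \<open>n\<close>; and advancing on the shorter way never makes the other one preferable.\<close>

lemma stage_A: "sweep S n H 0 z short"
proof unfold_locales
  show "z < n" by (rule z_less)
  show "on (0 + n)" using on_early[of n] by simp
  fix a assume a: "a \<in> H"
  show "push \<tau> a = None" if "\<tau> < 0 + n" "Y \<tau> a = z" for \<tau>
    using push_A[of \<tau> a] that a by simp
  have c: "coord n z (opposite (hh a)) v + coord n z (hh a) v = n" if "v < n" "v \<noteq> z" for v
    by (rule coord_sum[OF z_less that])
  show "push \<tau> a = Some (short a)" if t: "\<tau> < 0 + n" "Y \<tau> a \<noteq> z"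
    "coord n z (opposite (short a)) (Y \<tau> a) \<le> coord n z (opposite (short a)) (Y 0 a)" for \<tau>
  proof (cases "2 * coord n z (hh a) (Y 0 a) \<le> n")
    case True
    then show ?thesis using push_A[of \<tau> a] t a by (simp add: short_def)
  next
    case False
    then have "Y 0 a \<noteq> z" using z_coord[OF a, of "hh a" 0] by auto
    then have "\<not> 2 * coord n z (hh a) (Y \<tau> a) \<le> n"
      using False t c[of "Y 0 a"] c[of "Y \<tau> a"] Y_less[OF a, of 0] Y_less[OF a, of \<tau>]
      by (simp add: short_def)
    then show ?thesis using push_A[of \<tau> a] t a False by (simp add: short_def)
  qed
  have half: "2 * coord n z (opposite (short a)) (Y 0 a) \<le> n" if "Y 0 a \<noteq> z" "a \<in> H" for a
    using coord_sum[OF z_less, of "Y 0 a" "hh a"] Y_less[OF that(2), of 0] that by (simp add: short_def)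
  fix b assume "b \<in> H" "Y 0 a \<noteq> z" "Y 0 b \<noteq> z"
  then show "Y 0 a = Y 0 b \<and> short a = short b
    \<or> coord n z (opposite (short a)) (Y 0 a) + coord n z (opposite (short b)) (Y 0 b) \<le> n"
    using half[of a] half[of b] a by linarith
qed

lemma grouped_A:
  assumes "a \<in> H" "b \<in> H" "Y n a \<noteq> z" "Y n b \<noteq> z"
  shows "Y n a = Y n b"
proof -
  interpret A: sweep S n H 0 z short by (rule stage_A)
  show ?thesis using A.merge[OF assms(1,2)] assms(3,4) by simp
qed

lemma bound: "\<tau> \<le> 3 * n \<Longrightarrow> \<tau> \<le> (n + 3) * n"
  using four by linarith

lemma waiter: "\<exists>a. a \<in> H \<and> Y n a = z"
proof (rule ccontr)
  assume no: "\<not> ?thesis"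
  obtain a where a: "a \<in> H" using H_ne by blast
  have "\<forall>b\<in>H. Y n b = Y n a" using grouped_A a no by blast
  then show False using apart[of n "Y n a"] on_early[of n] bound[of n] by simp
qed

lemma walker: "\<exists>a. a \<in> H \<and> Y n a \<noteq> z"
  using apart[of n z] on_early[of n] bound[of n] by auto

lemma push_B:
  assumes "n \<le> \<tau>" "\<tau> < 2 * n" "a \<in> H"
  shows "push \<tau> a = (if Y n a = z \<or> Y \<tau> a = z then None else Some (hh a))"
proof -
  have o: "on \<tau>" using on_early assms by simp
  show ?thesis
    using assms up_const[OF o assms(3)] z_coord[OF assms(3), of "hh a" \<tau>] hdg_plus[OF assms(3)]
      vr_up[OF assms(1) o assms(3)]
    by (simp add: push_def push2_def)
qed

lemma stage_B: "sweep S n H n z hh"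
proof unfold_locales
  show "z < n" by (rule z_less)
  show "on (n + n)" using on_early[of "n + n"] by simp
  fix a assume a: "a \<in> H"
  show "push \<tau> a = None" if "n \<le> \<tau>" "\<tau> < n + n" "Y \<tau> a = z" for \<tau>
    using push_B[of \<tau> a] that a by simp
  show "push \<tau> a = Some (hh a)" if t: "n \<le> \<tau>" "\<tau> < n + n" "Y \<tau> a \<noteq> z"
    "coord n z (opposite (hh a)) (Y \<tau> a) \<le> coord n z (opposite (hh a)) (Y n a)" for \<tau>
  proof -
    have "Y n a \<noteq> z"
      using t z_coord[OF a, of "opposite (hh a)" n] z_coord[OF a, of "opposite (hh a)" \<tau>] by auto
    then show ?thesis using push_B[of \<tau> a] t a by simp
  qed
  fix b assume b: "b \<in> H" "Y n a \<noteq> z" "Y n b \<noteq> z"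
  then have e: "Y n b = Y n a" using grouped_A[of b a] a by simp
  show "Y n a = Y n b \<and> hh a = hh b
    \<or> coord n z (opposite (hh a)) (Y n a) + coord n z (opposite (hh b)) (Y n b) \<le> n"
    unfolding e using together_pairs[OF z_less Y_less[OF a] b(2)] by blast
qed

lemma waiter_B: "a \<in> H \<Longrightarrow> Y n a = z \<Longrightarrow> Y (2 * n) a = z"
proof -
  assume a: "a \<in> H" "Y n a = z"
  interpret B: sweep S n H n z hh by (rule stage_B)
  show ?thesis using B.stay[OF a(1), of n "2 * n"] a by simp
qed

lemma grouped_B:
  assumes "a \<in> H" "b \<in> H" "Y (2 * n) a \<noteq> z" "Y (2 * n) b \<noteq> z"
  shows "Y (2 * n) a = Y (2 * n) b" "hh a = hh b"
proof -
  interpret B: sweep S n H n z hh by (rule stage_B)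
  show "Y (2 * n) a = Y (2 * n) b" "hh a = hh b"
    using B.merge[OF assms(1,2)] assms(3,4) by (simp_all add: mult_2)
qed

lemma walker_B: "\<exists>a. a \<in> H \<and> Y (2 * n) a \<noteq> z"
  using apart[of "2 * n" z] on_early[of "2 * n"] bound[of "2 * n"] by auto

lemma finB_eq:
  assumes a: "a \<in> H"
  shows "fin (up (2 * n) a) =
    (if Y n a = z then map_option (Pair False) (arrive (om (2 * n) a) (VV (2 * n) a))
     else if Y (2 * n) a = z then Some (False, opp (plus a))
     else if tot (VV (2 * n) a) < tot (VV n a) then Some (True, plus a) else None)"
proof -
  have o: "on (2 * n)" using on_early by simp
  show ?thesis
    using up_2n[OF a] om_const[OF o a] vr_om[OF _ o a] n0 om_2n[OF a] z_coord[OF a, of "hh a" "2 * n"]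
    by (simp add: finB_def)
qed

text \<open>Those who arrive and those left behind had set out from one node, so their headings were
  opposite, and \<open>F\<close> is the heading of the latter. Waiting agents learn it from the side
  of the arrival, agents that arrived by reversing their own heading, and those left behind from the
  loss of companions.\<close>

lemma stage_B_outcome:
  "(\<exists>b\<in>H. Y n b \<noteq> z \<and> Y (2 * n) b = z) \<Longrightarrow>
     \<exists>F. \<forall>a\<in>H. \<exists>d. fin (up (2 * n) a) = Some (Y (2 * n) a \<noteq> z, d) \<and> hdg a d = F"
  "\<not> (\<exists>b\<in>H. Y n b \<noteq> z \<and> Y (2 * n) b = z) \<Longrightarrow> \<forall>a\<in>H. fin (up (2 * n) a) = None"
proof -
  interpret B: sweep S n H n z hh by (rule stage_B)
  have o: "on (Suc n)" using on_early[of "Suc n"] n0 by simp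
  have watch:
    "\<And>d. arrive (om (2 * n) v) (VV (2 * n) v) = Some d \<Longrightarrow>
      \<exists>b\<in>H. Y n b \<noteq> z \<and> Y (2 * n) b = z \<and> hdg v d = opposite (hh b)"
    "\<And>b. arrive (om (2 * n) v) (VV (2 * n) v) = None \<Longrightarrow> b \<in> H \<Longrightarrow> Y n b \<noteq> z \<Longrightarrow> Y (2 * n) b \<noteq> z"
    if v: "v \<in> H" "Y n v = z" for v
  proof -
    have a0: "arr (om (Suc n) v) = None" using om_Suc(3)[OF o v(1)] up_n[OF v(1)] by simp
    have ar: "arr (up \<tau> v) = arrive (om \<tau> v) (VV \<tau> v)" if "n < \<tau>" "\<tau> < n + n" for \<tau>
      using arr_up[of \<tau> v] that v by simp
    note w = B.watch_end[OF v a0 ar, folded mult_2]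
    show "\<And>d. arrive (om (2 * n) v) (VV (2 * n) v) = Some d \<Longrightarrow>
      \<exists>b\<in>H. Y n b \<noteq> z \<and> Y (2 * n) b = z \<and> hdg v d = opposite (hh b)" by (rule w(1))
    show "\<And>b. arrive (om (2 * n) v) (VV (2 * n) v) = None \<Longrightarrow> b \<in> H \<Longrightarrow> Y n b \<noteq> z \<Longrightarrow> Y (2 * n) b \<noteq> z"
      by (rule w(2))
  qed
  have count: "tot (VV (2 * n) a) < tot (VV n a) \<longleftrightarrow> (\<exists>b\<in>H. Y n b \<noteq> z \<and> Y (2 * n) b = z)"
    if a: "a \<in> H" "Y (2 * n) a \<noteq> z" for a
  proof -
    have "Y n a \<noteq> z" using waiter_B[OF a(1)] a(2) by blast
    then have "\<forall>b\<in>H. Y n b \<noteq> z \<longrightarrow> Y n b = Y n a" using grouped_A a(1) by blast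
    then show ?thesis using B.companions[OF a(1), folded mult_2] a(2) by blast
  qed
  show "\<forall>a\<in>H. fin (up (2 * n) a) = None" if no: "\<not> (\<exists>b\<in>H. Y n b \<noteq> z \<and> Y (2 * n) b = z)"
  proof
    fix a assume a: "a \<in> H"
    show "fin (up (2 * n) a) = None"
    proof (cases "Y n a = z")
      case True
      have "arrive (om (2 * n) a) (VV (2 * n) a) = None"
      proof (cases "arrive (om (2 * n) a) (VV (2 * n) a)")
        case (Some d)
        then show ?thesis using watch(1)[OF a True] no by blast
      qed
      then show ?thesis using finB_eq[OF a] True by simp
    next
      case False
      then have "Y (2 * n) a \<noteq> z" using no a by blast
      then show ?thesis using finB_eq[OF a] False count[OF a] no by auto
    qed
  qed
  show "\<exists>F. \<forall>a\<in>H. \<exists>d. fin (up (2 * n) a) = Some (Y (2 * n) a \<noteq> z, d) \<and> hdg a d = F"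
    if ex: "\<exists>b\<in>H. Y n b \<noteq> z \<and> Y (2 * n) b = z"
  proof -
    obtain c where c: "c \<in> H" "Y (2 * n) c \<noteq> z" using walker_B by blast
    have opp: "opposite (hh b) = hh c" if b: "b \<in> H" "Y n b \<noteq> z" "Y (2 * n) b = z" for b
    proof -
      have "Y n c \<noteq> z" using waiter_B[OF c(1)] c(2) by blast
      then have "Y n b = Y n c" using grouped_A b c(1) by blast
      then show ?thesis using B.reached_opposite[OF c(1) _ b(1), folded mult_2] b c by simp
    qed
    have "\<exists>d. fin (up (2 * n) a) = Some (Y (2 * n) a \<noteq> z, d) \<and> hdg a d = hh c" if a: "a \<in> H" for a
    proof (cases "Y n a = z")
      case True
      then have y: "Y (2 * n) a = z" using waiter_B a by blast
      have "arrive (om (2 * n) a) (VV (2 * n) a) \<noteq> None" using watch(2)[OF a True] ex by blast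
      then obtain d where d: "arrive (om (2 * n) a) (VV (2 * n) a) = Some d" by blast
      obtain b where b: "b \<in> H" "Y n b \<noteq> z" "Y (2 * n) b = z" "hdg a d = opposite (hh b)"
        using watch(1)[OF a True d] by blast
      have "hdg a d = hh c" using opp[OF b(1-3)] b(4) by simp
      then show ?thesis using finB_eq[OF a] True d y by auto
    next
      case False
      show ?thesis
      proof (cases "Y (2 * n) a = z")
        case True
        have "hdg a (opp (plus a)) = hh c" using opp[OF a False True] hdg_plus[OF a] by simp
        then show ?thesis using finB_eq[OF a] False True by auto
      next
        case F: False
        have "hdg a (plus a) = hh c" using grouped_B(2)[OF a c(1) F c(2)] hdg_plus[OF a] by simp
        moreover have "tot (VV (2 * n) a) < tot (VV n a)" using count[OF a F] ex by blast
        ultimately show ?thesis using finB_eq[OF a] False F by auto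
      qed
    qed
    then show ?thesis by blast
  qed
qed

end

lemma coord_if:
  assumes "z < n" "v < n"
  shows "coord n z Clockwise v = (if z \<le> v then v - z else v + n - z)"
    "coord n z Counterclockwise v = (if v \<le> z then z - v else z + n - v)"
proof -
  have e: "(int x - int y) mod int n = (if y \<le> x then int x - int y else int x - int y + int n)"
    if "x < n" "y < n" for x y
  proof (cases "y \<le> x")
    case False
    have "(int x - int y) mod int n = (int x - int y + int n) mod int n" by simp
    also have "\<dots> = int x - int y + int n" by (rule mod_pos_pos_trivial) (use that False in auto)
    finally show ?thesis using False by simp
  qed (use that in simp)
  show "coord n z Clockwise v = (if z \<le> v then v - z else v + n - z)"
    using assms e[of v z] by (auto simp: coord_def)
  show "coord n z Counterclockwise v = (if v \<le> z then z - v else z + n - v)"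
    using assms e[of z v] by (auto simp: coord_def)
qed

text \<open>The last hypothesis says that \<open>v\<close> lies on the way from \<open>z\<close> to
  \<open>x\<close> with heading \<open>F\<close>, so cutting the ring at \<open>z\<close> puts it
  below \<open>x\<close>. In the mirror image \<open>coord_after\<close> the node \<open>z\<close>
  is the upper end \<open>n\<close>.\<close>

lemma coord_before:
  assumes "z < n" "x < n" "v < n" "v \<noteq> x" "z \<noteq> x"
    and "coord n x (opposite F) v \<le> coord n x (opposite F) z"
  shows "coord n z F v < coord n z F x"
  using assms by (cases F) (auto simp: coord_if split: if_splits)

lemma coord_after:
  assumes "z < n" "x < n" "v < n" "v \<noteq> x" "z \<noteq> x"
    and "coord n x F v \<le> coord n x F z"
  shows "coord n z F x < (if v = z then n else coord n z F v)"
  using assms by (cases F) (auto simp: coord_if split: if_splits)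

section \<open>Separation into a lower and an upper group\<close>

context elude
begin

text \<open>The outcome required of the three stages. The node \<open>z\<close> is both ends of the
  cut ring: it is \<open>0\<close> for the lower group and \<open>n\<close> for the upper
  one.\<close>

definition split_by :: "heading \<Rightarrow> (nat \<Rightarrow> bool) \<Rightarrow> bool" where
  "split_by F low \<longleftrightarrow> (\<forall>a\<in>H. \<exists>d. fin (up (3 * n) a) = Some (low a, d) \<and> hdg a d = F)
    \<and> (\<exists>a. a \<in> H \<and> low a) \<and> (\<exists>a. a \<in> H \<and> \<not> low a)
    \<and> (\<forall>a\<in>H. \<forall>b\<in>H. low a = low b \<longrightarrow> Y (3 * n) a = Y (3 * n) b)
    \<and> (\<forall>a\<in>H. \<forall>b\<in>H. low a \<longrightarrow> \<not> low b \<longrightarrow>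
        coord n z F (Y (3 * n) a) < (if Y (3 * n) b = z then n else coord n z F (Y (3 * n) b)))"

lemma push_C:
  assumes "2 * n \<le> \<tau>" "\<tau> < 3 * n" "a \<in> H"
  shows "push \<tau> a = (if fin (up (2 * n) a) \<noteq> None \<or> Y n a \<noteq> z
      \<or> 2 * n < \<tau> \<and> (\<exists>b\<in>H. b \<noteq> a \<and> Y \<tau> b = Y \<tau> a \<and> U \<tau> b = AtNode) then None else Some (hh a))"
proof -
  have o: "on \<tau>" using on_early assms by simp
  have b: "(\<exists>b\<in>H. b \<noteq> a \<and> Y \<tau> b = Y \<tau> a \<and> U \<tau> b = AtNode) \<longleftrightarrow> 0 < others (VV \<tau> a) AtNode"
    using others_pos[OF assms(3), of "prot n" "T1 + \<tau>" AtNode] by simp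
  show ?thesis
    unfolding b using assms up_const[OF o assms(3)] hdg_plus[OF assms(3)] vr_up[OF _ o assms(3)]
      stageC_fields[OF assms] by (simp add: push_def push2_def)
qed

lemma fin_3n: "a \<in> H \<Longrightarrow> fin (up (3 * n) a) = finC (om (3 * n) a) (VV (3 * n) a)"
  using fin_search[OF order_refl on_early] by simp

text \<open>After an arrival in the second stage nobody moves in the third. The upper group is at
  \<open>z\<close>, that is at \<open>n\<close>, so it is above the lower one wherever that
  is.\<close>

lemma known_side:
  assumes "\<exists>b\<in>H. Y n b \<noteq> z \<and> Y (2 * n) b = z"
  shows "\<exists>F low. split_by F low"
proof -
  obtain F where F: "\<forall>a\<in>H. \<exists>d. fin (up (2 * n) a) = Some (Y (2 * n) a \<noteq> z, d) \<and> hdg a d = F"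
    using stage_B_outcome(1)[OF assms] by blast
  have st: "Y (2 * n + j) a = Y (2 * n) a" if "j \<le> n" "a \<in> H" for j a
    using that(1)
  proof (induction j)
    case (Suc j)
    have "push (2 * n + j) a = None" using push_C[of "2 * n + j" a] Suc.prems that(2) F by auto
    moreover have "on (Suc (2 * n + j))" using on_early[of "Suc (2 * n + j)"] Suc.prems by simp
    ultimately show ?case using move(1)[of "2 * n + j" a] that(2) Suc by simp
  qed simp
  have y: "Y (3 * n) a = Y (2 * n) a" if "a \<in> H" for a
    using st[of n a] that by (simp add: mult.commute)
  have f: "\<exists>d. fin (up (3 * n) a) = Some (Y (2 * n) a \<noteq> z, d) \<and> hdg a d = F" if a: "a \<in> H" for a
  proof -
    obtain d where d: "fin (up (2 * n) a) = Some (Y (2 * n) a \<noteq> z, d)" "hdg a d = F" using F a by blast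
    have "fin (up (3 * n) a) = fin (up (2 * n) a)"
      unfolding fin_3n[OF a] using om_3n[OF a] d by (simp add: finC_def)
    then show ?thesis using d by auto
  qed
  have "split_by F (\<lambda>a. Y (2 * n) a \<noteq> z)"
    unfolding split_by_def
  proof (intro conjI ballI impI)
    fix a assume a: "a \<in> H"
    show "\<exists>d. fin (up (3 * n) a) = Some (Y (2 * n) a \<noteq> z, d) \<and> hdg a d = F" using f[OF a] .
    fix b assume b: "b \<in> H"
    show "Y (3 * n) a = Y (3 * n) b" if "(Y (2 * n) a \<noteq> z) = (Y (2 * n) b \<noteq> z)"
      using that grouped_B(1)[OF a b] unfolding y[OF a] y[OF b] by auto
    show "coord n z F (Y (3 * n) a) < (if Y (3 * n) b = z then n else coord n z F (Y (3 * n) b))"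
      if "\<not> Y (2 * n) b \<noteq> z" using that coord_less[OF n0] unfolding y[OF b] by simp
  next
    show "\<exists>a. a \<in> H \<and> Y (2 * n) a \<noteq> z" by (rule walker_B)
    show "\<exists>a. a \<in> H \<and> \<not> Y (2 * n) a \<noteq> z" using assms by blast
  qed
  then show ?thesis by blast
qed

end

text \<open>The case without arrivals in the second stage: the agents not at \<open>z\<close> are
  then together with one heading, and wait at \<open>w\<close>.\<close>

locale calm = elude +
  assumes quiet: "\<not> (\<exists>b\<in>H. Y n b \<noteq> z \<and> Y (2 * n) b = z)"
begin

definition w :: nat where
  "w = Y (2 * n) (SOME a. a \<in> H \<and> Y n a \<noteq> z)"

lemma walkers: "a \<in> H \<Longrightarrow> Y n a \<noteq> z \<Longrightarrow> Y (2 * n) a = w"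
proof -
  assume a: "a \<in> H" "Y n a \<noteq> z"
  define c where "c = (SOME a. a \<in> H \<and> Y n a \<noteq> z)"
  have c: "c \<in> H \<and> Y n c \<noteq> z" unfolding c_def by (rule someI_ex[OF walker])
  show ?thesis using grouped_B(1)[OF a(1), of c] a c quiet unfolding w_def c_def[symmetric] by blast
qed

lemma w_neq: "w \<noteq> z"
proof -
  obtain a where "a \<in> H" "Y n a \<noteq> z" using walker by blast
  then show ?thesis using walkers quiet by metis
qed

lemma w_less: "w < n"
  unfolding w_def using someI_ex[OF walker] Y_less by blast

lemma none: "a \<in> H \<Longrightarrow> fin (up (2 * n) a) = None"
  using stage_B_outcome(2)[OF quiet] by blast

lemma walkers_stay: "a \<in> H \<Longrightarrow> Y n a \<noteq> z \<Longrightarrow> j \<le> n \<Longrightarrow> Y (2 * n + j) a = w \<and> (0 < j \<longrightarrow> U (2 * n + j) a = AtNode)"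
proof (induction j)
  case 0
  then show ?case using walkers by simp
next
  case (Suc j)
  have "push (2 * n + j) a = None" using push_C[of "2 * n + j" a] Suc.prems by simp
  moreover have "on (Suc (2 * n + j))" using on_early[of "Suc (2 * n + j)"] Suc.prems by simp
  ultimately show ?case using move(1)[of "2 * n + j" a] Suc by simp
qed

text \<open>An agent at the node proper did not push in the last round, hence is at
  \<open>w\<close>. This is how an agent that does not know \<open>w\<close> recognises that it has
  arrived.\<close>

lemma beside:
  assumes j: "j < n" and p: "\<forall>b\<in>H. Y n b = z \<longrightarrow> push (2 * n + j) b = (if Y (2 * n + j) b = w then None else Some (hh b))"
    and a: "a \<in> H" "Y n a = z"
  shows "(\<exists>b\<in>H. b \<noteq> a \<and> Y (2 * n + Suc j) b = Y (2 * n + Suc j) a \<and> U (2 * n + Suc j) b = AtNode)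
    \<longleftrightarrow> Y (2 * n + Suc j) a = w"
proof
  have o: "on (Suc (2 * n + j))" using on_early[of "Suc (2 * n + j)"] j by simp
  assume "\<exists>b\<in>H. b \<noteq> a \<and> Y (2 * n + Suc j) b = Y (2 * n + Suc j) a \<and> U (2 * n + Suc j) b = AtNode"
  then obtain b where b: "b \<in> H" "Y (2 * n + Suc j) b = Y (2 * n + Suc j) a" "U (2 * n + Suc j) b = AtNode"
    by blast
  have "Y (2 * n + Suc j) b = w"
  proof (cases "Y n b = z")
    case True
    have q: "push (2 * n + j) b = (if Y (2 * n + j) b = w then None else Some (hh b))"
      using p b(1) True by blast
    have "Y (2 * n + j) b = w"
    proof (rule ccontr)
      assume "Y (2 * n + j) b \<noteq> w"
      then have "push (2 * n + j) b = Some (hh b)" using q by simp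
      from move(3)[OF o b(1) this] b(3) show False by (simp split: if_splits)
    qed
    then show ?thesis using move(1)[OF o b(1)] q by simp
  next
    case False
    then show ?thesis using walkers_stay[OF b(1) False, of "Suc j"] j by simp
  qed
  then show "Y (2 * n + Suc j) a = w" using b(2) by simp
next
  assume y: "Y (2 * n + Suc j) a = w"
  obtain b where b: "b \<in> H" "Y n b \<noteq> z" using walker by blast
  have "b \<noteq> a" using b(2) a(2) by blast
  then show "\<exists>b\<in>H. b \<noteq> a \<and> Y (2 * n + Suc j) b = Y (2 * n + Suc j) a \<and> U (2 * n + Suc j) b = AtNode"
    using walkers_stay[OF b, of "Suc j"] j b(1) unfolding y by auto
qed

text \<open>Induction over the rounds: \<open>beside\<close> justifies the stopping rule of a round
  by the rule of the round before.\<close>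

lemma push_waiter:
  "j < n \<Longrightarrow> \<forall>a\<in>H. Y n a = z \<longrightarrow>
    push (2 * n + j) a = (if Y (2 * n + j) a = w then None else Some (hh a))"
proof (induction j)
  case 0
  then show ?case using push_C[of "2 * n"] none waiter_B w_neq n0 by simp
next
  case (Suc j)
  show ?case
  proof (intro ballI impI)
    fix a assume a: "a \<in> H" "Y n a = z"
    have "2 * n \<le> 2 * n + Suc j" "2 * n + Suc j < 3 * n" "2 * n < 2 * n + Suc j" using Suc.prems by auto
    then show "push (2 * n + Suc j) a = (if Y (2 * n + Suc j) a = w then None else Some (hh a))"
      using push_C[of "2 * n + Suc j" a] none[OF a(1)] a beside[of j a] Suc by simp
  qed
qed

lemma stage_C: "sweep S n H (2 * n) w hh"
proof unfold_locales
  show "w < n" by (rule w_less)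
  show "on (2 * n + n)" using on_early[of "2 * n + n"] by simp
  have p: "push \<tau> a = (if Y \<tau> a = w then None else Some (hh a))"
    if t: "2 * n \<le> \<tau>" "\<tau> < 2 * n + n" and a: "a \<in> H" for \<tau> a
  proof -
    have e: "2 * n + (\<tau> - 2 * n) = \<tau>" and l: "\<tau> - 2 * n < n" using t by auto
    show ?thesis
    proof (cases "Y n a = z")
      case True
      have "push (2 * n + (\<tau> - 2 * n)) a = (if Y (2 * n + (\<tau> - 2 * n)) a = w then None else Some (hh a))"
        using push_waiter[OF l] a True by blast
      then show ?thesis unfolding e .
    next
      case False
      have "Y \<tau> a = w" using walkers_stay[OF a False less_imp_le[OF l]] unfolding e by simp
      moreover have "push \<tau> a = None" using push_C[of \<tau> a] t a False by simp
      ultimately show ?thesis by simp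
    qed
  qed
  fix a assume a: "a \<in> H"
  show "push \<tau> a = None" if "2 * n \<le> \<tau>" "\<tau> < 2 * n + n" "Y \<tau> a = w" for \<tau>
    using p[OF that(1,2) a] that(3) by simp
  show "push \<tau> a = Some (hh a)" if "2 * n \<le> \<tau>" "\<tau> < 2 * n + n" "Y \<tau> a \<noteq> w" for \<tau>
    using p[OF that(1,2) a] that(3) by simp
  fix b assume b: "b \<in> H" "Y (2 * n) a \<noteq> w" "Y (2 * n) b \<noteq> w"
  have y: "Y (2 * n) a = z" "Y (2 * n) b = z"
    using a b walkers[of a] walkers[of b] waiter_B[of a] waiter_B[of b] by blast+
  show "Y (2 * n) a = Y (2 * n) b \<and> hh a = hh b
    \<or> coord n w (opposite (hh a)) (Y (2 * n) a) + coord n w (opposite (hh b)) (Y (2 * n) b) \<le> n"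
    unfolding y using together_pairs[OF w_less z_less w_neq[symmetric], of "hh a" "hh b"] by simp
qed


lemma beside_3n:
  assumes "a \<in> H" "Y n a = z"
  shows "(\<exists>b\<in>H. b \<noteq> a \<and> Y (3 * n) b = Y (3 * n) a \<and> U (3 * n) b = AtNode) \<longleftrightarrow> Y (3 * n) a = w"
proof -
  obtain j where j: "n = Suc j" using n0 by (cases n) auto
  have e: "2 * n + Suc j = 3 * n" and l: "j < n" using j by simp_all
  show ?thesis using beside[OF l push_waiter[OF l] assms] unfolding e .
qed

lemma finC_eq:
  assumes a: "a \<in> H"
  shows "Y n a = z \<Longrightarrow> fin (up (3 * n) a) =
      (if Y (3 * n) a = w then Some (False, opp (plus a))
       else if tot (VV (3 * n) a) < tot (VV (2 * n) a) then Some (True, plus a)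
       else if symm n R then Some (False, opp (plus a)) else Some (True, plus a))"
    "Y n a \<noteq> z \<Longrightarrow> fin (up (3 * n) a) = (case arrive (om (3 * n) a) (VV (3 * n) a) of
       Some s \<Rightarrow> Some (False, s) | None \<Rightarrow> if symm n R then Some (True, plus a) else Some (False, plus a))"
proof -
  have o: "on (3 * n)" using on_early by simp
  have b: "(\<exists>b\<in>H. b \<noteq> a \<and> Y (3 * n) b = Y (3 * n) a \<and> U (3 * n) b = AtNode) \<longleftrightarrow> 0 < others (VV (3 * n) a) AtNode"
    using others_pos[OF a, of "prot n" "T1 + 3 * n" AtNode] by simp
  have v: "vr (om (3 * n) a) = (Y n a = z)" using vr_om[OF _ o a] n0 by simp
  have c: "fin (om (3 * n) a) = None" "c0 (om (3 * n) a) = tot (VV (2 * n) a)"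
    "ps (om (3 * n) a) = plus a" "sy (om (3 * n) a) = symm n R"
    using om_3n[OF a] none[OF a] om_const[OF o a] by auto
  show "fin (up (3 * n) a) =
      (if Y (3 * n) a = w then Some (False, opp (plus a))
       else if tot (VV (3 * n) a) < tot (VV (2 * n) a) then Some (True, plus a)
       else if symm n R then Some (False, opp (plus a)) else Some (True, plus a))" if y: "Y n a = z"
    using beside_3n[OF a y] y unfolding fin_3n[OF a] finC_def b c v option.case by simp
  show "fin (up (3 * n) a) = (case arrive (om (3 * n) a) (VV (3 * n) a) of
       Some s \<Rightarrow> Some (False, s) | None \<Rightarrow> if symm n R then Some (True, plus a) else Some (False, plus a))"
    if y: "Y n a \<noteq> z"
    using y unfolding fin_3n[OF a] finC_def c v option.case by simp
qed

lemma walkers_3n: "a \<in> H \<Longrightarrow> Y n a \<noteq> z \<Longrightarrow> Y (3 * n) a = w"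
  using walkers_stay[of a n] by (simp add: mult.commute)

lemma laggard: "\<exists>a. a \<in> H \<and> Y (3 * n) a \<noteq> w"
  using apart[of "3 * n" w] on_early[of "3 * n"] bound[of "3 * n"] by auto

lemma laggard_waiter: "a \<in> H \<Longrightarrow> Y (3 * n) a \<noteq> w \<Longrightarrow> Y n a = z \<and> Y (2 * n) a = z"
  using walkers_3n waiter_B by blast

lemma waiter_2n: "a \<in> H \<Longrightarrow> Y (2 * n) a \<noteq> w \<longleftrightarrow> Y n a = z"
  using waiter_B[of a] walkers[of a] w_neq by (cases "Y n a = z") auto

lemma grouped_C:
  assumes "a \<in> H" "b \<in> H" "Y (3 * n) a \<noteq> w" "Y (3 * n) b \<noteq> w"
  shows "Y (3 * n) a = Y (3 * n) b" "hh a = hh b"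
proof -
  interpret C: sweep S n H "2 * n" w hh by (rule stage_C)
  have e: "2 * n + n = 3 * n" by simp
  show "Y (3 * n) a = Y (3 * n) b" "hh a = hh b"
    using C.merge[OF assms(1,2), unfolded e] assms(3,4) by blast+
qed

lemma laggard_rem:
  assumes "a \<in> H" "Y (3 * n) a \<noteq> w"
  shows "coord n w (opposite (hh a)) (Y (3 * n) a) \<le> coord n w (opposite (hh a)) z"
proof -
  interpret C: sweep S n H "2 * n" w hh by (rule stage_C)
  show ?thesis
    using C.rem_le[OF assms(1), of "3 * n"] laggard_waiter[OF assms] by (simp add: C.rem_def)
qed

text \<open>If somebody arrives, the reasoning of the second stage applies with \<open>w\<close> as
  target, and the agents still underway are below \<open>w\<close>. If nobody arrives, each group
  has a single heading. Without symmetry all agents share it; with symmetry both headings occur, so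
  the groups have opposite ones.\<close>

lemma stage_C_outcome: "\<exists>F low. split_by F low"
proof -
  interpret C: sweep S n H "2 * n" w hh by (rule stage_C)
  have e: "2 * n + n = 3 * n" by simp
  have o: "on (Suc (2 * n))" using on_early[of "Suc (2 * n)"] n0 by simp
  obtain c where c: "c \<in> H" "Y (3 * n) c \<noteq> w" using laggard by blast
  have zc: "Y n c = z" using laggard_waiter c by blast
  obtain g where g: "g \<in> H" "Y n g \<noteq> z" using walker by blast
  have watch:
    "\<And>d. arrive (om (3 * n) v) (VV (3 * n) v) = Some d \<Longrightarrow>
      \<exists>b\<in>H. Y n b = z \<and> Y (3 * n) b = w \<and> hdg v d = opposite (hh b)"
    "\<And>b. arrive (om (3 * n) v) (VV (3 * n) v) = None \<Longrightarrow> b \<in> H \<Longrightarrow> Y n b = z \<Longrightarrow> Y (3 * n) b \<noteq> w"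
    if v: "v \<in> H" "Y n v \<noteq> z" for v
  proof -
    have a0: "arr (om (Suc (2 * n)) v) = None" using om_Suc(3)[OF o v(1)] up_2n[OF v(1)] by simp
    have ar: "arr (up \<tau> v) = arrive (om \<tau> v) (VV \<tau> v)" if "2 * n < \<tau>" "\<tau> < 2 * n + n" for \<tau>
      using arr_up[of \<tau> v] that v by simp
    note wt = C.watch_end[OF v(1) walkers[OF v] a0 ar, unfolded e]
    show "\<And>d. arrive (om (3 * n) v) (VV (3 * n) v) = Some d \<Longrightarrow>
      \<exists>b\<in>H. Y n b = z \<and> Y (3 * n) b = w \<and> hdg v d = opposite (hh b)"
      using wt(1) waiter_2n by blast
    show "\<And>b. arrive (om (3 * n) v) (VV (3 * n) v) = None \<Longrightarrow> b \<in> H \<Longrightarrow> Y n b = z \<Longrightarrow> Y (3 * n) b \<noteq> w"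
      using wt(2) waiter_2n by blast
  qed
  have count: "tot (VV (3 * n) a) < tot (VV (2 * n) a) \<longleftrightarrow> (\<exists>b\<in>H. Y n b = z \<and> Y (3 * n) b = w)"
    if a: "a \<in> H" "Y (3 * n) a \<noteq> w" for a
  proof -
    have "\<forall>b\<in>H. Y (2 * n) b \<noteq> w \<longrightarrow> Y (2 * n) b = Y (2 * n) a"
      using laggard_waiter[OF a] waiter_2n waiter_B by simp
    then show ?thesis using C.companions[OF a(1), unfolded e] a(2) waiter_2n by blast
  qed
  have before: "coord n z (hh a) (Y (3 * n) a) < coord n z (hh a) w" if a: "a \<in> H" "Y (3 * n) a \<noteq> w" for a
    using coord_before[OF z_less w_less Y_less[OF a(1)] a(2) w_neq[symmetric] laggard_rem[OF a]] .
  show ?thesis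
  proof (cases "\<exists>b\<in>H. Y n b = z \<and> Y (3 * n) b = w")
    case True
    have opp: "opposite (hh b) = hh c" if b: "b \<in> H" "Y n b = z" "Y (3 * n) b = w" for b
      using C.reached_opposite[OF c(1) _ b(1), unfolded e] b c waiter_B[OF b(1,2)] waiter_B[OF c(1) zc] by simp
    have f: "\<exists>d. fin (up (3 * n) a) = Some (Y (3 * n) a \<noteq> w, d) \<and> hdg a d = hh c" if a: "a \<in> H" for a
    proof (cases "Y n a = z")
      case ya: True
      show ?thesis
      proof (cases "Y (3 * n) a = w")
        case True
        have "hdg a (opp (plus a)) = hh c" using opp[OF a ya True] hdg_plus[OF a] by simp
        then show ?thesis using finC_eq(1)[OF a ya] True by auto
      next
        case False
        have "hdg a (plus a) = hh c" using grouped_C(2)[OF a c(1) False c(2)] hdg_plus[OF a] by simp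
        moreover have "tot (VV (3 * n) a) < tot (VV (2 * n) a)" using count[OF a False] True by blast
        ultimately show ?thesis using finC_eq(1)[OF a ya] False by auto
      qed
    next
      case False
      have "arrive (om (3 * n) a) (VV (3 * n) a) \<noteq> None" using watch(2)[OF a False] True by blast
      then obtain d where d: "arrive (om (3 * n) a) (VV (3 * n) a) = Some d" by blast
      obtain b where b: "b \<in> H" "Y n b = z" "Y (3 * n) b = w" "hdg a d = opposite (hh b)"
        using watch(1)[OF a False d] by blast
      have "hdg a d = hh c" using opp[OF b(1-3)] b(4) by simp
      then show ?thesis using finC_eq(2)[OF a False] d walkers_3n[OF a False] by auto
    qed
    have "split_by (hh c) (\<lambda>a. Y (3 * n) a \<noteq> w)"
      unfolding split_by_def
    proof (intro conjI ballI impI)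
      fix a assume a: "a \<in> H"
      show "\<exists>d. fin (up (3 * n) a) = Some (Y (3 * n) a \<noteq> w, d) \<and> hdg a d = hh c" using f[OF a] .
      fix b assume b: "b \<in> H"
      show "Y (3 * n) a = Y (3 * n) b" if "(Y (3 * n) a \<noteq> w) = (Y (3 * n) b \<noteq> w)"
        using that grouped_C(1)[OF a b] by (cases "Y (3 * n) a = w") simp_all
      show "coord n z (hh c) (Y (3 * n) a) < (if Y (3 * n) b = z then n else coord n z (hh c) (Y (3 * n) b))"
        if l: "Y (3 * n) a \<noteq> w" "\<not> Y (3 * n) b \<noteq> w"
        using before[OF a l(1)] grouped_C(2)[OF a c(1) l(1) c(2)] l(2) w_neq by simp
    next
      show "\<exists>a. a \<in> H \<and> Y (3 * n) a \<noteq> w" by (rule laggard)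
      show "\<exists>a. a \<in> H \<and> \<not> Y (3 * n) a \<noteq> w" using walkers_3n g by blast
    qed
    then show ?thesis by blast
  next
    case False
    have lag: "Y (3 * n) a = w \<longleftrightarrow> Y n a \<noteq> z" if "a \<in> H" for a
      using False walkers_3n that by blast
    have idle: "arrive (om (3 * n) a) (VV (3 * n) a) = None" if a: "a \<in> H" "Y n a \<noteq> z" for a
    proof (cases "arrive (om (3 * n) a) (VV (3 * n) a)")
      case (Some d)
      then show ?thesis using watch(1)[OF a] False by blast
    qed
    have hg: "hh a = hh g" if a: "a \<in> H" "Y n a \<noteq> z" for a
      using grouped_B(2)[OF a(1) g(1)] quiet a g by blast
    have hc: "hh a = hh c" if a: "a \<in> H" "Y n a = z" for a
      using grouped_C(2)[OF a(1) c(1) _ c(2)] lag[OF a(1)] a(2) by blast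
    have fz: "fin (up (3 * n) a) = (if symm n R then Some (False, opp (plus a)) else Some (True, plus a))"
      if a: "a \<in> H" "Y n a = z" for a
    proof -
      have "Y (3 * n) a \<noteq> w" using lag a by blast
      then show ?thesis using finC_eq(1)[OF a] count[OF a(1)] False by auto
    qed
    have fw: "fin (up (3 * n) a) = (if symm n R then Some (True, plus a) else Some (False, plus a))"
      if a: "a \<in> H" "Y n a \<noteq> z" for a
      using finC_eq(2)[OF a] idle[OF a] by simp
    show ?thesis
    proof (cases "symm n R")
      case True
      have "c \<noteq> g" using zc g by blast
      then have "2 \<le> card H" using c(1) g(1) card_mono[OF fin_H, of "{c, g}"] by simp
      then obtain a b where ab: "a \<in> H" "b \<in> H" "hh a \<noteq> hh b" using both_types[OF True] by blast
      \<comment> \<open>Equal headings of the two groups would leave one heading for all agents,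
        contrary to \<open>both_types\<close>.\<close>
      have "hh c \<noteq> hh g" using ab hg[OF ab(1)] hg[OF ab(2)] hc[OF ab(1)] hc[OF ab(2)] by metis
      then have cg: "hh g = opposite (hh c)" using heading_neq by metis
      have "split_by (hh g) (\<lambda>a. Y n a \<noteq> z)"
        unfolding split_by_def
      proof (intro conjI ballI impI)
        fix a assume a: "a \<in> H"
        show "\<exists>d. fin (up (3 * n) a) = Some (Y n a \<noteq> z, d) \<and> hdg a d = hh g"
        proof (cases "Y n a = z")
          case y: True
          then show ?thesis using fz[OF a y] True hdg_plus[OF a] hc[OF a y] cg by simp
        next
          case y: False
          then show ?thesis using fw[OF a y] True hdg_plus[OF a] hg[OF a y] by simp
        qed
        fix b assume b: "b \<in> H"
        show "Y (3 * n) a = Y (3 * n) b" if "(Y n a \<noteq> z) = (Y n b \<noteq> z)"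
          using that grouped_C(1)[OF a b] lag[OF a] lag[OF b] by metis
        show "coord n z (hh g) (Y (3 * n) a) < (if Y (3 * n) b = z then n else coord n z (hh g) (Y (3 * n) b))"
          if l: "Y n a \<noteq> z" "\<not> Y n b \<noteq> z"
        proof -
          have ya: "Y (3 * n) a = w" and yb: "Y (3 * n) b \<noteq> w" using lag[OF a] lag[OF b] l by blast+
          \<comment> \<open>The agents from \<open>z\<close> walk against the common orientation
            here, so they are between the upper end and \<open>w\<close>.\<close>
          have "coord n w (hh g) (Y (3 * n) b) \<le> coord n w (hh g) z"
            using laggard_rem[OF b yb] hc[OF b] l cg by simp
          from coord_after[OF z_less w_less Y_less[OF b] yb w_neq[symmetric] this]
          show ?thesis unfolding ya .
        qed
      next
        show "\<exists>a. a \<in> H \<and> Y n a \<noteq> z" by (rule walker)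
        show "\<exists>a. a \<in> H \<and> \<not> Y n a \<noteq> z" using waiter by blast
      qed
      then show ?thesis by blast
    next
      case False
      have same: "hh a = hh c" if "a \<in> H" for a using same_types[OF False that c(1)] .
      have "split_by (hh c) (\<lambda>a. Y n a = z)"
        unfolding split_by_def
      proof (intro conjI ballI impI)
        fix a assume a: "a \<in> H"
        show "\<exists>d. fin (up (3 * n) a) = Some (Y n a = z, d) \<and> hdg a d = hh c"
          using fz[OF a] fw[OF a] False hdg_plus[OF a] same[OF a] by (cases "Y n a = z") simp_all
        fix b assume b: "b \<in> H"
        show "Y (3 * n) a = Y (3 * n) b" if "(Y n a = z) = (Y n b = z)"
          using that grouped_C(1)[OF a b] lag[OF a] lag[OF b] by metis
        show "coord n z (hh c) (Y (3 * n) a) < (if Y (3 * n) b = z then n else coord n z (hh c) (Y (3 * n) b))"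
          if l: "Y n a = z" "\<not> Y n b = z"
        proof -
          have ya: "Y (3 * n) a \<noteq> w" and yb: "Y (3 * n) b = w" using lag[OF a] lag[OF b] l by blast+
          show ?thesis using before[OF a ya] same[OF a] w_neq unfolding yb by simp
        qed
      next
        show "\<exists>a. a \<in> H \<and> Y n a = z" by (rule waiter)
        show "\<exists>a. a \<in> H \<and> \<not> Y n a = z" by (rule walker)
      qed
      then show ?thesis by blast
    qed
  qed
qed

end

lemma (in elude) split: "\<exists>F low. split_by F low"
proof (cases "\<exists>b\<in>H. Y n b \<noteq> z \<and> Y (2 * n) b = z")
  case True
  then show ?thesis by (rule known_side)
next
  case False
  then interpret calm S n H by unfold_locales
  show ?thesis by (rule stage_C_outcome)
qed

section \<open>Final phases on the cut ring\<close>

locale seek = elude +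
  fixes F :: heading and low :: "nat \<Rightarrow> bool" and l u :: nat
  assumes split_F: "split_by F low" and l: "l \<in> H" "low l" and u: "u \<in> H" "\<not> low u"
begin

definition y :: "nat \<Rightarrow> nat \<Rightarrow> nat" where
  "y \<tau> a = (if \<not> low a \<and> Y \<tau> a = z then n else coord n z F (Y \<tau> a))"

lemma settled:
  assumes "on \<tau>" "3 * n \<le> \<tau>" "a \<in> H"
  obtains d where "fin (up \<tau> a) = Some (low a, d)" "hdg a d = F"
proof -
  have "\<forall>a\<in>H. \<exists>d. fin (up (3 * n) a) = Some (low a, d) \<and> hdg a d = F"
    using split_F unfolding split_by_def by (rule conjunct1)
  then obtain d where "fin (up (3 * n) a) = Some (low a, d)" "hdg a d = F" using assms(3) by blast
  then show ?thesis using that fin_search[OF assms(2,1,3)] fin_3n[OF assms(3)] by simp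
qed

lemma yc_up:
  assumes "on \<tau>" "3 * n \<le> \<tau>" "a \<in> H"
  shows "yc n (up \<tau> a) = y \<tau> a"
proof -
  obtain d where d: "fin (up \<tau> a) = Some (low a, d)" "hdg a d = F" using settled[OF assms] .
  have e: "(if d = plus a then coord n z (hh a) (Y \<tau> a) else (n - coord n z (hh a) (Y \<tau> a)) mod n)
    = coord n z F (Y \<tau> a)"
  proof (cases "d = plus a")
    case True
    then show ?thesis using hdg_plus[OF assms(3)] d(2) by simp
  next
    case False
    then have "plus a = opp d" using side_neq by blast
    then have "F = opposite (hh a)" using d(2) assms(3) by (simp add: hh_def)
    then show ?thesis using coord_opposite[OF n0, of z "hh a" "Y \<tau> a"] False by simp
  qed
  have s: "snd (the (fin (up \<tau> a))) = d" using d(1) by simp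
  have c: "(if snd (the (fin (up \<tau> a))) = ps (up \<tau> a) then xc (up \<tau> a) else (n - xc (up \<tau> a)) mod n)
    = coord n z F (Y \<tau> a)"
    unfolding s up_const(2,5)[OF assms(1,3)] by (rule e)
  have f: "fst (the (fin (up \<tau> a))) = low a" using d(1) by simp
  show ?thesis
    unfolding yc_def y_def Let_def c f using z_coord[OF assms(3), of F \<tau>] by simp
qed

lemma push_S:
  assumes "on \<tau>" "3 * n \<le> \<tau>" "a \<in> H"
  shows "push \<tau> a = (if low a then if y \<tau> a < \<tau> div n - 2 then Some F else None
    else if \<tau> div n - 2 < y \<tau> a then Some (opposite F) else None)"
proof -
  obtain d where d: "fin (up \<tau> a) = Some (low a, d)" "hdg a d = F" using settled[OF assms] .
  show ?thesis
    using d assms(2,3) up_const[OF assms(1,3)] yc_up[OF assms] n0 by (simp add: push_def push2_def)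
qed

lemma stop_S:
  assumes "on \<tau>" "3 * n \<le> \<tau>" "a \<in> H"
  shows "stop2 n (up \<tau> a) \<longleftrightarrow> 4 * n \<le> \<tau> \<and> \<tau> mod n = 0
    \<and> (if low a then y \<tau> a < \<tau> div n - 3 else y \<tau> a \<le> \<tau> div n - 3)"
proof -
  obtain d where d: "fin (up \<tau> a) = Some (low a, d)" "hdg a d = F" using settled[OF assms] .
  show ?thesis
    using d up_const[OF assms(1,3)] yc_up[OF assms] by (simp add: stop2_def)
qed

definition two :: "nat \<Rightarrow> bool" where
  "two \<tau> \<longleftrightarrow> (\<forall>a\<in>H. \<forall>b\<in>H. low a = low b \<longrightarrow> Y \<tau> a = Y \<tau> b)"

lemma y_two:
  assumes "two \<tau>" "a \<in> H"
  shows "Y \<tau> a = (if low a then Y \<tau> l else Y \<tau> u)" "y \<tau> a = (if low a then y \<tau> l else y \<tau> u)"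
proof -
  show e: "Y \<tau> a = (if low a then Y \<tau> l else Y \<tau> u)"
  proof (cases "low a")
    case True
    then have "Y \<tau> a = Y \<tau> l" using assms l unfolding two_def by blast
    then show ?thesis using True by simp
  next
    case False
    then have "Y \<tau> a = Y \<tau> u" using assms u unfolding two_def by blast
    then show ?thesis using False by simp
  qed
  show "y \<tau> a = (if low a then y \<tau> l else y \<tau> u)"
    unfolding y_def e using l u by simp
qed

lemma y_apart:
  assumes "two \<tau>" "on \<tau>" "\<tau> \<le> (n + 3) * n"
  shows "y \<tau> l \<noteq> y \<tau> u"
proof
  assume e: "y \<tau> l = y \<tau> u"
  have "y \<tau> l < n" using l coord_less[OF n0] by (simp add: y_def)
  then have "coord n z F (Y \<tau> l) = coord n z F (Y \<tau> u)"
    using e l u by (simp add: y_def split: if_splits)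
  then have "Y \<tau> l = Y \<tau> u" by (rule coord_inj[OF Y_less[OF l(1)] Y_less[OF u(1)]])
  then have "\<forall>a\<in>H. Y \<tau> a = Y \<tau> u" using y_two(1)[OF assms(1)] by simp
  then show False using apart[OF assms(2,3)] by blast
qed

lemma y_u: "coord n z F (Y \<tau> u) = y \<tau> u mod n" "y \<tau> u \<le> n" "0 < y \<tau> u"
  using u coord_less[OF n0, of z F "Y \<tau> u"] z_coord[OF u(1), of F \<tau>] n0 by (auto simp: y_def)

lemma y_l: "coord n z F (Y \<tau> l) = y \<tau> l" "y \<tau> l < n"
  using l coord_less[OF n0, of z F "Y \<tau> l"] by (auto simp: y_def)

lemma two_Suc:
  assumes "two \<tau>" "on (Suc \<tau>)" "3 * n \<le> \<tau>"
  shows "two (Suc \<tau>)"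
  unfolding two_def
proof (intro ballI impI)
  fix a b assume ab: "a \<in> H" "b \<in> H" "low a = low b"
  have o: "on \<tau>" using assms(2) on_Suc_D by blast
  have e: "Y \<tau> a = Y \<tau> b" using assms(1) ab unfolding two_def by blast
  have "y \<tau> a = y \<tau> b" using e ab(3) by (simp add: y_def)
  then have p: "push \<tau> a = push \<tau> b"
    unfolding push_S[OF o assms(3) ab(1)] push_S[OF o assms(3) ab(2)] using ab(3) by simp
  show "Y (Suc \<tau>) a = Y (Suc \<tau>) b"
    using on_Suc(3)[OF assms(2) ab(1)] on_Suc(3)[OF assms(2) ab(2)] unfolding e p by (metis prod.inject)
qed

text \<open>The value \<open>m mod n\<close> provides for the last phase, in which a step from
  \<open>n - 1\<close> leads to \<open>z\<close>; \<open>round_S\<close> shows that the groups would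
  then have met.\<close>

lemma low_step:
  assumes o: "on (Suc \<tau>)" and t: "3 * n \<le> \<tau>" "\<tau> div n = m + 2" and m: "m \<le> Suc (y \<tau> l)"
  shows "m \<le> y \<tau> l \<Longrightarrow> y (Suc \<tau>) l = y \<tau> l"
    "y \<tau> l < m \<Longrightarrow> halted \<tau> l \<Longrightarrow> y (Suc \<tau>) l = y \<tau> l"
    "y \<tau> l < m \<Longrightarrow> \<not> halted \<tau> l \<Longrightarrow> y (Suc \<tau>) l = m mod n"
proof -
  have p: "push \<tau> l = (if y \<tau> l < m then Some F else None)"
    using push_S[OF on_Suc_D[OF o] t(1) l(1)] l(2) t(2) by simp
  show "y (Suc \<tau>) l = y \<tau> l" if "m \<le> y \<tau> l"
    using move(1)[OF o l(1)] p that by (simp add: y_def)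
  show "y (Suc \<tau>) l = y \<tau> l" if "y \<tau> l < m" "halted \<tau> l"
    using move(2)[OF o l(1), of F] p that by (simp add: y_def)
  show "y (Suc \<tau>) l = m mod n" if q: "y \<tau> l < m" "\<not> halted \<tau> l"
  proof -
    have "Y (Suc \<tau>) l = neighbour n (Y \<tau> l) F" using move(2)[OF o l(1), of F] p q by simp
    then have "y (Suc \<tau>) l = (y \<tau> l + 1) mod n"
      using coord_neighbour(1)[OF n0, of z F "Y \<tau> l"] y_l(1)[of "Suc \<tau>"] y_l(1)[of \<tau>] by simp
    moreover have "y \<tau> l + 1 = m" using q(1) m by simp
    ultimately show ?thesis by simp
  qed
qed

lemma high_step:
  assumes o: "on (Suc \<tau>)" and t: "3 * n \<le> \<tau>" "\<tau> div n = m + 2" and m: "0 < m"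
  shows "y \<tau> u \<le> m \<Longrightarrow> Y (Suc \<tau>) u = Y \<tau> u \<and> y (Suc \<tau>) u = y \<tau> u"
    "m < y \<tau> u \<Longrightarrow> halted \<tau> u \<Longrightarrow> y (Suc \<tau>) u = y \<tau> u"
    "m < y \<tau> u \<Longrightarrow> \<not> halted \<tau> u \<Longrightarrow> Suc (y (Suc \<tau>) u) = y \<tau> u"
proof -
  have p: "push \<tau> u = (if m < y \<tau> u then Some (opposite F) else None)"
    using push_S[OF on_Suc_D[OF o] t(1) u(1)] u(2) t(2) by simp
  show "Y (Suc \<tau>) u = Y \<tau> u \<and> y (Suc \<tau>) u = y \<tau> u" if "y \<tau> u \<le> m"
    using move(1)[OF o u(1)] p that by (simp add: y_def)
  show "y (Suc \<tau>) u = y \<tau> u" if "m < y \<tau> u" "halted \<tau> u"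
    using move(2)[OF o u(1), of "opposite F"] p that by (simp add: y_def)
  show "Suc (y (Suc \<tau>) u) = y \<tau> u" if q: "m < y \<tau> u" "\<not> halted \<tau> u"
  proof -
    have "Y (Suc \<tau>) u = neighbour n (Y \<tau> u) (opposite F)"
      using move(2)[OF o u(1), of "opposite F"] p q by simp
    then have c: "coord n z F (Y (Suc \<tau>) u) = (y \<tau> u mod n + n - 1) mod n"
      using coord_neighbour(2)[OF n0, of z F "Y \<tau> u"] y_u(1)[of \<tau>] by simp
    have "(y \<tau> u mod n + n - 1) mod n = y \<tau> u - 1"
      using mod_pred[of "y \<tau> u mod n" n] y_u(2)[of \<tau>] m q(1) n0 by (cases "y \<tau> u = n") auto
    then have "coord n z F (Y (Suc \<tau>) u) = y \<tau> u - 1" "y \<tau> u - 1 \<noteq> 0" using c m q(1) by auto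
    then have "y (Suc \<tau>) u = y \<tau> u - 1" using z_coord[OF u(1), of F "Suc \<tau>"] by (auto simp: y_def)
    then show ?thesis using q(1) by simp
  qed
qed

text \<open>An edge blocking both groups would join \<open>m - 1\<close> to the node of the upper
  group, which would then be at \<open>m\<close> and not above it.\<close>

lemma not_both_halted:
  assumes o: "on \<tau>" and t: "3 * n \<le> \<tau>" "\<tau> div n = m + 2"
    and "Suc (y \<tau> l) = m" "m < y \<tau> u" "halted \<tau> l" "halted \<tau> u"
  shows False
proof -
  have "push \<tau> l = Some F" "push \<tau> u = Some (opposite F)"
    using push_S[OF o t(1) l(1)] push_S[OF o t(1) u(1)] assms(4,5) l(2) u(2) t(2) by auto
  then have "edge_towards n (Y \<tau> u) (opposite F) = edge_towards n (Y \<tau> l) F"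
    using assms(6,7) by (simp add: halted_def)
  then have "Y \<tau> u = neighbour n (Y \<tau> l) F"
    by (rule edge_towards_facing[OF Y_less[OF u(1)] Y_less[OF l(1)]])
  then have "y \<tau> u mod n = m mod n"
    using coord_neighbour(1)[OF n0, of z F "Y \<tau> l"] y_l(1)[of \<tau>] y_u(1)[of \<tau>] assms(4) by auto
  moreover have "m < n" "0 < m" using assms(4,5) y_u(2)[of \<tau>] by auto
  ultimately show False using assms(5) y_u(2)[of \<tau>] by (cases "y \<tau> u = n") auto
qed

text \<open>The lower group has reached the goal \<open>m - 1\<close> of the previous phase, so at
  most the single step to \<open>m\<close> is left to it, and the upper group has not passed
  \<open>m\<close>.\<close>

definition phase_inv :: "nat \<Rightarrow> nat \<Rightarrow> bool" where
  "phase_inv m \<tau> \<longleftrightarrow> on \<tau> \<and> two \<tau> \<and> m \<le> Suc (y \<tau> l) \<and> m \<le> y \<tau> u \<and> y \<tau> l < y \<tau> u"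

lemma round_S:
  assumes i: "phase_inv m \<tau>" and o: "on (Suc \<tau>)" "Suc \<tau> \<le> (n + 3) * n"
    and t: "3 * n \<le> \<tau>" "\<tau> div n = m + 2" and m: "0 < m" "m \<le> n"
  shows "phase_inv m (Suc \<tau>)"
    "Suc (y (Suc \<tau>) l) = m \<Longrightarrow> Suc (y \<tau> l) = m \<and> (y \<tau> u = m \<and> y (Suc \<tau>) u = m \<or> y \<tau> u = Suc (y (Suc \<tau>) u))"
proof -
  have i': "on \<tau>" "two \<tau>" "m \<le> Suc (y \<tau> l)" "m \<le> y \<tau> u" "y \<tau> l < y \<tau> u" using i by (auto simp: phase_inv_def)
  have t2: "two (Suc \<tau>)" by (rule two_Suc[OF i'(2) o(1) t(1)])
  have ap: "y (Suc \<tau>) l \<noteq> y (Suc \<tau>) u" by (rule y_apart[OF t2 o])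
  note L = low_step[OF o(1) t i'(3)] and U = high_step[OF o(1) t m(1)]
  \<comment> \<open>In phase \<open>n\<close> the step of the lower group would end at
    \<open>z\<close>, where the upper group already is.\<close>
  have wrap: "m < n" if q: "y \<tau> l < m" "\<not> halted \<tau> l"
  proof (rule ccontr)
    assume "\<not> m < n"
    then have mn: "m = n" using m by simp
    then have yu: "y \<tau> u = n" using i'(4) y_u(2)[of \<tau>] by simp
    have "y (Suc \<tau>) l = 0" using L(3) q mn by simp
    then have zl: "Y (Suc \<tau>) l = z" using y_l(1)[of "Suc \<tau>"] z_coord[OF l(1), of F "Suc \<tau>"] by simp
    have "Y (Suc \<tau>) u = Y \<tau> u" using U(1) yu mn by simp
    moreover have "Y \<tau> u = z" using yu y_u(1)[of \<tau>] z_coord[OF u(1)] by simp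
    ultimately have "\<forall>a\<in>H. Y (Suc \<tau>) a = z" using y_two(1)[OF t2] zl by simp
    then show False using apart[OF o] by blast
  qed
  have yl: "y (Suc \<tau>) l = y \<tau> l \<or> Suc (y \<tau> l) = m \<and> y (Suc \<tau>) l = m"
    using L wrap i'(3) by (cases "m \<le> y \<tau> l"; cases "halted \<tau> l") auto
  have yu: "m \<le> y (Suc \<tau>) u" "y \<tau> u \<le> Suc (y (Suc \<tau>) u)"
    using U i'(4) by (cases "y \<tau> u \<le> m"; cases "halted \<tau> u"; auto)+
  have "y (Suc \<tau>) l < y (Suc \<tau>) u" using yl yu i' ap by auto
  then show "phase_inv m (Suc \<tau>)" using o(1) t2 yl yu i' by (auto simp: phase_inv_def)
  show "Suc (y \<tau> l) = m \<and> (y \<tau> u = m \<and> y (Suc \<tau>) u = m \<or> y \<tau> u = Suc (y (Suc \<tau>) u))"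
    if s: "Suc (y (Suc \<tau>) l) = m"
  proof -
    have e: "Suc (y \<tau> l) = m" using yl s by auto
    have hl: "halted \<tau> l"
    proof (rule ccontr)
      assume nh: "\<not> halted \<tau> l"
      then have "y (Suc \<tau>) l = m" using L(3) wrap e by simp
      then show False using s by simp
    qed
    show ?thesis
    proof (cases "y \<tau> u \<le> m")
      case True
      then show ?thesis using U(1) e i'(4) by simp
    next
      case False
      then have "\<not> halted \<tau> u" using not_both_halted[OF i'(1) t e _ hl] by auto
      then show ?thesis using U(3) False e by simp
    qed
  qed
qed

text \<open>A lower group kept at \<open>m - 1\<close> in each round uses up the missing edge, so an
  upper group above \<open>m\<close> advances in each of these rounds. Having started at
  \<open>n\<close> or below, it is at \<open>m\<close> after at most \<open>n\<close>
  rounds.\<close>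

lemma phase:
  assumes i: "phase_inv m ((m + 2) * n)" and m: "0 < m" "m \<le> n"
  shows "j \<le> n \<Longrightarrow> phase_inv m ((m + 2) * n + j)
    \<and> (Suc (y ((m + 2) * n + j) l) = m \<longrightarrow> y ((m + 2) * n + j) u = m \<or> y ((m + 2) * n + j) u + j \<le> n + m)"
proof (induction j)
  case 0
  then show ?case using i y_u(2)[of "(m + 2) * n"] by simp
next
  case (Suc j)
  define \<tau> where "\<tau> = (m + 2) * n + j"
  have I: "phase_inv m \<tau>" "Suc (y \<tau> l) = m \<longrightarrow> y \<tau> u = m \<or> y \<tau> u + j \<le> n + m"
    using Suc unfolding \<tau>_def by auto
  have j: "j < n" using Suc by simp
  have "\<tau> = j + (m + 2) * n" by (simp add: \<tau>_def)
  then have "\<tau> div n = m + 2 + j div n" using n0 by (simp only: div_mult_self1)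
  then have d: "\<tau> div n = m + 2" using j by simp
  have t3: "3 * n \<le> \<tau>" unfolding \<tau>_def using mult_le_mono1[of 3 "m + 2" n] m by linarith
  have "(m + 2) * n + n \<le> (n + 3) * n" using mult_le_mono1[of "m + 3" "n + 3" n] m by (simp add: algebra_simps)
  then have b: "Suc \<tau> \<le> (n + 3) * n" using j unfolding \<tau>_def by linarith
  have o: "on \<tau>" "two \<tau>" using I by (auto simp: phase_inv_def)
  have "on (Suc \<tau>)"
  proof (rule on_next[OF o(1)])
    show "\<tau> \<le> (n + 3) * n" using b by simp
    show "\<forall>a\<in>H. \<not> stop2 n (up \<tau> a)"
    proof
      fix a assume a: "a \<in> H"
      have "y \<tau> a = (if low a then y \<tau> l else y \<tau> u)" using y_two(2)[OF o(2) a] .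
      then show "\<not> stop2 n (up \<tau> a)"
        unfolding stop_S[OF o(1) t3 a] d using I(1) m by (auto simp: phase_inv_def)
    qed
  qed
  note r = round_S[OF I(1) this b t3 d m]
  have v: "phase_inv m (Suc \<tau>)" by (rule r(1))
  then have "m \<le> y (Suc \<tau>) u" by (simp add: phase_inv_def)
  then have "Suc (y (Suc \<tau>) l) = m \<longrightarrow> y (Suc \<tau>) u = m \<or> y (Suc \<tau>) u + Suc j \<le> n + m"
    using r(2) I(2) by auto
  then show ?case using v unfolding \<tau>_def by simp
qed

text \<open>A failure of the lower group would leave the groups at the neighbouring nodes
  \<open>m - 1\<close> and \<open>m\<close>, where \<open>stop2\<close> halts everybody at once;
  this is excluded by \<open>nowin\<close>.\<close>

lemma phase_end:
  assumes i: "phase_inv m ((m + 2) * n)" and m: "0 < m" "m \<le> n"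
  shows "phase_inv (Suc m) ((m + 3) * n)"
proof -
  define \<tau> where "\<tau> = (m + 3) * n"
  have e: "(m + 2) * n + n = \<tau>" by (simp add: \<tau>_def algebra_simps)
  have I: "phase_inv m \<tau>" "Suc (y \<tau> l) = m \<longrightarrow> y \<tau> u = m \<or> y \<tau> u + n \<le> n + m"
    using phase[OF i m, of n] unfolding e by auto
  have o: "on \<tau>" "two \<tau>" using I by (auto simp: phase_inv_def)
  have b: "\<tau> \<le> (n + 3) * n" unfolding \<tau>_def using m by (intro mult_le_mono1) simp
  have t4: "4 * n \<le> \<tau>" unfolding \<tau>_def using m by (intro mult_le_mono1) simp
  have "Suc (y \<tau> l) \<noteq> m"
  proof
    assume s: "Suc (y \<tau> l) = m"
    then have yu: "y \<tau> u = m" using I by (auto simp: phase_inv_def)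
    have "stop2 n (up \<tau> a)" if a: "a \<in> H" for a
    proof -
      have "y \<tau> a = (if low a then y \<tau> l else y \<tau> u)" using y_two(2)[OF o(2) a] .
      moreover have "\<tau> div n = m + 3" "\<tau> mod n = 0" using n0 by (simp_all add: \<tau>_def)
      moreover have "3 * n \<le> \<tau>" using t4 by simp
      ultimately show ?thesis using stop_S[OF o(1) _ a] t4 s yu by simp
    qed
    then have h: "\<forall>a\<in>H. halt \<tau> a" unfolding halt_def by blast
    have "coord n z F (neighbour n (Y \<tau> l) F) = coord n z F (Y \<tau> u)"
      using coord_neighbour(1)[OF n0, of z F "Y \<tau> l"] y_l(1)[of \<tau>] y_u(1)[of \<tau>] s yu by simp
    then have "neighbour n (Y \<tau> l) F = Y \<tau> u"
      by (rule coord_inj[OF neighbour_less[OF n0] Y_less[OF u(1)]])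
    then have "\<forall>a\<in>H. Y \<tau> a \<in> {Y \<tau> l, neighbour n (Y \<tau> l) F}" using y_two(1)[OF o(2)] by simp
    then have "near2 \<tau>" unfolding near2_def by blast
    then show False using nowin[OF b o(1) h] by blast
  qed
  then have "phase_inv (Suc m) \<tau>" using I(1) by (auto simp: phase_inv_def)
  then show ?thesis unfolding \<tau>_def .
qed

text \<open>After phase \<open>n\<close> the lower group would have reached coordinate
  \<open>n\<close>, but its coordinates are residues below \<open>n\<close>.\<close>

lemma impossible: False
proof -
  have "phase_inv (Suc m) ((m + 3) * n)" if "m \<le> n" for m
    using that
  proof (induction m)
    case 0
    have t: "two (3 * n)" using split_F unfolding split_by_def two_def by blast
    have "coord n z F (Y (3 * n) l) < (if Y (3 * n) u = z then n else coord n z F (Y (3 * n) u))"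
      using split_F l u unfolding split_by_def by blast
    then have "y (3 * n) l < y (3 * n) u" using l u by (simp add: y_def)
    then show ?case using t on_early[of "3 * n"] y_u(3)[of "3 * n"] by (simp add: phase_inv_def)
  next
    case (Suc m)
    have "(Suc m + 2) * n = (m + 3) * n" by (simp add: algebra_simps)
    then have "phase_inv (Suc m) ((Suc m + 2) * n)" using Suc by (metis Suc_leD)
    from phase_end[OF this] show ?case using Suc.prems by simp
  qed
  from this[of n] have "n \<le> y ((n + 3) * n) l" by (simp add: phase_inv_def)
  then show False using y_l(2)[of "(n + 3) * n"] by simp
qed

end

lemma (in meet) gathers: "\<exists>\<tau>\<le>(n + 3) * n. on \<tau> \<and> (\<forall>a\<in>H. halt \<tau> a) \<and> near2 \<tau>"
proof (rule ccontr)
  assume no: "\<not> ?thesis"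
  interpret elude S n H by unfold_locales (use no in blast)
  obtain F low where s: "split_by F low" using split by blast
  then obtain l u where "l \<in> H" "low l" "u \<in> H" "\<not> low u" unfolding split_by_def by blast
  then interpret seek S n H F low l u using s by unfold_locales
  show False by (rule impossible)
qed

section \<open>The theorem\<close>

text \<open>Phase \<open>n\<close> ends \<open>(n + 3) * n\<close> rounds after the exploration, and
  entering the terminal state takes one more round.\<close>

definition horizon :: "nat \<Rightarrow> nat" where
  "horizon n = tex n + (n + 3) * n + 1"

lemma horizon_bigo: "(\<lambda>n. real (horizon n)) \<in> O(\<lambda>n. (real n)\<^sup>2)"
proof (rule bigoI)
  show "\<forall>\<^sub>F n in sequentially. norm (real (horizon n)) \<le> 25 * norm ((real n)\<^sup>2)"
    using eventually_ge_at_top[of 1]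
  proof eventually_elim
    case (elim n)
    have "n * 1 \<le> n * n" using elim by (intro mult_le_mono2) simp
    moreover have "1 \<le> n * n" using elim by simp
    \<comment> \<open>The constant \<open>25\<close> is \<open>13 + 11 + 1\<close>, as
      \<open>n\<close> and \<open>1\<close> are at most \<open>n * n\<close>.\<close>
    moreover have "horizon n = 13 * (n * n) + 11 * n + 1"
      by (simp add: horizon_def tex_def win_def algebra_simps)
    ultimately have "horizon n \<le> 25 * (n * n)" by linarith
    then have "real (horizon n) \<le> real (25 * (n * n))" by (rule of_nat_mono)
    then show ?case by (simp add: power2_eq_square)
  qed
qed

text \<open>With at most two nodes every placement is gathered, so stopping at once is
  correct.\<close>

lemma (in scen) tiny:
  assumes "n \<le> 2"
  shows "solves_in S (prot n) \<and> (\<forall>a\<in>H. sta (prot n) 1 a = Term Gathering_Achieved)"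
proof -
  have t: "\<forall>a\<in>H. sta (prot n) 1 a = Term Gathering_Achieved"
    using sta_Suc[of "prot n" 0] assms by (simp add: prot_def)
  have g: "gathered S (run S (prot n) r)" for r
  proof -
    have "pos (prot n) r a \<in> {0, neighbour n 0 Clockwise}" if "a \<in> H" for a
      using pos_less[OF that, of "prot n" r] assms by (cases "n = 2") auto
    then show ?thesis unfolding gathered_iff by blast
  qed
  have "solves_in S (prot n)"
    by (rule solvesI[of _ 0 1]) (use t g in auto)
  then show ?thesis using t by blast
qed

lemma (in big) gathering:
  assumes "axial_frame n H"
  shows "solves_in S (prot n) \<and> (\<exists>T\<le>horizon n. \<forall>a\<in>H. st T a = Term Gathering_Achieved)"
  using exploration
proof (elim disjE conjE)
  assume "live (tex n)" "\<forall>a\<in>H. n \<le> mv (ob (tex n) a)"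
  then interpret meet S n H using assms by unfold_locales auto
  obtain \<tau> where \<tau>: "\<tau> \<le> (n + 3) * n" "on \<tau>" "\<forall>a\<in>H. halt \<tau> a" "near2 \<tau>"
    using gathers by blast
  have "tex n + Suc \<tau> \<le> horizon n" using \<tau>(1) by (simp add: horizon_def)
  then show ?thesis using win[OF \<tau>(2-4)] by blast
next
  assume s: "solves_in S (prot n)" and "\<exists>T\<le>tex n. \<forall>a\<in>H. st T a = Term Gathering_Achieved"
  then obtain T where "T \<le> tex n" "\<forall>a\<in>H. st T a = Term Gathering_Achieved" by blast
  then have "T \<le> horizon n \<and> (\<forall>a\<in>H. st T a = Term Gathering_Achieved)" by (simp add: horizon_def)
  then show ?thesis using s by blast
qed

text \<open>The test made by \<open>elect\<close> is invariant under changes of frame, so all agents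
  reach the same negative verdict, in the same round.\<close>

lemma (in big) detection:
  assumes na: "\<not> axial_frame n H"
  shows "solves_in S (prot n) \<or> detects_in S (prot n)"
  using exploration
proof (elim disjE conjE)
  assume lv: "live (tex n)" and ex: "\<forall>a\<in>H. n \<le> mv (ob (tex n) a)"
  have "st (Suc (tex n)) a = Term Config_Excluded" if a: "a \<in> H" for a
  proof -
    have s: "st (tex n) a = Active (Ex (em (tex n) a))" "tm (em (tex n) a) = tex n"
      using st_em tm_em lv a by auto
    have "set (seen (ob (tex n) a)) = coord n a (hdg a Left) ` H"
      using seen_explored[OF lv a] ex a by blast
    then have "elect n (set (seen (ob (tex n) a))) = None"
      using elect_None[OF n0 H_less[OF a]] na by simp
    then have "start2 n (ob (tex n) a) (V (tex n) a) = (Term Config_Excluded, None)"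
      by (simp add: start2_def)
    then show ?thesis using s by (simp add: sta_Suc act_Ex ob_def)
  qed
  then have "\<forall>a\<in>homebases S. state_of (run S (prot n) (Suc (tex n))) a = Term Config_Excluded"
    by (simp add: sta_def)
  then show ?thesis unfolding detects_in_def by blast
qed simp

lemma outcome:
  assumes S: "S \<in> scenarios n H" and H: "H \<in> configurations n"
  shows "solves_in S (prot n) \<or> detects_in S (prot n)"
    "\<not> periodic n H \<Longrightarrow> \<not> edge_edge n H \<Longrightarrow>
      solves_in S (prot n) \<and> (\<exists>T\<le>horizon n. \<forall>a\<in>H. state_of (run S (prot n) T) a = Term Gathering_Achieved)"
proof -
  interpret scen S n H using S H by unfold_locales
  interpret config n H using H by unfold_locales
  have "(solves_in S (prot n) \<or> detects_in S (prot n)) \<and>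
    (\<not> periodic n H \<longrightarrow> \<not> edge_edge n H \<longrightarrow>
      solves_in S (prot n) \<and> (\<exists>T\<le>horizon n. \<forall>a\<in>H. sta (prot n) T a = Term Gathering_Achieved))"
  proof (cases "n \<le> 2")
    case True
    have "1 \<le> horizon n" by (simp add: horizon_def)
    then show ?thesis using tiny[OF True] by blast
  next
    case False
    then interpret big S n H by unfold_locales simp
    show ?thesis
    proof (cases "axial_frame n H")
      case True
      then show ?thesis using gathering by blast
    next
      case na: False
      then show ?thesis using detection not_axial[OF n3 na] by blast
    qed
  qed
  then show "solves_in S (prot n) \<or> detects_in S (prot n)"
    "\<not> periodic n H \<Longrightarrow> \<not> edge_edge n H \<Longrightarrow>
      solves_in S (prot n) \<and> (\<exists>T\<le>horizon n. \<forall>a\<in>H. state_of (run S (prot n) T) a = Term Gathering_Achieved)"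
    unfolding sta_def by blast+
qed

definition gathering_protocol :: "nat \<Rightarrow> nat protocol" where
  "gathering_protocol n = nat_protocol (prot n)"

lemma gathering_protocol_good:
  assumes "H \<in> configurations n - (periodic_configs n \<union> edge_edge_configs n)"
  shows "solves_gathering n H (gathering_protocol n)"
    "terminates_within n H (gathering_protocol n) (horizon n)"
proof -
  have H: "H \<in> configurations n" "\<not> periodic n H" "\<not> edge_edge n H"
    using assms by (auto simp: periodic_configs_def edge_edge_configs_def)
  show "solves_gathering n H (gathering_protocol n)"
    unfolding solves_gathering_def gathering_protocol_def using outcome(2)[OF _ H] by simp
  show "terminates_within n H (gathering_protocol n) (horizon n)"
    unfolding terminates_within_def gathering_protocol_def
  proof
    fix S assume "S \<in> scenarios n H"
    then obtain T where "T \<le> horizon n" "\<forall>a\<in>H. state_of (run S (prot n) T) a = Term Gathering_Achieved"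
      using outcome(2)[OF _ H] by blast
    then show "\<exists>t\<le>horizon n. \<forall>a\<in>H. \<exists>v. state_of (run S (nat_protocol (prot n)) t) a = Term v"
      by (intro exI[of _ T]) simp
  qed
qed

theorem theorem6:
  "(\<exists>A :: nat \<Rightarrow> nat protocol. \<forall>n.
      \<forall>H \<in> configurations n - (periodic_configs n \<union> edge_edge_configs n).
        solves_gathering n H (A n)) \<and>
   (\<exists>(A :: nat \<Rightarrow> nat protocol) (T :: nat \<Rightarrow> nat).
      (\<lambda>n. real (T n)) \<in> O(\<lambda>n. (real n)\<^sup>2) \<and>
      (\<forall>n.
        (\<forall>H \<in> configurations n - (periodic_configs n \<union> edge_edge_configs n).
           solves_gathering n H (A n) \<and> terminates_within n H (A n) (T n)) \<and>
        (\<forall>H \<in> periodic_configs n \<union> edge_edge_configs n.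
           solves_or_detects n H (A n))))"
proof
  show "\<exists>A :: nat \<Rightarrow> nat protocol. \<forall>n.
      \<forall>H \<in> configurations n - (periodic_configs n \<union> edge_edge_configs n). solves_gathering n H (A n)"
    using gathering_protocol_good(1) by blast
  have "solves_or_detects n H (gathering_protocol n)"
    if "H \<in> periodic_configs n \<union> edge_edge_configs n" for n H
  proof -
    have H: "H \<in> configurations n" using that by (auto simp: periodic_configs_def edge_edge_configs_def)
    show ?thesis
      unfolding solves_or_detects_def gathering_protocol_def using outcome(1)[OF _ H] by simp
  qed
  then show "\<exists>(A :: nat \<Rightarrow> nat protocol) (T :: nat \<Rightarrow> nat).
      (\<lambda>n. real (T n)) \<in> O(\<lambda>n. (real n)\<^sup>2) \<and>
      (\<forall>n.
        (\<forall>H \<in> configurations n - (periodic_configs n \<union> edge_edge_configs n).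
           solves_gathering n H (A n) \<and> terminates_within n H (A n) (T n)) \<and>
        (\<forall>H \<in> periodic_configs n \<union> edge_edge_configs n. solves_or_detects n H (A n)))"
    using horizon_bigo gathering_protocol_good by (intro exI[of _ gathering_protocol] exI[of _ horizon]) blast
qed

end
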